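(* Assume that $d_{1,1}=0$, that $\overline{E_t}$ is a curve of genus one and that $\tau$ is of infinite order. Assume moreover that one of the $P_i$'s and one of the $Q_j$'s are not simultaneously fixed by an involution, i.e. there is no pair $(i,j)$ such that $P_i$ is fixed by $\iota_1$ or $\iota_2$ and $Q_j$ is fixed by $\iota_1$ or $\iota_2$. Then $b=x(\iota_1(y)-y)$ has a certificate in $\mathbb{C}(\overline{E_t})$ if and only if $P_0\sim P_1$.
   Context: Weighted model: a family of weights $d_{i,j}$, $(i,j)\in\{-1,0,1\}^2$, and a fixed $t\in\mathbb{C}$ transcendental over $\mathbb{Q}$. Kernel: $K(x,y,t)=xy\bigl(1-t\sum_{i,j}d_{i,j}x^iy^j\bigr)$, assumed irreducible in $\mathbb{C}[x,y]$ and of degree $2$ in each of $x$ and $y$. The kernel curve $\overline{E_t}\subset\mathbb{P}^1(\mathbb{C})\times\mathbb{P}^1(\mathbb{C})$ is the zero set of $\overline{K}(x_0,x_1,y_0,y_1,t)=x_0x_1y_0y_1-t\sum_{i,j=0}^2d_{i-1,j-1}x_0^ix_1^{2-i}y_0^jy_1^{2-j}$, with function field $\mathbb{C}(\overline{E_t})=\mathrm{Frac}\,\mathbb{C}[x,y]/(K)$, $x=x_0/x_1$, $y=y_0/y_1$. $\iota_1$ (resp. $\iota_2$) is the involution of $\overline{E_t}$ exchanging the two points (with multiplicity) of $\overline{E_t}$ having the same $x$-coordinate (resp. $y$-coordinate). On $\overline{E_t}$, $\tau=\iota_2\circ\iota_1$. These act on $\mathbb{C}(\overline{E_t})$ by composition,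 $f\mapsto f\circ\iota_1$ etc. A certificate for $b$ is $g\in\mathbb{C}(\overline{E_t})$ with $b=\tau(g)-g$. With $\infty=[1:0]$: $P_0,P_1$ are the two points (with multiplicity) of $\overline{E_t}$ with $x=\infty$, and $Q_0,Q_1$ are the two points (with multiplicity) of $\overline{E_t}$ with $y=\infty$. For $R,S\in\overline{E_t}$, $R\sim S$ means $R=\tau^n(S)$ for some $n\in\mathbb{Z}$. *)

theory Defs
  imports
    "HOL-Computational_Algebra.Computational_Algebra"
    "HOL-Algebra.Embedded_Algebras"
begin

text \<open>
  The complex projective line: the class of a nonzero pair \<open>(a, b)\<close> is the point
  with homogeneous coordinates \<open>[a : b]\<close>.
\<close>

definition proj_rel :: "complex \<times> complex \<Rightarrow> complex \<times> complex \<Rightarrow> bool" where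
  "proj_rel u v \<longleftrightarrow>
     u \<noteq> (0, 0) \<and> v \<noteq> (0, 0) \<and> (\<exists>c. c \<noteq> 0 \<and> v = (c * fst u, c * snd u))"

lemma part_equivp_proj_rel: "part_equivp proj_rel"
proof (rule part_equivpI)
  have "proj_rel (1, 1) (1, 1)" by (auto simp: proj_rel_def intro!: exI[of _ 1])
  then show "\<exists>u. proj_rel u u" ..
  show "symp proj_rel"
  proof (rule sympI)
    fix u v assume "proj_rel u v"
    then obtain c where c: "u \<noteq> (0, 0)" "v \<noteq> (0, 0)" "c \<noteq> 0" "v = (c * fst u, c * snd u)"
      unfolding proj_rel_def by blast
    then have "u = (inverse c * fst v, inverse c * snd v)" by (simp add: prod_eq_iff)
    with c show "proj_rel v u"
      unfolding proj_rel_def by (metis nonzero_imp_inverse_nonzero)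
  qed
  show "transp proj_rel"
  proof (rule transpI)
    fix u v w assume "proj_rel u v" "proj_rel v w"
    then obtain c e where c: "u \<noteq> (0, 0)" "v = (c * fst u, c * snd u)" "c \<noteq> 0"
      and e: "w \<noteq> (0, 0)" "w = (e * fst v, e * snd v)" "e \<noteq> 0"
      unfolding proj_rel_def by blast
    then have "w = ((e * c) * fst u, (e * c) * snd u)" "e * c \<noteq> 0" by (simp_all add: mult.assoc)
    with c(1) e(1) show "proj_rel u w" unfolding proj_rel_def by blast
  qed
qed

quotient_type cp1 = "complex \<times> complex" / partial: proj_rel
  by (rule part_equivp_proj_rel)

lift_definition cp1_infinity :: cp1 is "(1, 0)"
  by (auto simp: proj_rel_def intro!: exI[of _ 1])

lift_definition cp1_of_complex :: "complex \<Rightarrow> cp1" is "\<lambda>z. (z, 1)"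
  by (auto simp: proj_rel_def intro!: exI[of _ 1])


text \<open>
  A bivariate polynomial is an element of \<^typ>\<open>complex poly poly\<close>: the inner variable is
  \<open>x\<close>, the outer one is \<open>y\<close>.
\<close>

definition X :: "complex poly poly" where "X = [:[:0, 1:]:]"
definition Y :: "complex poly poly" where "Y = [:0, 1:]"
definition const2 :: "complex \<Rightarrow> complex poly poly" where "const2 c = [:[:c:]:]"

definition eval2 :: "complex poly poly \<Rightarrow> complex \<Rightarrow> complex \<Rightarrow> complex" where
  "eval2 p x y = poly (poly p [:y:]) x"

definition degree_x :: "complex poly poly \<Rightarrow> nat" where
  "degree_x p = (MAX j\<in>{..degree p}. degree (Polynomial.coeff p j))"

definition degree_y :: "complex poly poly \<Rightarrow> nat" where
  "degree_y p = degree p"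


text \<open>
  The kernel \<open>K(x,y,t) = x y (1 - t \<Sum> d\<^sub>i\<^sub>,\<^sub>j x\<^sup>i y\<^sup>j)\<close>, the sum ranging over
  \<open>i, j \<in> {-1, 0, 1}\<close>. Only these nine values of \<open>d\<close> are used, and the summation indices
  are shifted by one so that no negative power of \<open>x\<close> or \<open>y\<close> remains.
\<close>

definition walk_kernel :: "(int \<Rightarrow> int \<Rightarrow> complex) \<Rightarrow> complex \<Rightarrow> complex poly poly" where
  "walk_kernel d t =
     X * Y - const2 t * (\<Sum>i\<le>2. \<Sum>j\<le>2. const2 (d (int i - 1) (int j - 1)) * X ^ i * Y ^ j)"

definition kernel_hom ::
  "(int \<Rightarrow> int \<Rightarrow> complex) \<Rightarrow> complex \<Rightarrow> complex \<Rightarrow> complex \<Rightarrow> complex \<Rightarrow> complex \<Rightarrow> complex" where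
  "kernel_hom d t x0 x1 y0 y1 =
     x0 * x1 * y0 * y1 -
     t * (\<Sum>i\<le>2. \<Sum>j\<le>2. d (int i - 1) (int j - 1) * x0 ^ i * x1 ^ (2 - i) * y0 ^ j * y1 ^ (2 - j))"

lemma kernel_hom_scale_x:
  "kernel_hom d t (c * x0) (c * x1) y0 y1 = c ^ 2 * kernel_hom d t x0 x1 y0 y1"
  by (simp add: kernel_hom_def numeral_2_eq_2 algebra_simps)

lemma kernel_hom_scale_y:
  "kernel_hom d t x0 x1 (c * y0) (c * y1) = c ^ 2 * kernel_hom d t x0 x1 y0 y1"
  by (simp add: kernel_hom_def numeral_2_eq_2 algebra_simps)

lift_definition on_curve :: "(int \<Rightarrow> int \<Rightarrow> complex) \<Rightarrow> complex \<Rightarrow> cp1 \<Rightarrow> cp1 \<Rightarrow> bool" is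
  "\<lambda>d t u v. kernel_hom d t (fst u) (snd u) (fst v) (snd v) = 0"
  by (auto simp: proj_rel_def kernel_hom_scale_x kernel_hom_scale_y)

definition kernel_curve :: "(int \<Rightarrow> int \<Rightarrow> complex) \<Rightarrow> complex \<Rightarrow> (cp1 \<times> cp1) set" where
  "kernel_curve d t = {(a, b). on_curve d t a b}"


text \<open>
  \<open>x_fibre d t a b b'\<close>: the binary quadratic form \<open>kernel_hom d t a\<^sub>0 a\<^sub>1\<close> in \<open>(y\<^sub>0, y\<^sub>1)\<close> is a
  nonzero multiple of the product of the linear forms vanishing at \<open>b\<close> and at \<open>b'\<close>, i.e.
  \<open>b, b'\<close> are its two zeros, counted with multiplicity. The scalar \<open>c\<close> absorbs the choice of
  homogeneous coordinates. \<open>y_fibre\<close> is the same with the two coordinates exchanged.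
\<close>

lemma ex_scalar_cong:
  fixes F G :: "complex \<Rightarrow> complex \<Rightarrow> complex"
  assumes "k \<noteq> 0" "m \<noteq> 0"
  shows "(\<exists>c. c \<noteq> 0 \<and> (\<forall>z0 z1. k * F z0 z1 = c * (m * G z0 z1))) \<longleftrightarrow>
         (\<exists>c. c \<noteq> 0 \<and> (\<forall>z0 z1. F z0 z1 = c * G z0 z1))"
proof
  assume "\<exists>c. c \<noteq> 0 \<and> (\<forall>z0 z1. k * F z0 z1 = c * (m * G z0 z1))"
  then obtain c where "c \<noteq> 0" "\<forall>z0 z1. k * F z0 z1 = c * (m * G z0 z1)" by blast
  with assms show "\<exists>c. c \<noteq> 0 \<and> (\<forall>z0 z1. F z0 z1 = c * G z0 z1)"
    by (intro exI[of _ "c * m / k"]) (auto simp: field_simps)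
next
  assume "\<exists>c. c \<noteq> 0 \<and> (\<forall>z0 z1. F z0 z1 = c * G z0 z1)"
  then obtain c where "c \<noteq> 0" "\<forall>z0 z1. F z0 z1 = c * G z0 z1" by blast
  with assms show "\<exists>c. c \<noteq> 0 \<and> (\<forall>z0 z1. k * F z0 z1 = c * (m * G z0 z1))"
    by (intro exI[of _ "c * k / m"]) (auto simp: field_simps)
qed

lift_definition x_fibre :: "(int \<Rightarrow> int \<Rightarrow> complex) \<Rightarrow> complex \<Rightarrow> cp1 \<Rightarrow> cp1 \<Rightarrow> cp1 \<Rightarrow> bool" is
  "\<lambda>d t a b b'. \<exists>c. c \<noteq> 0 \<and> (\<forall>y0 y1. kernel_hom d t (fst a) (snd a) y0 y1 =
      c * ((snd b * y0 - fst b * y1) * (snd b' * y0 - fst b' * y1)))"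
proof -
  fix d t and u1 u2 v1 v2 w1 w2 :: "complex \<times> complex"
  assume "proj_rel u1 u2" "proj_rel v1 v2" "proj_rel w1 w2"
  then obtain k l m where k: "k \<noteq> 0" "u2 = (k * fst u1, k * snd u1)"
    and l: "l \<noteq> 0" "v2 = (l * fst v1, l * snd v1)"
    and m: "m \<noteq> 0" "w2 = (m * fst w1, m * snd w1)"
    unfolding proj_rel_def by blast
  have eq: "(snd v2 * y0 - fst v2 * y1) * (snd w2 * y0 - fst w2 * y1) =
      (l * m) * ((snd v1 * y0 - fst v1 * y1) * (snd w1 * y0 - fst w1 * y1))" for y0 y1
    by (simp add: l m algebra_simps)
  have eq': "kernel_hom d t (fst u2) (snd u2) y0 y1 =
      k ^ 2 * kernel_hom d t (fst u1) (snd u1) y0 y1" for y0 y1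
    by (simp add: k kernel_hom_scale_x)
  show "(\<exists>c. c \<noteq> 0 \<and> (\<forall>y0 y1. kernel_hom d t (fst u1) (snd u1) y0 y1 =
            c * ((snd v1 * y0 - fst v1 * y1) * (snd w1 * y0 - fst w1 * y1)))) =
        (\<exists>c. c \<noteq> 0 \<and> (\<forall>y0 y1. kernel_hom d t (fst u2) (snd u2) y0 y1 =
            c * ((snd v2 * y0 - fst v2 * y1) * (snd w2 * y0 - fst w2 * y1))))"
    unfolding eq eq' by (rule ex_scalar_cong[symmetric]) (use k l m in auto)
qed

lift_definition y_fibre :: "(int \<Rightarrow> int \<Rightarrow> complex) \<Rightarrow> complex \<Rightarrow> cp1 \<Rightarrow> cp1 \<Rightarrow> cp1 \<Rightarrow> bool" is
  "\<lambda>d t b a a'. \<exists>c. c \<noteq> 0 \<and> (\<forall>x0 x1. kernel_hom d t x0 x1 (fst b) (snd b) =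
      c * ((snd a * x0 - fst a * x1) * (snd a' * x0 - fst a' * x1)))"
proof -
  fix d t and u1 u2 v1 v2 w1 w2 :: "complex \<times> complex"
  assume "proj_rel u1 u2" "proj_rel v1 v2" "proj_rel w1 w2"
  then obtain k l m where k: "k \<noteq> 0" "u2 = (k * fst u1, k * snd u1)"
    and l: "l \<noteq> 0" "v2 = (l * fst v1, l * snd v1)"
    and m: "m \<noteq> 0" "w2 = (m * fst w1, m * snd w1)"
    unfolding proj_rel_def by blast
  have eq: "(snd v2 * x0 - fst v2 * x1) * (snd w2 * x0 - fst w2 * x1) =
      (l * m) * ((snd v1 * x0 - fst v1 * x1) * (snd w1 * x0 - fst w1 * x1))" for x0 x1
    by (simp add: l m algebra_simps)
  have eq': "kernel_hom d t x0 x1 (fst u2) (snd u2) =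
      k ^ 2 * kernel_hom d t x0 x1 (fst u1) (snd u1)" for x0 x1
    by (simp add: k kernel_hom_scale_y)
  show "(\<exists>c. c \<noteq> 0 \<and> (\<forall>x0 x1. kernel_hom d t x0 x1 (fst u1) (snd u1) =
            c * ((snd v1 * x0 - fst v1 * x1) * (snd w1 * x0 - fst w1 * x1)))) =
        (\<exists>c. c \<noteq> 0 \<and> (\<forall>x0 x1. kernel_hom d t x0 x1 (fst u2) (snd u2) =
            c * ((snd v2 * x0 - fst v2 * x1) * (snd w2 * x0 - fst w2 * x1))))"
    unfolding eq eq' by (rule ex_scalar_cong[symmetric]) (use k l m in auto)
qed

text \<open>\<open>P, P'\<close> are the two points, with multiplicity, of the curve whose \<open>x\<close>-coordinate
  (respectively \<open>y\<close>-coordinate) is \<open>a\<close>.\<close>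

definition same_x_pair ::
  "(int \<Rightarrow> int \<Rightarrow> complex) \<Rightarrow> complex \<Rightarrow> cp1 \<Rightarrow> cp1 \<times> cp1 \<Rightarrow> cp1 \<times> cp1 \<Rightarrow> bool" where
  "same_x_pair d t a P P' \<longleftrightarrow> fst P = a \<and> fst P' = a \<and> x_fibre d t a (snd P) (snd P')"

definition same_y_pair ::
  "(int \<Rightarrow> int \<Rightarrow> complex) \<Rightarrow> complex \<Rightarrow> cp1 \<Rightarrow> cp1 \<times> cp1 \<Rightarrow> cp1 \<times> cp1 \<Rightarrow> bool" where
  "same_y_pair d t b P P' \<longleftrightarrow> snd P = b \<and> snd P' = b \<and> y_fibre d t b (fst P) (fst P')"

definition iota1 :: "(int \<Rightarrow> int \<Rightarrow> complex) \<Rightarrow> complex \<Rightarrow> cp1 \<times> cp1 \<Rightarrow> cp1 \<times> cp1" where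
  "iota1 d t P = (THE P'. same_x_pair d t (fst P) P P')"

definition iota2 :: "(int \<Rightarrow> int \<Rightarrow> complex) \<Rightarrow> complex \<Rightarrow> cp1 \<times> cp1 \<Rightarrow> cp1 \<times> cp1" where
  "iota2 d t P = (THE P'. same_y_pair d t (snd P) P P')"

definition tau :: "(int \<Rightarrow> int \<Rightarrow> complex) \<Rightarrow> complex \<Rightarrow> cp1 \<times> cp1 \<Rightarrow> cp1 \<times> cp1" where
  "tau d t = iota2 d t \<circ> iota1 d t"

text \<open>Away from the curve the values of these maps are irrelevant; accordingly powers of \<open>tau\<close>
  are compared, and inverted, on the curve only.\<close>

definition tau_infinite_order :: "(int \<Rightarrow> int \<Rightarrow> complex) \<Rightarrow> complex \<Rightarrow> bool" where
  "tau_infinite_order d t \<longleftrightarrow>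
     (\<forall>n>0. \<exists>P\<in>kernel_curve d t. (tau d t ^^ n) P \<noteq> P)"

definition tau_power ::
  "(int \<Rightarrow> int \<Rightarrow> complex) \<Rightarrow> complex \<Rightarrow> int \<Rightarrow> cp1 \<times> cp1 \<Rightarrow> cp1 \<times> cp1" where
  "tau_power d t n =
     (if 0 \<le> n then tau d t ^^ nat n
      else inv_into (kernel_curve d t) (tau d t) ^^ nat (- n))"

definition same_orbit ::
  "(int \<Rightarrow> int \<Rightarrow> complex) \<Rightarrow> complex \<Rightarrow> cp1 \<times> cp1 \<Rightarrow> cp1 \<times> cp1 \<Rightarrow> bool" where
  "same_orbit d t R S \<longleftrightarrow> (\<exists>n. R = tau_power d t n S)"


text \<open>
  \<open>Frac \<complex>[x,y]/(K)\<close> for a prime \<open>K\<close>, as classes of pairs \<open>(p, q)\<close> standing for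
  \<open>p/q\<close>: \<open>q\<close> must be nonzero modulo \<open>K\<close>, and \<open>p/q = p'/q'\<close> iff \<open>p q' - p' q = 0\<close> modulo \<open>K\<close>.
\<close>

type_synonym rat_fun = "(complex poly poly \<times> complex poly poly) set"

definition frac_rel ::
  "complex poly poly \<Rightarrow> ((complex poly poly \<times> complex poly poly) \<times> (complex poly poly \<times> complex poly poly)) set" where
  "frac_rel K = {((p, q), (p', q')). \<not> K dvd q \<and> \<not> K dvd q' \<and> K dvd p * q' - p' * q}"

definition ratio :: "complex poly poly \<Rightarrow> complex poly poly \<Rightarrow> complex poly poly \<Rightarrow> rat_fun" where
  "ratio K p q = frac_rel K `` {(p, q)}"

definition function_field :: "complex poly poly \<Rightarrow> rat_fun ring" where
  "function_field K =
     \<lparr> carrier = {(p, q). \<not> K dvd q} // frac_rel K,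
       mult = (\<lambda>f g. \<Union>(p, q)\<in>f. \<Union>(p', q')\<in>g. ratio K (p * p') (q * q')),
       one = ratio K 1 1,
       zero = ratio K 0 1,
       add = (\<lambda>f g. \<Union>(p, q)\<in>f. \<Union>(p', q')\<in>g. ratio K (p * q' + p' * q) (q * q')) \<rparr>"

definition constants :: "complex poly poly \<Rightarrow> rat_fun set" where
  "constants K = range (\<lambda>c. ratio K (const2 c) 1)"


text \<open>
  Genus of an algebraic function field \<open>F\<close> in one variable over an algebraically closed field
  \<open>k\<close> of constants, following Riemann: the maximum of \<open>deg D + 1 - dim\<^sub>k L(D)\<close> over all
  divisors \<open>D\<close>. The places of \<open>F/k\<close>, i.e. the points of the smooth projective model, are
  represented by the normalised discrete valuations of \<open>F\<close> that are trivial on \<open>k\<close>; since \<open>k\<close>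
  is algebraically closed, all of them have degree one.
\<close>

definition places :: "('a, 'b) ring_scheme \<Rightarrow> 'a set \<Rightarrow> ('a \<Rightarrow> int) set" where
  "places F k =
     {v \<in> extensional (carrier F - {\<zero>\<^bsub>F\<^esub>}).
        v ` (carrier F - {\<zero>\<^bsub>F\<^esub>}) = UNIV \<and>
        (\<forall>c \<in> k - {\<zero>\<^bsub>F\<^esub>}. v c = 0) \<and>
        (\<forall>f \<in> carrier F - {\<zero>\<^bsub>F\<^esub>}. \<forall>g \<in> carrier F - {\<zero>\<^bsub>F\<^esub>}.
           v (f \<otimes>\<^bsub>F\<^esub> g) = v f + v g \<and>
           (f \<oplus>\<^bsub>F\<^esub> g \<noteq> \<zero>\<^bsub>F\<^esub> \<longrightarrow> min (v f) (v g) \<le> v (f \<oplus>\<^bsub>F\<^esub> g)))}"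

definition divisors :: "('a, 'b) ring_scheme \<Rightarrow> 'a set \<Rightarrow> (('a \<Rightarrow> int) \<Rightarrow> int) set" where
  "divisors F k = {D. {v. D v \<noteq> 0} \<subseteq> places F k \<and> finite {v. D v \<noteq> 0}}"

definition div_degree :: "(('a \<Rightarrow> int) \<Rightarrow> int) \<Rightarrow> int" where
  "div_degree D = (\<Sum>v | D v \<noteq> 0. D v)"

definition riemann_roch_space ::
  "('a, 'b) ring_scheme \<Rightarrow> 'a set \<Rightarrow> (('a \<Rightarrow> int) \<Rightarrow> int) \<Rightarrow> 'a set" where
  "riemann_roch_space F k D =
     {f \<in> carrier F. f = \<zero>\<^bsub>F\<^esub> \<or> (\<forall>v \<in> places F k. - D v \<le> v f)}"

definition has_genus :: "('a, 'b) ring_scheme \<Rightarrow> 'a set \<Rightarrow> int \<Rightarrow> bool" where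
  "has_genus F k g \<longleftrightarrow>
     (\<forall>D \<in> divisors F k. \<forall>n. ring.dimension F n k (riemann_roch_space F k D) \<longrightarrow>
        div_degree D + 1 - int n \<le> g) \<and>
     (\<exists>D \<in> divisors F k. \<exists>n. ring.dimension F n k (riemann_roch_space F k D) \<and>
        div_degree D + 1 - int n = g)"


text \<open>
  A rational function on the curve is determined by its values at all but finitely many points,
  so in the composition \<open>f \<circ> \<sigma>\<close> it suffices to compare values at affine points where a
  denominator does not vanish.
\<close>

definition has_value :: "rat_fun \<Rightarrow> cp1 \<times> cp1 \<Rightarrow> complex \<Rightarrow> bool" where
  "has_value f P c \<longleftrightarrow>
     (\<exists>x y p q. P = (cp1_of_complex x, cp1_of_complex y) \<and> (p, q) \<in> f \<and>
        eval2 q x y \<noteq> 0 \<and> c = eval2 p x y / eval2 q x y)"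

definition pullback ::
  "(int \<Rightarrow> int \<Rightarrow> complex) \<Rightarrow> complex \<Rightarrow> (cp1 \<times> cp1 \<Rightarrow> cp1 \<times> cp1) \<Rightarrow> rat_fun \<Rightarrow> rat_fun" where
  "pullback d t \<sigma> f =
     (THE h. h \<in> carrier (function_field (walk_kernel d t)) \<and>
        finite {P \<in> kernel_curve d t. \<not> (\<exists>c. has_value f (\<sigma> P) c \<and> has_value h P c)})"

definition has_certificate ::
  "(int \<Rightarrow> int \<Rightarrow> complex) \<Rightarrow> complex \<Rightarrow> rat_fun \<Rightarrow> bool" where
  "has_certificate d t b \<longleftrightarrow>
     (\<exists>g \<in> carrier (function_field (walk_kernel d t)).
        b = pullback d t (tau d t) g \<ominus>\<^bsub>function_field (walk_kernel d t)\<^esub> g)"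

definition x_fun :: "(int \<Rightarrow> int \<Rightarrow> complex) \<Rightarrow> complex \<Rightarrow> rat_fun" where
  "x_fun d t = ratio (walk_kernel d t) X 1"

definition y_fun :: "(int \<Rightarrow> int \<Rightarrow> complex) \<Rightarrow> complex \<Rightarrow> rat_fun" where
  "y_fun d t = ratio (walk_kernel d t) Y 1"

end

theory Submission
  imports Defs "HOL-Computational_Algebra.Field_as_Ring"
begin

text \<open>
  Write \<open>K = A y\<^sup>2 + B y + C\<close>, \<open>D = B\<^sup>2 - 4 A C\<close> and \<open>\<delta> = 2 A y + B\<close>, so \<open>\<delta>\<^sup>2 = D\<close>.
  Since \<open>d\<^sub>1\<^sub>,\<^sub>1 = 0\<close>, the point \<open>O = (\<infinity>, \<infinity>)\<close> is both a \<open>P\<^sub>i\<close> and a \<open>Q\<^sub>j\<close>, hence it is fixed by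
  neither involution; so \<open>D\<close> has degree four and \<open>A\<close> has degree one. If \<open>a\<close> is the root of \<open>A\<close>, then
  \<open>(x - a) (\<iota>\<^sub>1 y - y)\<close> is a constant multiple of \<open>\<delta>\<close>, and \<open>\<iota>\<^sub>1 y - y = \<tau> y - y\<close> because \<open>\<iota>\<^sub>2 y = y\<close>.
  Therefore \<open>b\<close> has a certificate iff \<open>\<delta>\<close> has one.

  The only poles of \<open>\<delta>\<close> are \<open>O\<close> and \<open>\<iota>\<^sub>1 O\<close>. If these lie in different orbits and
  \<open>\<delta> = \<tau> g - g\<close>, then along the infinite orbit of \<open>O\<close> the function \<open>g\<close> changes from regular to
  polar exactly once, although it has finitely many poles. Conversely, if \<open>\<iota>\<^sub>1 O = \<tau>\<^sup>n O\<close>, then some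
  point \<open>R\<close> of the orbit is fixed by \<open>\<iota>\<^sub>1\<close> or \<open>\<iota>\<^sub>2\<close>, according to the parity of \<open>n\<close>, and
  \<open>f = 1 / (x - x(R))\<close> or \<open>f = 1 / (y - y(R))\<close> has a double pole at \<open>R\<close> and no other. A
  difference of two translates of \<open>f\<close>, which telescopes, is antisymmetric under \<open>\<iota>\<^sub>1\<close> with the poles of
  \<open>\<delta>\<close>, and is a constant multiple of \<open>\<delta>\<close> because \<open>D\<close> is squarefree. The same description of the
  functions with poles over \<open>x = \<infinity>\<close> shows that the orbit of \<open>O\<close> is infinite when \<open>\<tau>\<close> has
  infinite order. Finally, if \<open>D\<close> were not squarefree, the function field would be purely
  transcendental, and then \<open>dim L(D) > deg D\<close> for every divisor, contradicting genus one.

  Places are handled through \<^emph>\<open>arcs\<close>: pairs of non-constant Laurent series satisfying the equation of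
  the curve. Rational functions are evaluated at arcs, and the order of the resulting series
  plays the role of the valuation.
\<close>

section \<open>Polynomials evaluated at Laurent series\<close>

text \<open>No group law, local parameters or degree theory of divisors is available on the curve;
  everything is read off from series. Since K is irreducible, a nonzero function has a nonzero value
  along every arc, so a single arc already embeds the function field, and identities may be checked
  there. Substituting x = a + s^2 makes D(x) a square at once and yields arcs through every point
  without Puiseux expansions. The price is that orders may come out doubled, so pole orders are
  bounded only along arcs where some function takes the value \<open>fls_X\<close>. Without
  translations on an elliptic curve, infinite order of \<tau> does not by itself exclude a finite
  orbit. If \<tau>^n fixes O, then x \<circ> \<tau>^n has at most simple poles, all over infinity,
  so it is a polynomial in x and invariant under \<open>iota1\<close>. As conjugation by
  \<open>iota1\<close> inverts \<tau>, this gives x \<circ> \<tau>^(2n) = x, and \<tau>^(4n) is the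
  identity. The genus is used only to exclude a conic: after removal of a double root r of D, the
  quotient \<delta> / ((x - r)(x - s)), with s another root, is the slope parameter of a conic and
  generates the field.\<close>

definition fls_poly :: "complex poly \<Rightarrow> complex fls \<Rightarrow> complex fls" where
  "fls_poly p f = fold_coeffs (\<lambda>c r. fls_const c + f * r) p 0"

lemma fls_poly_0 [simp]: "fls_poly 0 f = 0"
  by (simp add: fls_poly_def)

lemma fls_poly_pCons [simp]: "fls_poly (pCons c p) f = fls_const c + f * fls_poly p f"
  by (cases "p = 0 \<and> c = 0") (auto simp: fls_poly_def)

lemma fls_poly_1 [simp]: "fls_poly 1 f = 1"
  by (simp add: one_pCons)

lemma fls_poly_add [simp]: "fls_poly (p + q) f = fls_poly p f + fls_poly q f"
  by (induction p q rule: poly_induct2) (auto simp: algebra_simps simp flip: fls_plus_const)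

lemma fls_poly_minus [simp]: "fls_poly (- p) f = - fls_poly p f"
  by (induction p) (auto simp: algebra_simps)

lemma fls_poly_diff [simp]: "fls_poly (p - q) f = fls_poly p f - fls_poly q f"
  using fls_poly_add[of p "- q" f] by simp

lemma fls_poly_smult [simp]: "fls_poly (Polynomial.smult c p) f = fls_const c * fls_poly p f"
  by (induction p) (auto simp: algebra_simps simp flip: fls_const_mult_const)

lemma fls_poly_mult [simp]: "fls_poly (p * q) f = fls_poly p f * fls_poly q f"
  by (induction p) (auto simp: algebra_simps)

lemma fls_poly_power [simp]: "fls_poly (p ^ n) f = fls_poly p f ^ n"
  by (induction n) auto

definition nonconst :: "complex fls \<Rightarrow> bool" where
  "nonconst f \<longleftrightarrow> (\<forall>c. f \<noteq> fls_const c)"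

lemma nonconst_nz: "nonconst f \<Longrightarrow> f - fls_const c \<noteq> 0"
  by (auto simp: nonconst_def)

text \<open>Over the complex numbers the polynomial splits into linear factors, and Laurent series
  form a field, so some factor f - z vanishes. Thus \<open>nonconst\<close> means transcendental
  over the constants.\<close>

lemma fls_poly_eq_0_imp_const:
  assumes "p \<noteq> 0" "fls_poly p f = 0"
  shows "\<exists>c. f = fls_const c"
  using assms
proof (induction "degree p" arbitrary: p)
  case 0
  then obtain c where "p = [:c:]" by (metis degree_eq_zeroE)
  with 0 show ?case by simp
next
  case (Suc n)
  have "\<not> constant (poly p)"
    using Suc(2) constant_degree by (metis nat.distinct(1))
  then obtain z where "poly p z = 0" using fundamental_theorem_of_algebra by blast
  then obtain q where q: "p = [:- z, 1:] * q" by (metis poly_eq_0_iff_dvd dvdE)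
  with Suc have "q \<noteq> 0" by auto
  then have "degree p = Suc (degree q)" unfolding q by (subst degree_mult_eq) auto
  then have dq: "n = degree q" using Suc(2) by simp
  have "(f - fls_const z) * fls_poly q f = 0" using Suc(4) by (simp add: q algebra_simps)
  then show ?case using Suc(1)[OF dq \<open>q \<noteq> 0\<close>] by auto
qed

lemma fls_poly_nonzero: "nonconst f \<Longrightarrow> p \<noteq> 0 \<Longrightarrow> fls_poly p f \<noteq> 0"
  using fls_poly_eq_0_imp_const unfolding nonconst_def by blast

text \<open>Since \<open>fls_subdegree 0 = 0\<close>, the condition \<open>0 \<le> fls_ord f\<close> characterises power series, zero included.\<close>

abbreviation fls_ord :: "complex fls \<Rightarrow> int" where "fls_ord \<equiv> fls_subdegree"

abbreviation fls_res :: "complex fls \<Rightarrow> complex" where "fls_res f \<equiv> fls_nth f 0"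

lemma fls_ord_add_ge: "n \<le> fls_ord f \<Longrightarrow> n \<le> fls_ord g \<Longrightarrow> n \<le> 0 \<Longrightarrow> n \<le> fls_ord (f + g)"
  by (cases "f + g = 0") (use fls_plus_subdegree[of f g] in simp_all)

lemma fls_ord_diff_ge: "n \<le> fls_ord f \<Longrightarrow> n \<le> fls_ord g \<Longrightarrow> n \<le> 0 \<Longrightarrow> n \<le> fls_ord (f - g)"
  using fls_ord_add_ge[of n f "- g"] by simp

lemma fls_ord_mult_ge0: "0 \<le> fls_ord f \<Longrightarrow> 0 \<le> fls_ord g \<Longrightarrow> 0 \<le> fls_ord (f * g)"
  by (rule fls_mult_subdegree_ge_0)

lemma fls_res_mult:
  assumes "0 \<le> fls_ord f" "0 \<le> fls_ord g"
  shows "fls_res (f * g) = fls_res f * fls_res g"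
proof -
  have "f = fps_to_fls (fls_regpart f)" "g = fps_to_fls (fls_regpart g)"
    using assms by simp_all
  then obtain F G where "f = fps_to_fls F" "g = fps_to_fls G" by blast
  then show ?thesis by (simp add: fls_times_fps_to_fls[symmetric])
qed

lemma fls_ord_pos_iff: "0 \<le> fls_ord f \<Longrightarrow> fls_res f = 0 \<longleftrightarrow> f = 0 \<or> 0 < fls_ord f"
  by (metis fls_eq0_below_subdegree fls_zero_nth nth_fls_subdegree_nonzero order_le_less)

lemma fls_poly_integral: "0 \<le> fls_ord f \<Longrightarrow> 0 \<le> fls_ord (fls_poly p f) \<and> fls_res (fls_poly p f) = poly p (fls_res f)"
  by (induction p) (auto intro: fls_ord_add_ge fls_ord_mult_ge0 simp: fls_res_mult)

text \<open>The leading term dominates when f has a pole: each Horner step adds a constant of order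
  0 to a series of negative order.\<close>

lemma fls_ord_fls_poly_infinity:
  assumes "fls_ord f < 0" "p \<noteq> 0"
  shows "fls_ord (fls_poly p f) = int (degree p) * fls_ord f"
  using assms(2)
proof (induction p)
  case (pCons c p)
  show ?case
  proof (cases "p = 0")
    case False
    have f: "f \<noteq> 0" using assms(1) by auto
    have nz: "fls_poly p f \<noteq> 0"
      using fls_poly_eq_0_imp_const[OF False, of f] assms(1) by (auto)
    have s: "fls_ord (f * fls_poly p f) = fls_ord f + int (degree p) * fls_ord f"
      using False pCons.IH f nz by simp
    have "int (degree p) * fls_ord f \<le> 0" using assms(1) by (simp add: mult_nonneg_nonpos)
    then have "fls_ord (f * fls_poly p f) < 0" using s assms(1) by linarith
    then have "fls_ord (fls_poly (pCons c p) f) = fls_ord (f * fls_poly p f)"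
      using f nz by (simp add: fls_subdegree_add_eq2)
    with s False show ?thesis by (simp add: algebra_simps)
  qed (use pCons in simp)
qed simp

text \<open>Splitting off the full power of x - a leaves a cofactor that does not vanish at a and so
  evaluates to a power series of order 0.\<close>

lemma fls_ord_fls_poly_finite:
  assumes "0 < fls_ord (f - fls_const a)" "p \<noteq> 0"
  shows "fls_ord (fls_poly p f) = int (Polynomial.order a p) * fls_ord (f - fls_const a)"
proof -
  obtain q where q: "p = [:- a, 1:] ^ Polynomial.order a p * q" "\<not> [:- a, 1:] dvd q"
    using order_decomp[OF assms(2)] by blast
  have i: "0 \<le> fls_ord f" "fls_res f = a"
  proof -
    have "f = (f - fls_const a) + fls_const a" by simp
    also have "0 \<le> fls_ord \<dots>" by (rule fls_ord_add_ge) (use assms in auto)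
    finally show "0 \<le> fls_ord f" by simp
    have "fls_res (f - fls_const a) = 0" using assms by (intro fls_eq0_below_subdegree)
    then show "fls_res f = a" by simp
  qed
  have "poly q a \<noteq> 0" using q(2) poly_eq_0_iff_dvd by blast
  then have "fls_res (fls_poly q f) \<noteq> 0" "0 \<le> fls_ord (fls_poly q f)" using fls_poly_integral[OF i(1), of q] i(2) by auto
  then have "fls_ord (fls_poly q f) = 0" "fls_poly q f \<noteq> 0" using fls_ord_pos_iff[of "fls_poly q f"] by auto
  moreover have "f - fls_const a \<noteq> 0" using assms by auto
  ultimately have "fls_ord ((f - fls_const a) ^ Polynomial.order a p * fls_poly q f) = int (Polynomial.order a p) * fls_ord (f - fls_const a)"
    by (simp add: fls_subdegree_pow)
  moreover have "fls_poly p f = (f - fls_const a) ^ Polynomial.order a p * fls_poly q f"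
    by (subst q(1)) (simp add: algebra_simps)
  ultimately show ?thesis by simp
qed

text \<open>The unit part has a square root because its constant coefficient has one, and half of
  the even order shifts it back. This is what solves the equation of the curve for y.\<close>

lemma fls_even_square:
  fixes F :: "complex fls"
  assumes "F \<noteq> 0" "even (fls_ord F)"
  shows "\<exists>G. G ^ 2 = F"
proof -
  obtain m where m: "fls_ord F = 2 * m" using assms(2) by blast
  define b where "b = fls_base_factor_to_fps F"
  have b0: "fps_nth b 0 \<noteq> 0" using assms(1) by (simp add: b_def)
  have "(csqrt (fps_nth b 0)) ^ Suc 1 = fps_nth b 0" by (simp add: numeral_2_eq_2[symmetric])
  then have sq: "fps_radical (\<lambda>n x. csqrt x) (Suc 1) b ^ Suc 1 = b"
    using power_radical[of b "\<lambda>n x. csqrt x" 1] b0 by blast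
  define r where "r = fps_radical (\<lambda>n x. csqrt x) (Suc 1) b"
  have r: "r ^ 2 = b" using sq unfolding r_def by (simp add: numeral_2_eq_2)
  have "F = fls_shift (- fls_ord F) (fps_to_fls b)"
    unfolding b_def by (rule fls_conv_base_factor_to_fps_shift_subdegree)
  also have "\<dots> = fls_shift (- m) (fps_to_fls r) ^ 2"
    by (simp add: m r[symmetric] fls_shifted_pow fps_to_fls_power)
  finally show ?thesis by metis
qed

section \<open>The involutions on the points of the curve\<close>

abbreviation mk :: "complex \<times> complex \<Rightarrow> cp1" where "mk \<equiv> abs_cp1"

lemma proj_rel_refl: "u \<noteq> (0, 0) \<Longrightarrow> proj_rel u u"
  by (auto simp: proj_rel_def prod_eq_iff intro!: exI[of _ 1])

lemma mk_eq_iff: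
  assumes "u \<noteq> (0, 0)" "v \<noteq> (0, 0)"
  shows "mk u = mk v \<longleftrightarrow> fst u * snd v = fst v * snd u"
proof -
  have "mk u = mk v \<longleftrightarrow> proj_rel u v"
    using assms Quotient3_rel[OF Quotient3_cp1, of u v] by (simp add: proj_rel_refl)
  also have "\<dots> \<longleftrightarrow> fst u * snd v = fst v * snd u"
  proof
    assume "fst u * snd v = fst v * snd u"
    moreover have "fst u \<noteq> 0 \<or> snd u \<noteq> 0" "fst v \<noteq> 0 \<or> snd v \<noteq> 0"
      using assms by (auto simp: prod_eq_iff)
    ultimately have "v = ((snd v / snd u) * fst u, (snd v / snd u) * snd u) \<and> snd v / snd u \<noteq> 0 \<or>
        v = ((fst v / fst u) * fst u, (fst v / fst u) * snd u) \<and> fst v / fst u \<noteq> 0"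
      by (cases "fst u = 0"; cases "snd u = 0"; cases "fst v = 0"; cases "snd v = 0")
         (auto simp: prod_eq_iff field_simps)
    then show "proj_rel u v" using assms unfolding proj_rel_def by blast
  qed (auto simp: proj_rel_def)
  finally show ?thesis .
qed

lemma cp1_cases:
  obtains u0 u1 where "a = mk (u0, u1)" "(u0, u1) \<noteq> (0, 0)"
proof -
  have "\<exists>u. a = mk u \<and> proj_rel u u" by (induction a rule: cp1.abs_induct) blast
  then obtain u where "a = mk u" "proj_rel u u" by blast
  then show ?thesis using that[of "fst u" "snd u"] by (auto simp: proj_rel_def)
qed

lemma infinity_mk: "cp1_infinity = mk (1, 0)"
  by (simp add: cp1_infinity_def)

lemma of_complex_mk: "cp1_of_complex z = mk (z, 1)"
  by (simp add: cp1_of_complex_def)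

abbreviation affine :: "complex \<Rightarrow> complex \<Rightarrow> cp1 \<times> cp1" where
  "affine x y \<equiv> (cp1_of_complex x, cp1_of_complex y)"

lemma cp1_exhaust:
  obtains (fin) z where "a = cp1_of_complex z" | (inf) "a = cp1_infinity"
proof -
  obtain u0 u1 where a: "a = mk (u0, u1)" "(u0, u1) \<noteq> (0, 0)" by (rule cp1_cases)
  show ?thesis
  proof (cases "u1 = 0")
    case True
    then have "a = cp1_infinity" using a by (auto simp: infinity_mk mk_eq_iff)
    then show ?thesis by (rule inf)
  next
    case False
    then have "a = cp1_of_complex (u0 / u1)" using a by (auto simp: of_complex_mk mk_eq_iff)
    then show ?thesis by (rule fin)
  qed
qed

lemma of_complex_eq_iff [simp]: "cp1_of_complex z = cp1_of_complex w \<longleftrightarrow> z = w"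
  by (simp add: of_complex_mk mk_eq_iff)

lemma of_complex_neq_infinity [simp]:
  "cp1_of_complex z \<noteq> cp1_infinity" "cp1_infinity \<noteq> cp1_of_complex z"
  by (simp_all add: of_complex_mk infinity_mk mk_eq_iff)

definition kernel_coeff :: "(int \<Rightarrow> int \<Rightarrow> complex) \<Rightarrow> complex \<Rightarrow> nat \<Rightarrow> nat \<Rightarrow> complex" where
  "kernel_coeff d t i j = (if i = 1 \<and> j = 1 then 1 else 0) - t * d (int i - 1) (int j - 1)"

text \<open>The coefficients A, B, C of the overview as binary forms in the homogeneous coordinates
  of x; \<open>pA\<close>, \<open>pB\<close> and \<open>pC\<close> are the same at
  \<open>x1 = 1\<close>.\<close>

definition fA where "fA d t x0 x1 = kernel_coeff d t 0 2 * x1 ^ 2 + kernel_coeff d t 1 2 * x0 * x1 + kernel_coeff d t 2 2 * x0 ^ 2"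
definition fB where "fB d t x0 x1 = kernel_coeff d t 0 1 * x1 ^ 2 + kernel_coeff d t 1 1 * x0 * x1 + kernel_coeff d t 2 1 * x0 ^ 2"
definition fC where "fC d t x0 x1 = kernel_coeff d t 0 0 * x1 ^ 2 + kernel_coeff d t 1 0 * x0 * x1 + kernel_coeff d t 2 0 * x0 ^ 2"

lemma kernel_hom_form:
  "kernel_hom d t x0 x1 y0 y1 = fA d t x0 x1 * y0 ^ 2 + fB d t x0 x1 * y0 * y1 + fC d t x0 x1 * y1 ^ 2"
  unfolding kernel_hom_def fA_def fB_def fC_def kernel_coeff_def
  by (simp add: numeral_2_eq_2 algebra_simps)

text \<open>Exchanging the coordinates transposes the weights. Facts about \<open>iota2\<close> and
  y are then the facts about \<open>iota1\<close> and x for \<open>flip d\<close>.\<close>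

definition flip :: "(int \<Rightarrow> int \<Rightarrow> complex) \<Rightarrow> int \<Rightarrow> int \<Rightarrow> complex" where
  "flip d = (\<lambda>i j. d j i)"

lemma flip_flip [simp]: "flip (flip d) = d"
  by (simp add: flip_def)

lemma kernel_hom_flip: "kernel_hom (flip d) t y0 y1 x0 x1 = kernel_hom d t x0 x1 y0 y1"
  unfolding kernel_hom_def flip_def by (simp add: numeral_2_eq_2 algebra_simps)

lemma kernel_coeff_flip: "kernel_coeff (flip d) t i j = kernel_coeff d t j i"
  by (auto simp: kernel_coeff_def flip_def)

lemma on_curve_mk: "u \<noteq> (0, 0) \<Longrightarrow> v \<noteq> (0, 0) \<Longrightarrow>
   on_curve d t (mk u) (mk v) \<longleftrightarrow> kernel_hom d t (fst u) (snd u) (fst v) (snd v) = 0"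
  by (rule on_curve.abs_eq) (auto intro: proj_rel_refl)

lemma x_fibre_mk: "u \<noteq> (0, 0) \<Longrightarrow> v \<noteq> (0, 0) \<Longrightarrow> w \<noteq> (0, 0) \<Longrightarrow>
   x_fibre d t (mk u) (mk v) (mk w) \<longleftrightarrow>
   (\<exists>c. c \<noteq> 0 \<and> (\<forall>y0 y1. kernel_hom d t (fst u) (snd u) y0 y1 =
      c * ((snd v * y0 - fst v * y1) * (snd w * y0 - fst w * y1))))"
  by (rule x_fibre.abs_eq) (auto intro: proj_rel_refl)

lemma y_fibre_mk: "u \<noteq> (0, 0) \<Longrightarrow> v \<noteq> (0, 0) \<Longrightarrow> w \<noteq> (0, 0) \<Longrightarrow>
   y_fibre d t (mk u) (mk v) (mk w) \<longleftrightarrow>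
   (\<exists>c. c \<noteq> 0 \<and> (\<forall>x0 x1. kernel_hom d t x0 x1 (fst u) (snd u) =
      c * ((snd v * x0 - fst v * x1) * (snd w * x0 - fst w * x1))))"
  by (rule y_fibre.abs_eq) (auto intro: proj_rel_refl)

lemma on_curve_flip: "on_curve (flip d) t b a \<longleftrightarrow> on_curve d t a b"
proof -
  obtain u0 u1 where a: "a = mk (u0, u1)" "(u0, u1) \<noteq> (0, 0)" by (rule cp1_cases)
  obtain v0 v1 where b: "b = mk (v0, v1)" "(v0, v1) \<noteq> (0, 0)" by (rule cp1_cases)
  show ?thesis using a b by (simp add: on_curve_mk kernel_hom_flip[of d] del: prod.inject)
qed

lemma x_fibre_flip: "x_fibre (flip d) t b a a' \<longleftrightarrow> y_fibre d t b a a'"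
proof -
  obtain u0 u1 where a: "a = mk (u0, u1)" "(u0, u1) \<noteq> (0, 0)" by (rule cp1_cases)
  obtain v0 v1 where b: "b = mk (v0, v1)" "(v0, v1) \<noteq> (0, 0)" by (rule cp1_cases)
  obtain w0 w1 where a': "a' = mk (w0, w1)" "(w0, w1) \<noteq> (0, 0)" by (rule cp1_cases)
  show ?thesis using a b a'
    by (simp add: x_fibre_mk y_fibre_mk kernel_hom_flip[of d] del: prod.inject)
qed

text \<open>A binary quadratic form vanishing at a point is divisible by the linear form of that
  point. The pair \<open>(w0, w1)\<close> gives the cofactor, hence the second zero unless the form
  is zero.\<close>

lemma mk_factor:
  fixes v0 v1 :: complex
  assumes "(v0, v1) \<noteq> (0, 0)" "\<alpha> * v0 ^ 2 + \<beta> * v0 * v1 + \<gamma> * v1 ^ 2 = 0"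
  shows "\<exists>w0 w1. \<alpha> = v1 * w1 \<and> \<beta> = - (v1 * w0 + v0 * w1) \<and> \<gamma> = v0 * w0"
proof (cases "v1 = 0")
  case True
  with assms show ?thesis
    by (intro exI[of _ "\<gamma> / v0"] exI[of _ "- \<beta> / v0"]) auto
next
  case False
  define w1 w0 where "w1 = \<alpha> / v1" and "w0 = - (\<beta> + v0 * w1) / v1"
  have a: "\<alpha> = v1 * w1" and b: "v1 * w0 = - (\<beta> + v0 * w1)"
    using False by (simp_all add: w1_def w0_def)
  have "v1 ^ 2 * (v0 * w0) = v1 * v0 * (v1 * w0)" by (simp add: power2_eq_square)
  also have "\<dots> = - (\<alpha> * v0 ^ 2 + \<beta> * v0 * v1)"
    unfolding b a by (simp add: algebra_simps power2_eq_square)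
  also have "\<dots> = \<gamma> * v1 ^ 2" by (rule minus_unique[OF assms(2)])
  finally have "v1 ^ 2 * (v0 * w0) = v1 ^ 2 * \<gamma>" by (simp only: mult.commute)
  then have "\<gamma> = v0 * w0" using False by simp
  moreover have "\<beta> = - (v1 * w0 + v0 * w1)" unfolding b by simp
  ultimately show ?thesis using a by blast
qed

lemma ex_fibre:
  assumes "\<exists>y0 y1. kernel_hom d t u0 u1 y0 y1 \<noteq> 0" "(u0, u1) \<noteq> (0, 0)" "on_curve d t (mk (u0, u1)) b"
  shows "\<exists>b'. x_fibre d t (mk (u0, u1)) b b'"
proof -
  obtain v0 v1 where b: "b = mk (v0, v1)" "(v0, v1) \<noteq> (0, 0)" by (rule cp1_cases)
  have "kernel_hom d t u0 u1 v0 v1 = 0" using assms(2,3) b by (simp add: on_curve_mk)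
  then obtain w0 w1 where w: "fA d t u0 u1 = v1 * w1"
    "fB d t u0 u1 = - (v1 * w0 + v0 * w1)" "fC d t u0 u1 = v0 * w0"
    using mk_factor[OF b(2)] unfolding kernel_hom_form by blast
  have eq: "kernel_hom d t u0 u1 y0 y1 = (v1 * y0 - v0 * y1) * (w1 * y0 - w0 * y1)" for y0 y1
    unfolding kernel_hom_form w by (simp add: algebra_simps power2_eq_square)
  have "(w0, w1) \<noteq> (0, 0)" using assms(1) by (auto simp: eq)
  then have "x_fibre d t (mk (u0, u1)) b (mk (w0, w1))"
    using assms(2) b eq by (auto simp: x_fibre_mk intro!: exI[of _ 1])
  then show ?thesis ..
qed

lemma fibre_sym: "x_fibre d t a b b' \<Longrightarrow> x_fibre d t a b' b"
proof -
  assume "x_fibre d t a b b'"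
  moreover obtain u0 u1 where "a = mk (u0, u1)" "(u0, u1) \<noteq> (0, 0)" by (rule cp1_cases)
  moreover obtain v0 v1 where "b = mk (v0, v1)" "(v0, v1) \<noteq> (0, 0)" by (rule cp1_cases)
  moreover obtain w0 w1 where "b' = mk (w0, w1)" "(w0, w1) \<noteq> (0, 0)" by (rule cp1_cases)
  ultimately show ?thesis by (auto simp: x_fibre_mk mult.commute)
qed

lemma fibre_mem_iff:
  assumes "x_fibre d t a b b'"
  shows "on_curve d t a c \<longleftrightarrow> c = b \<or> c = b'"
proof -
  obtain u0 u1 where a: "a = mk (u0, u1)" "(u0, u1) \<noteq> (0, 0)" by (rule cp1_cases)
  obtain v0 v1 where b: "b = mk (v0, v1)" "(v0, v1) \<noteq> (0, 0)" by (rule cp1_cases)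
  obtain w0 w1 where b': "b' = mk (w0, w1)" "(w0, w1) \<noteq> (0, 0)" by (rule cp1_cases)
  obtain z0 z1 where c: "c = mk (z0, z1)" "(z0, z1) \<noteq> (0, 0)" by (rule cp1_cases)
  obtain k where "k \<noteq> 0" "\<forall>y0 y1. kernel_hom d t u0 u1 y0 y1 =
      k * ((v1 * y0 - v0 * y1) * (w1 * y0 - w0 * y1))"
    using assms a b b' by (auto simp: x_fibre_mk)
  then show ?thesis using a(2) b(2) b'(2) c(2) unfolding a b b' c
    by (auto simp: on_curve_mk mk_eq_iff mult.commute)
qed

text \<open>Each factorisation is evaluated at the residual zero of the other. Were these two zeros
  distinct, both would be proportional to \<open>(v0, v1)\<close>, which would then be
  \<open>(0, 0)\<close>.\<close>

lemma fibre_unique: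
  assumes "x_fibre d t a b b'" "x_fibre d t a b b''"
  shows "b' = b''"
proof -
  obtain u0 u1 where a: "a = mk (u0, u1)" "(u0, u1) \<noteq> (0, 0)" by (rule cp1_cases)
  obtain v0 v1 where b: "b = mk (v0, v1)" "(v0, v1) \<noteq> (0, 0)" by (rule cp1_cases)
  obtain w0 w1 where b': "b' = mk (w0, w1)" "(w0, w1) \<noteq> (0, 0)" by (rule cp1_cases)
  obtain z0 z1 where b'': "b'' = mk (z0, z1)" "(z0, z1) \<noteq> (0, 0)" by (rule cp1_cases)
  obtain k where k: "k \<noteq> 0" "\<And>y0 y1. kernel_hom d t u0 u1 y0 y1 =
      k * ((v1 * y0 - v0 * y1) * (w1 * y0 - w0 * y1))"
    using assms a b b' by (auto simp: x_fibre_mk)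
  obtain l where l: "l \<noteq> 0" "\<And>y0 y1. kernel_hom d t u0 u1 y0 y1 =
      l * ((v1 * y0 - v0 * y1) * (z1 * y0 - z0 * y1))"
    using assms a b b'' by (auto simp: x_fibre_mk)
  have 1: "v1 * w0 = v0 * w1 \<or> z1 * w0 = z0 * w1" using k(2)[of w0 w1] l(2)[of w0 w1] k(1) l(1)
    by auto
  have 2: "v1 * z0 = v0 * z1 \<or> w1 * z0 = w0 * z1" using k(2)[of z0 z1] l(2)[of z0 z1] k(1) l(1)
    by auto
  have "z1 * w0 = z0 * w1"
  proof (rule ccontr)
    assume n: "z1 * w0 \<noteq> z0 * w1"
    with 1 2 have "v1 * w0 = v0 * w1" "v1 * z0 = v0 * z1" by (auto simp: mult.commute)
    have "v0 * (z1 * w0) = (v1 * z0) * w0" using \<open>v1 * z0 = v0 * z1\<close> by simp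
    also have "\<dots> = z0 * (v1 * w0)" by simp
    also have "\<dots> = v0 * (z0 * w1)" by (simp only: \<open>v1 * w0 = v0 * w1\<close> mult_ac)
    finally have 3: "v0 = 0" using n by simp
    have "v1 * (z1 * w0) = z1 * (v1 * w0)" by simp
    also have "\<dots> = (v0 * z1) * w1" by (simp only: \<open>v1 * w0 = v0 * w1\<close> mult_ac)
    also have "\<dots> = v1 * (z0 * w1)" by (simp only: \<open>v1 * z0 = v0 * z1\<close>[symmetric] mult_ac)
    finally have 4: "v1 = 0" using n by simp
    from 3 4 b(2) show False by simp
  qed
  then show ?thesis using b' b'' by (simp add: mk_eq_iff mult.commute)
qed

definition pA where "pA d t = [:kernel_coeff d t 0 2, kernel_coeff d t 1 2, kernel_coeff d t 2 2:]"
definition pB where "pB d t = [:kernel_coeff d t 0 1, kernel_coeff d t 1 1, kernel_coeff d t 2 1:]"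
definition pC where "pC d t = [:kernel_coeff d t 0 0, kernel_coeff d t 1 0, kernel_coeff d t 2 0:]"

text \<open>A formal branch of the curve, possibly traversed more than once, as can happen for x = a
  + s^2. Both coordinates are required to be transcendental so that nonzero polynomials in x alone
  or y alone never vanish along it.\<close>

definition arc :: "(int \<Rightarrow> int \<Rightarrow> complex) \<Rightarrow> complex \<Rightarrow> complex fls \<Rightarrow> complex fls \<Rightarrow> bool" where
  "arc d t f g \<longleftrightarrow> nonconst f \<and> nonconst g \<and>
     fls_poly (pA d t) f * g ^ 2 + fls_poly (pB d t) f * g + fls_poly (pC d t) f = 0"

definition disc_root :: "(int \<Rightarrow> int \<Rightarrow> complex) \<Rightarrow> complex \<Rightarrow> complex fls \<Rightarrow> complex fls \<Rightarrow> complex fls" where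
  "disc_root d t f g = 2 * fls_poly (pA d t) f * g + fls_poly (pB d t) f"

lemma arc_flip: "arc (flip d) t g f \<longleftrightarrow> arc d t f g"
proof -
  have "fls_poly (pA (flip d) t) g * f ^ 2 + fls_poly (pB (flip d) t) g * f + fls_poly (pC (flip d) t) g =
      fls_poly (pA d t) f * g ^ 2 + fls_poly (pB d t) f * g + fls_poly (pC d t) f"
    unfolding pA_def pB_def pC_def kernel_coeff_flip by (simp add: algebra_simps power2_eq_square)
  then show ?thesis unfolding arc_def by auto
qed

text \<open>
  The consequences of irreducibility that are symmetric in \<open>x\<close> and \<open>y\<close>. Conditions \<open>ind1\<close> and \<open>ind2\<close>
  say that the two discriminants are not squares; they are stated for arcs so that exchanging
  \<open>x\<close> and \<open>y\<close> needs no transposition of bivariate polynomials.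
\<close>

locale biquad =
  fixes d :: "int \<Rightarrow> int \<Rightarrow> complex" and t :: complex
  assumes fibx: "(x0, x1) \<noteq> (0, 0) \<Longrightarrow> \<exists>y0 y1. kernel_hom d t x0 x1 y0 y1 \<noteq> 0"
    and fiby: "(y0, y1) \<noteq> (0, 0) \<Longrightarrow> \<exists>x0 x1. kernel_hom d t x0 x1 y0 y1 \<noteq> 0"
    and ind1: "arc d t f g \<Longrightarrow> fls_poly a f + fls_poly b f * disc_root d t f g = 0 \<Longrightarrow> a = 0 \<and> b = 0"
    and ind2: "arc d t f g \<Longrightarrow> fls_poly a g + fls_poly b g * disc_root (flip d) t g f = 0 \<Longrightarrow> a = 0 \<and> b = 0"
    and A1: "pA d t \<noteq> 0" and A2: "pA (flip d) t \<noteq> 0"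
begin

abbreviation "E \<equiv> kernel_curve d t"

lemma biquad_flip: "biquad (flip d) t"
  by unfold_locales
    (use fibx fiby ind1 ind2 A1 A2 in \<open>simp_all add: kernel_hom_flip arc_flip\<close>)

lemma iota1_eqI:
  assumes "same_x_pair d t (fst P) P P'"
  shows "iota1 d t P = P'"
  unfolding iota1_def
proof (rule the_equality)
  show "same_x_pair d t (fst P) P P'" by fact
  fix R assume "same_x_pair d t (fst P) P R"
  then show "R = P'" using assms fibre_unique unfolding same_x_pair_def by (auto simp: prod_eq_iff)
qed

lemma iota1_spec:
  assumes "P \<in> E"
  shows "same_x_pair d t (fst P) P (iota1 d t P)"
proof -
  obtain u0 u1 where a: "fst P = mk (u0, u1)" "(u0, u1) \<noteq> (0, 0)" by (rule cp1_cases)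
  have "on_curve d t (fst P) (snd P)" using assms by (auto simp: kernel_curve_def)
  then obtain b where "x_fibre d t (fst P) (snd P) b" using ex_fibre[OF fibx[OF a(2)] a(2)] a(1) by metis
  then have "same_x_pair d t (fst P) P (fst P, b)" by (simp add: same_x_pair_def)
  with iota1_eqI show ?thesis by metis
qed

lemma same_x_pair_in:
  assumes "same_x_pair d t a P P'"
  shows "P \<in> E" "P' \<in> E" "P' = iota1 d t P" "P = iota1 d t P'" "fst P = a" "fst P' = a"
proof -
  show ab: "fst P = a" "fst P' = a" using assms by (auto simp: same_x_pair_def)
  have "x_fibre d t a (snd P) (snd P')" using assms by (auto simp: same_x_pair_def)
  from fibre_mem_iff[OF this] ab show "P \<in> E" "P' \<in> E" by (auto simp: kernel_curve_def split: prod.splits)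
  show "P' = iota1 d t P" using iota1_eqI assms ab by metis
  have "same_x_pair d t a P' P" using assms fibre_sym by (auto simp: same_x_pair_def)
  then show "P = iota1 d t P'" using iota1_eqI ab by metis
qed

lemma iota1_in: "P \<in> E \<Longrightarrow> iota1 d t P \<in> E"
  and iota1_iota1: "P \<in> E \<Longrightarrow> iota1 d t (iota1 d t P) = P"
  and fst_iota1: "P \<in> E \<Longrightarrow> fst (iota1 d t P) = fst P"
  using same_x_pair_in[OF iota1_spec] by metis+

lemma same_fst_cases:
  assumes "P \<in> E" "Q \<in> E" "fst Q = fst P"
  shows "Q = P \<or> Q = iota1 d t P"
proof -
  have "x_fibre d t (fst P) (snd P) (snd (iota1 d t P))"
    using iota1_spec[OF assms(1)] by (auto simp: same_x_pair_def)
  moreover have "on_curve d t (fst P) (snd Q)" using assms by (auto simp: kernel_curve_def)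
  ultimately have "snd Q = snd P \<or> snd Q = snd (iota1 d t P)" using fibre_mem_iff by blast
  then show ?thesis using assms fst_iota1[OF assms(1)] by (auto simp: prod_eq_iff)
qed

lemma swap_in: "prod.swap P \<in> kernel_curve (flip d) t \<longleftrightarrow> P \<in> E"
  by (auto simp: kernel_curve_def on_curve_flip[of d] split: prod.splits)

lemma same_y_pair_flip: "same_y_pair d t b P P' \<longleftrightarrow> same_x_pair (flip d) t b (prod.swap P) (prod.swap P')"
  by (auto simp: same_x_pair_def same_y_pair_def x_fibre_flip)

lemma iota2_flip:
  assumes "P \<in> E"
  shows "iota2 d t P = prod.swap (iota1 (flip d) t (prod.swap P))"
proof -
  interpret sw: biquad "flip d" t by (rule biquad_flip)
  have P: "prod.swap P \<in> kernel_curve (flip d) t" using assms by (simp add: swap_in)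
  let ?R = "prod.swap (iota1 (flip d) t (prod.swap P))"
  show ?thesis unfolding iota2_def
  proof (rule the_equality)
    show "same_y_pair d t (snd P) P ?R"
      using sw.iota1_spec[OF P] by (simp add: same_y_pair_flip)
    fix Q assume "same_y_pair d t (snd P) P Q"
    then have "same_x_pair (flip d) t (snd P) (prod.swap P) (prod.swap Q)" by (simp add: same_y_pair_flip)
    then have "iota1 (flip d) t (prod.swap P) = prod.swap Q" using sw.iota1_eqI by simp
    then show "Q = ?R" by simp
  qed
qed

lemma iota2_in: "P \<in> E \<Longrightarrow> iota2 d t P \<in> E"
  and iota2_iota2: "P \<in> E \<Longrightarrow> iota2 d t (iota2 d t P) = P"
proof -
  interpret sw: biquad "flip d" t by (rule biquad_flip)
  assume P: "P \<in> E"
  then have P': "prod.swap P \<in> kernel_curve (flip d) t" by (simp add: swap_in)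
  show 1: "iota2 d t P \<in> E" using sw.iota1_in[OF P'] swap_in iota2_flip[OF P] by (metis swap_swap)
  show "iota2 d t (iota2 d t P) = P"
    using sw.iota1_iota1[OF P'] iota2_flip[OF P] iota2_flip[OF 1] by simp
qed

end

section \<open>The group generated by two involutions, for points and for arcs\<close>

locale dihedral =
  fixes S :: "'s set" and i1 i2 :: "'s \<Rightarrow> 's"
  assumes i1_in: "s \<in> S \<Longrightarrow> i1 s \<in> S" and i2_in: "s \<in> S \<Longrightarrow> i2 s \<in> S"
    and i1_i1: "s \<in> S \<Longrightarrow> i1 (i1 s) = s" and i2_i2: "s \<in> S \<Longrightarrow> i2 (i2 s) = s"
begin

text \<open>Negative powers iterate \<open>i1 \<circ> i2\<close>, which inverts
  \<open>i2 \<circ> i1\<close> on \<open>S\<close> only; every law below therefore assumes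
  membership in \<open>S\<close>.\<close>

definition rot :: "int \<Rightarrow> 's \<Rightarrow> 's" where
  "rot n s = (if 0 \<le> n then ((i2 \<circ> i1) ^^ nat n) s else ((i1 \<circ> i2) ^^ nat (- n)) s)"

lemma rot_0 [simp]: "rot 0 s = s"
  by (simp add: rot_def)

lemma rot_in: "s \<in> S \<Longrightarrow> rot n s \<in> S"
proof -
  assume s: "s \<in> S"
  have "((i2 \<circ> i1) ^^ m) s \<in> S" "((i1 \<circ> i2) ^^ m) s \<in> S" for m
    by (induction m) (auto simp: s i1_in i2_in)
  then show ?thesis by (simp add: rot_def)
qed

lemma rot_succ: "s \<in> S \<Longrightarrow> rot (n + 1) s = i2 (i1 (rot n s))"
proof (cases "0 \<le> n")
  case True
  then have "nat (n + 1) = Suc (nat n)" by simp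
  then show ?thesis using True by (simp add: rot_def)
next
  case False
  assume s: "s \<in> S"
  from False obtain m where m: "nat (- n) = Suc m" by (metis not0_implies_Suc zero_less_nat_eq neg_0_less_iff_less not_le less_irrefl)
  then have m': "nat (- (n + 1)) = m" "n + 1 \<le> 0" using False by linarith+
  have "rot n s = i1 (i2 (((i1 \<circ> i2) ^^ m) s))" using False m by (simp add: rot_def)
  moreover have "((i1 \<circ> i2) ^^ m) s = rot (n + 1) s" using m' by (auto simp: rot_def)
  ultimately show ?thesis using rot_in[OF s, of "n + 1"] by (simp add: i1_i1 i2_i2 i1_in i2_in)
qed

lemma rot_pred: "s \<in> S \<Longrightarrow> rot (n - 1) s = i1 (i2 (rot n s))"
  using rot_succ[of s "n - 1"] rot_in[of s "n - 1"] by (simp add: i1_i1 i2_i2 i1_in i2_in)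

lemma rot_add: "s \<in> S \<Longrightarrow> rot (m + n) s = rot m (rot n s)"
proof (induction m rule: int_induct[of _ 0])
  case (step1 i)
  then show ?case using rot_succ[of s "i + n"] rot_succ[of "rot n s" i] by (simp add: rot_in add_ac)
next
  case (step2 i)
  then show ?case using rot_pred[of s "i + n"] rot_pred[of "rot n s" i] by (simp add: rot_in algebra_simps)
qed simp

text \<open>The dihedral relation: conjugating \<open>i2 \<circ> i1\<close> by \<open>i1\<close>
  gives \<open>i1 \<circ> i2\<close>, its inverse.\<close>

lemma i1_rot: "s \<in> S \<Longrightarrow> i1 (rot n s) = rot (- n) (i1 s)"
proof (induction n rule: int_induct[of _ 0])
  case (step1 i)
  have e: "- (i + 1) = - i - 1" by simp
  show ?case unfolding e using step1 rot_succ[of s i] rot_pred[of "i1 s" "- i"]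
    by (simp add: i1_in)
next
  case (step2 i)
  have e: "- (i - 1) = - i + 1" by simp
  have "i1 (rot (- i) (i1 s)) = rot i s" using step2 rot_in[of s i] by (metis i1_i1)
  then show ?case unfolding e using step2 rot_pred[of s i] rot_succ[of "i1 s" "- i"] rot_in[of s i]
    by (simp add: i1_i1 i2_in i1_in)
qed simp

lemma rot_1: "rot 1 s = i2 (i1 s)"
  by (simp add: rot_def)

lemma rot_inj: "s \<in> S \<Longrightarrow> s' \<in> S \<Longrightarrow> rot n s = rot n s' \<Longrightarrow> s = s'"
  using rot_add[of s "- n" n] rot_add[of s' "- n" n] by simp

end

context biquad
begin

sublocale pts: dihedral E "iota1 d t" "iota2 d t"
  by unfold_locales (auto intro: iota1_in iota2_in iota1_iota1 iota2_iota2)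

lemma tau_bij: "bij_betw (tau d t) E E"
  by (rule bij_betwI[of _ _ _ "iota1 d t \<circ> iota2 d t"])
    (auto simp: tau_def iota1_in iota2_in iota1_iota1 iota2_iota2)

lemma inv_tau: "P \<in> E \<Longrightarrow> inv_into E (tau d t) P = iota1 d t (iota2 d t P)"
  by (rule inv_into_f_eq)
     (use tau_bij in \<open>auto simp: tau_def iota1_in iota2_in iota1_iota1 iota2_iota2 bij_betw_def\<close>)

lemma tau_power_rot:
  assumes "P \<in> E"
  shows "tau_power d t n P = pts.rot n P"
proof (cases "0 \<le> n")
  case True
  then show ?thesis by (simp add: tau_power_def pts.rot_def tau_def)
next
  case False
  have "(inv_into E (tau d t) ^^ m) P = ((iota1 d t \<circ> iota2 d t) ^^ m) P \<and> (inv_into E (tau d t) ^^ m) P \<in> E" for m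
    by (induction m) (auto simp: assms inv_tau iota1_in iota2_in)
  then show ?thesis using False by (simp add: tau_power_def pts.rot_def)
qed

lemma same_orbit_iff: "P \<in> E \<Longrightarrow> same_orbit d t R P \<longleftrightarrow> (\<exists>n. R = pts.rot n P)"
  by (simp add: same_orbit_def tau_power_rot)

end

section \<open>Arcs on the curve\<close>

lemma sum3_zeroD: "a + b + c = 0 \<Longrightarrow> c = - (a + b)" for a b c :: "'a::ab_group_add"
  using minus_unique by metis

text \<open>The limit of the series in the projective line at parameter 0; \<open>center\<close> is
  accordingly the point at which an arc is based.\<close>

definition val :: "complex fls \<Rightarrow> cp1" where
  "val f = (if 0 \<le> fls_ord f then cp1_of_complex (fls_res f) else cp1_infinity)"

definition center :: "complex fls \<times> complex fls \<Rightarrow> cp1 \<times> cp1" where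
  "center \<gamma> = (val (fst \<gamma>), val (snd \<gamma>))"

text \<open>Inverting a series with a pole gives homogeneous coordinates that are power series
  without common zero, so the limit can be read off from constant terms.\<close>

lemma val_homogeneous:
  obtains F0 F1 where "0 \<le> fls_ord F0" "0 \<le> fls_ord F1" "F1 \<noteq> 0" "f = F0 / F1"
    "(fls_res F0, fls_res F1) \<noteq> (0, 0)" "val f = mk (fls_res F0, fls_res F1)"
proof (cases "0 \<le> fls_ord f")
  case True
  show ?thesis by (rule that[of f 1]) (use True in \<open>auto simp: val_def of_complex_mk\<close>)
next
  case False
  then have "f \<noteq> 0" by auto
  then have "fls_res (inverse f) = 0" using False by (intro fls_eq0_below_subdegree) simp
  then show ?thesis
    by (intro that[of 1 "inverse f"]) (use False \<open>f \<noteq> 0\<close> in \<open>auto simp: val_def infinity_mk inverse_eq_divide[symmetric]\<close>)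
qed

lemma val_finiteD:
  assumes "val f = cp1_of_complex a" "nonconst f"
  shows "0 < fls_ord (f - fls_const a)" "0 \<le> fls_ord f" "fls_res f = a"
proof -
  show f: "0 \<le> fls_ord f" and a: "fls_res f = a" using assms by (auto simp: val_def split: if_splits)
  have "0 \<le> fls_ord (f - fls_const a)" by (rule fls_ord_diff_ge) (use f in auto)
  moreover have "fls_res (f - fls_const a) = 0" using a by simp
  ultimately show "0 < fls_ord (f - fls_const a)" using fls_ord_pos_iff[of "f - fls_const a"] nonconst_nz[OF assms(2)] by auto
qed

lemma val_infinite_iff: "val f = cp1_infinity \<longleftrightarrow> fls_ord f < 0"
  by (auto simp: val_def)

text \<open>Vieta: over a common x the two roots in y add up to -B/A.\<close>

definition arc_iota1 :: "(int \<Rightarrow> int \<Rightarrow> complex) \<Rightarrow> complex \<Rightarrow> complex fls \<times> complex fls \<Rightarrow> complex fls \<times> complex fls" where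
  "arc_iota1 d t \<gamma> = (fst \<gamma>, - fls_poly (pB d t) (fst \<gamma>) / fls_poly (pA d t) (fst \<gamma>) - snd \<gamma>)"

definition arc_iota2 :: "(int \<Rightarrow> int \<Rightarrow> complex) \<Rightarrow> complex \<Rightarrow> complex fls \<times> complex fls \<Rightarrow> complex fls \<times> complex fls" where
  "arc_iota2 d t \<gamma> = prod.swap (arc_iota1 (flip d) t (prod.swap \<gamma>))"

definition Arcs :: "(int \<Rightarrow> int \<Rightarrow> complex) \<Rightarrow> complex \<Rightarrow> (complex fls \<times> complex fls) set" where
  "Arcs d t = {(f, g). arc d t f g}"

definition disc :: "(int \<Rightarrow> int \<Rightarrow> complex) \<Rightarrow> complex \<Rightarrow> complex poly" where
  "disc d t = pB d t ^ 2 - 4 * pA d t * pC d t"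

lemma fls_poly_numeral [simp]: "fls_poly (numeral n) f = numeral n"
  by (metis fls_const_numeral numeral_poly fls_poly_0 fls_poly_pCons mult_zero_right add.right_neutral)

lemma swap_Arcs: "prod.swap \<gamma> \<in> Arcs (flip d) t \<longleftrightarrow> \<gamma> \<in> Arcs d t"
  by (auto simp: Arcs_def arc_flip split: prod.splits)

context biquad
begin

lemma ArcsD:
  assumes "\<gamma> \<in> Arcs d t"
  shows "arc d t (fst \<gamma>) (snd \<gamma>)" "nonconst (fst \<gamma>)" "nonconst (snd \<gamma>)"
    "fls_poly (pA d t) (fst \<gamma>) * snd \<gamma> ^ 2 + fls_poly (pB d t) (fst \<gamma>) * snd \<gamma> + fls_poly (pC d t) (fst \<gamma>) = 0"
    "fls_poly (pA d t) (fst \<gamma>) \<noteq> 0"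
  using assms fls_poly_nonzero[OF _ A1] by (auto simp: Arcs_def arc_def)

text \<open>A constant y = c would make K(x, c) vanish for a transcendental x, hence identically;
  the curve would contain a horizontal line, against \<open>fiby\<close>.\<close>

lemma nonconst_snd:
  assumes "nonconst f" "fls_poly (pA d t) f * g ^ 2 + fls_poly (pB d t) f * g + fls_poly (pC d t) f = 0"
  shows "nonconst g"
  unfolding nonconst_def
proof safe
  fix c assume c: "g = fls_const c"
  define p where "p = Polynomial.smult (c ^ 2) (pA d t) + Polynomial.smult c (pB d t) + pC d t"
  have "fls_poly p f = 0" using assms(2) by (simp add: p_def c algebra_simps fls_const_power)
  then have p: "p = 0" using fls_poly_nonzero[OF assms(1)] by blast
  have z: "fA d t x0 x1 * c ^ 2 + fB d t x0 x1 * c + fC d t x0 x1 = 0" for x0 x1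
  proof -
    have "c ^ 2 * kernel_coeff d t i 2 + c * kernel_coeff d t i 1 + kernel_coeff d t i 0 = 0" if "i \<le> 2" for i
    proof -
      have "poly.coeff p i = 0" using p by simp
      moreover have "i = 0 \<or> i = 1 \<or> i = 2" using that by auto
      ultimately show ?thesis
        by (auto simp: p_def pA_def pB_def pC_def numeral_2_eq_2)
    qed
    from this[of 0] this[of 1] this[of 2] have e: "kernel_coeff d t 0 0 = - (c ^ 2 * kernel_coeff d t 0 2 + c * kernel_coeff d t 0 1)"
      "kernel_coeff d t 1 0 = - (c ^ 2 * kernel_coeff d t 1 2 + c * kernel_coeff d t 1 1)"
      "kernel_coeff d t 2 0 = - (c ^ 2 * kernel_coeff d t 2 2 + c * kernel_coeff d t 2 1)"
      by (auto dest: sum3_zeroD)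
    show ?thesis unfolding fA_def fB_def fC_def e by (simp add: algebra_simps)
  qed
  then show False using fiby[of c 1] by (simp add: kernel_hom_form)
qed

lemma arc_iota1_in: "\<gamma> \<in> Arcs d t \<Longrightarrow> arc_iota1 d t \<gamma> \<in> Arcs d t"
proof -
  assume g: "\<gamma> \<in> Arcs d t"
  note D = ArcsD[OF g]
  define A B C where "A = fls_poly (pA d t) (fst \<gamma>)" "B = fls_poly (pB d t) (fst \<gamma>)" "C = fls_poly (pC d t) (fst \<gamma>)"
  have A: "A \<noteq> 0" and eq: "A * snd \<gamma> ^ 2 + B * snd \<gamma> + C = 0" using D by (simp_all add: A_B_C_def)
  have "A * (- B / A - snd \<gamma>) ^ 2 + B * (- B / A - snd \<gamma>) + C = A * snd \<gamma> ^ 2 + B * snd \<gamma> + C"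
    using A by (simp add: field_simps power2_eq_square)
  then have 1: "A * (- B / A - snd \<gamma>) ^ 2 + B * (- B / A - snd \<gamma>) + C = 0" using eq by simp
  then have "nonconst (- B / A - snd \<gamma>)"
    by (intro nonconst_snd[OF D(2)]) (simp only: A_B_C_def)
  with 1 D(2) have "arc d t (fst \<gamma>) (- B / A - snd \<gamma>)"
    unfolding arc_def A_B_C_def by blast
  then show ?thesis by (simp add: Arcs_def arc_iota1_def A_B_C_def)
qed

lemma arc_iota1_arc_iota1: "\<gamma> \<in> Arcs d t \<Longrightarrow> arc_iota1 d t (arc_iota1 d t \<gamma>) = \<gamma>"
  by (simp add: arc_iota1_def)

lemma fst_arc_iota1 [simp]: "fst (arc_iota1 d t \<gamma>) = fst \<gamma>"
  by (simp add: arc_iota1_def)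

lemma disc_root_arc_iota1: "\<gamma> \<in> Arcs d t \<Longrightarrow> disc_root d t (fst \<gamma>) (snd (arc_iota1 d t \<gamma>)) = - disc_root d t (fst \<gamma>) (snd \<gamma>)"
  using ArcsD[of \<gamma>] by (simp add: arc_iota1_def disc_root_def field_simps)

lemma disc_root_nz: "\<gamma> \<in> Arcs d t \<Longrightarrow> disc_root d t (fst \<gamma>) (snd \<gamma>) \<noteq> 0"
  using ind1[OF ArcsD(1), of \<gamma> 0 1] by auto

lemma disc_root_square:
  assumes "\<gamma> \<in> Arcs d t"
  shows "disc_root d t (fst \<gamma>) (snd \<gamma>) ^ 2 = fls_poly (disc d t) (fst \<gamma>)"
proof -
  define A B C where "A = fls_poly (pA d t) (fst \<gamma>)" "B = fls_poly (pB d t) (fst \<gamma>)" "C = fls_poly (pC d t) (fst \<gamma>)"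
  have "A * snd \<gamma> ^ 2 + B * snd \<gamma> + C = 0" using ArcsD[OF assms] by (simp add: A_B_C_def)
  then have "C = - (A * snd \<gamma> ^ 2 + B * snd \<gamma>)" by (rule sum3_zeroD)
  then have "(2 * A * snd \<gamma> + B) ^ 2 = B ^ 2 - 4 * A * C"
    by (simp only:) (simp add: algebra_simps power2_eq_square)
  then show ?thesis by (simp add: disc_root_def disc_def A_B_C_def)
qed

lemma arc_iota1_neq: "\<gamma> \<in> Arcs d t \<Longrightarrow> arc_iota1 d t \<gamma> \<noteq> \<gamma>"
  using disc_root_arc_iota1[of \<gamma>] disc_root_nz[of \<gamma>] by auto

lemma arcs_same_fst:
  assumes "\<gamma> \<in> Arcs d t" "\<gamma>' \<in> Arcs d t" "fst \<gamma>' = fst \<gamma>"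
  shows "\<gamma>' = \<gamma> \<or> \<gamma>' = arc_iota1 d t \<gamma>"
proof -
  define A B C where "A = fls_poly (pA d t) (fst \<gamma>)" "B = fls_poly (pB d t) (fst \<gamma>)" "C = fls_poly (pC d t) (fst \<gamma>)"
  have A: "A \<noteq> 0" and 1: "A * snd \<gamma> ^ 2 + B * snd \<gamma> + C = 0" using ArcsD[OF assms(1)] by (auto simp: A_B_C_def)
  have 2: "A * snd \<gamma>' ^ 2 + B * snd \<gamma>' + C = 0" using ArcsD[OF assms(2)] assms(3) by (simp add: A_B_C_def)
  have "(snd \<gamma>' - snd \<gamma>) * (A * (snd \<gamma>' + snd \<gamma>) + B) =
      (A * snd \<gamma>' ^ 2 + B * snd \<gamma>' + C) - (A * snd \<gamma> ^ 2 + B * snd \<gamma> + C)"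
    by (simp add: algebra_simps power2_eq_square)
  then have "(snd \<gamma>' - snd \<gamma>) * (A * (snd \<gamma>' + snd \<gamma>) + B) = 0" using 1 2 by simp
  then have "snd \<gamma>' - snd \<gamma> = 0 \<or> A * (snd \<gamma>' + snd \<gamma>) + B = 0" by (simp only: mult_eq_0_iff)
  then have "snd \<gamma>' = snd \<gamma> \<or> snd \<gamma>' = - B / A - snd \<gamma>"
  proof
    assume "A * (snd \<gamma>' + snd \<gamma>) + B = 0"
    then have "- B = A * (snd \<gamma>' + snd \<gamma>)" by (metis add.commute minus_unique)
    then show ?thesis using A by simp
  qed simp
  then show ?thesis using assms(3) by (auto simp: arc_iota1_def A_B_C_def prod_eq_iff)
qed

text \<open>Passing to the limit respects the factorisation A (Y - g) (Y - h) of the kernel over the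
  series f. Once denominators are cleared, the coefficients of the kernel form and those of the
  product of linear forms are power series, and neither triple vanishes entirely at 0. Hence their
  proportionality factor is a unit and the factorisation survives at the constant terms.\<close>

lemma center_pair:
  assumes "\<gamma> \<in> Arcs d t"
  shows "same_x_pair d t (val (fst \<gamma>)) (center \<gamma>) (center (arc_iota1 d t \<gamma>))"
proof -
  define f g h where "f = fst \<gamma>" "g = snd \<gamma>" "h = snd (arc_iota1 d t \<gamma>)"
  define A B C where "A = fls_poly (pA d t) f" "B = fls_poly (pB d t) f" "C = fls_poly (pC d t) f"
  have A: "A \<noteq> 0" and eq: "A * g ^ 2 + B * g + C = 0" using ArcsD[OF assms] by (simp_all add: A_B_C_def f_g_h_def)
  have h: "h = - B / A - g" by (simp add: arc_iota1_def A_B_C_def f_g_h_def)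
  have B: "B = - A * (g + h)" using A by (simp add: h field_simps)
  have "C = - (A * g ^ 2 + B * g)" using eq by (rule sum3_zeroD)
  then have C: "C = A * g * h" by (simp add: B algebra_simps power2_eq_square)
  obtain F0 F1 where F: "0 \<le> fls_ord F0" "0 \<le> fls_ord F1" "F1 \<noteq> 0" "f = F0 / F1"
    "(fls_res F0, fls_res F1) \<noteq> (0, 0)" "val f = mk (fls_res F0, fls_res F1)" by (rule val_homogeneous)
  obtain G0 G1 where G: "0 \<le> fls_ord G0" "0 \<le> fls_ord G1" "G1 \<noteq> 0" "g = G0 / G1"
    "(fls_res G0, fls_res G1) \<noteq> (0, 0)" "val g = mk (fls_res G0, fls_res G1)" by (rule val_homogeneous)
  obtain H0 H1 where H: "0 \<le> fls_ord H0" "0 \<le> fls_ord H1" "H1 \<noteq> 0" "h = H0 / H1"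
    "(fls_res H0, fls_res H1) \<noteq> (0, 0)" "val h = mk (fls_res H0, fls_res H1)" by (rule val_homogeneous)
  define L where "L p q r = fls_const p * F1 ^ 2 + fls_const q * (F0 * F1) + fls_const r * F0 ^ 2" for p q r
  have L: "0 \<le> fls_ord (L p q r)" "fls_res (L p q r) = p * fls_res F1 ^ 2 + q * fls_res F0 * fls_res F1 + r * fls_res F0 ^ 2" for p q r
    unfolding L_def power2_eq_square using F(1,2)
    by (auto intro!: fls_ord_add_ge fls_ord_mult_ge0 simp: fls_res_mult)
  have Lp: "L p q r = F1 ^ 2 * fls_poly [:p, q, r:] f" for p q r
    using F(3) by (simp add: L_def F(4) field_simps power2_eq_square)
  \<comment> \<open>The proportionality factor: A homogenised by the denominator of f and divided by
    those of the two linear forms.\<close>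
  define l where "l = F1 ^ 2 * A / (G1 * H1)"
  have l0: "l \<noteq> 0" using F G H A by (simp add: l_def)
  have eA: "L (kernel_coeff d t 0 2) (kernel_coeff d t 1 2) (kernel_coeff d t 2 2) = l * (G1 * H1)"
    using G H by (simp add: Lp l_def A_B_C_def pA_def)
  have "F1 ^ 2 * B = l * - (G0 * H1 + H0 * G1)"
    unfolding B l_def G(4) H(4) using G(3) H(3) by (simp add: field_simps)
  then have eB: "L (kernel_coeff d t 0 1) (kernel_coeff d t 1 1) (kernel_coeff d t 2 1) = l * - (G0 * H1 + H0 * G1)"
    by (simp only: Lp A_B_C_def pB_def)
  have "F1 ^ 2 * C = l * (G0 * H0)"
    unfolding C l_def G(4) H(4) using G(3) H(3) by (simp add: field_simps)
  then have eC: "L (kernel_coeff d t 0 0) (kernel_coeff d t 1 0) (kernel_coeff d t 2 0) = l * (G0 * H0)"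
    by (simp only: Lp A_B_C_def pC_def)
  define TA TB TC where T: "TA = G1 * H1" "TB = - (G0 * H1 + H0 * G1)" "TC = G0 * H0"
  have Ti: "0 \<le> fls_ord TA" "0 \<le> fls_ord TB" "0 \<le> fls_ord TC"
    unfolding T using G H by (auto intro!: fls_ord_add_ge fls_ord_mult_ge0 simp del: minus_add_distrib)
  have Tr: "fls_res TA = fls_res G1 * fls_res H1" "fls_res TB = - (fls_res G0 * fls_res H1 + fls_res H0 * fls_res G1)" "fls_res TC = fls_res G0 * fls_res H0"
    unfolding T using G H by (auto simp: fls_res_mult)
  have Tn: "fls_res TA \<noteq> 0 \<or> fls_res TB \<noteq> 0 \<or> fls_res TC \<noteq> 0"
    using G(5) H(5) unfolding Tr by auto
  define a b c where abc: "a = fA d t (fls_res F0) (fls_res F1)" "b = fB d t (fls_res F0) (fls_res F1)" "c = fC d t (fls_res F0) (fls_res F1)"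
  have an: "a \<noteq> 0 \<or> b \<noteq> 0 \<or> c \<noteq> 0" using fibx[OF F(5)] by (auto simp: kernel_hom_form abc)
  have r: "a = fls_res (l * TA)" "b = fls_res (l * TB)" "c = fls_res (l * TC)"
    and i: "0 \<le> fls_ord (l * TA)" "0 \<le> fls_ord (l * TB)" "0 \<le> fls_ord (l * TC)"
    unfolding T eA[symmetric] eB[symmetric] eC[symmetric] L abc fA_def fB_def fC_def by (simp_all add: L(1))
  \<comment> \<open>A positive order would annihilate the kernel form at the limit of f, against
    \<open>fibx\<close>; a negative order would annihilate the product of the two linear
    forms.\<close>
  have sl: "fls_ord l = 0"
  proof (rule ccontr)
    assume "fls_ord l \<noteq> 0"
    then consider "fls_ord l > 0" | "fls_ord l < 0" by linarith
    then show False
    proof cases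
      case 1
      then have "fls_res l = 0" "0 \<le> fls_ord l" by simp_all
      then show False using an r Ti by (simp add: fls_res_mult)
    next
      case 2
      then have "fls_res (inverse l) = 0" "0 \<le> fls_ord (inverse l)" using l0 by simp_all
      moreover have "TA = inverse l * (l * TA)" "TB = inverse l * (l * TB)" "TC = inverse l * (l * TC)"
        using l0 by simp_all
      ultimately have "fls_res TA = 0" "fls_res TB = 0" "fls_res TC = 0" using i by (metis mult_zero_left fls_res_mult)+
      then show False using Tn by simp
    qed
  qed
  then have rl: "fls_res l \<noteq> 0" using l0 nth_fls_subdegree_nonzero by metis
  have "kernel_hom d t (fls_res F0) (fls_res F1) y0 y1 =
      fls_res l * ((fls_res G1 * y0 - fls_res G0 * y1) * (fls_res H1 * y0 - fls_res H0 * y1))" for y0 y1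
  proof -
    have r': "a = fls_res l * (fls_res G1 * fls_res H1)" "b = fls_res l * - (fls_res G0 * fls_res H1 + fls_res H0 * fls_res G1)"
      "c = fls_res l * (fls_res G0 * fls_res H0)"
      unfolding r using fls_res_mult[of l] sl Ti Tr by (simp_all only: order_refl)
    show ?thesis
      unfolding kernel_hom_form abc[symmetric] r' by (simp add: algebra_simps power2_eq_square)
  qed
  then have "x_fibre d t (val f) (val g) (val h)"
    unfolding F(6) G(6) H(6) using F(5) G(5) H(5) rl by (auto simp: x_fibre_mk)
  then show ?thesis by (simp add: same_x_pair_def center_def f_g_h_def)
qed

lemma center_in: "\<gamma> \<in> Arcs d t \<Longrightarrow> center \<gamma> \<in> E"
  and center_arc_iota1: "\<gamma> \<in> Arcs d t \<Longrightarrow> center (arc_iota1 d t \<gamma>) = iota1 d t (center \<gamma>)"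
  by (rule same_x_pair_in(1)[OF center_pair], assumption)
     (rule same_x_pair_in(3)[OF center_pair], assumption)

lemma center_swap: "center (prod.swap \<gamma>) = prod.swap (center \<gamma>)"
  by (simp add: center_def)

lemma arc_iota2_in: "\<gamma> \<in> Arcs d t \<Longrightarrow> arc_iota2 d t \<gamma> \<in> Arcs d t"
  and arc_iota2_arc_iota2: "\<gamma> \<in> Arcs d t \<Longrightarrow> arc_iota2 d t (arc_iota2 d t \<gamma>) = \<gamma>"
  and snd_arc_iota2: "snd (arc_iota2 d t \<gamma>) = snd \<gamma>"
  and center_arc_iota2: "\<gamma> \<in> Arcs d t \<Longrightarrow> center (arc_iota2 d t \<gamma>) = iota2 d t (center \<gamma>)"
proof -
  interpret sw: biquad "flip d" t by (rule biquad_flip)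
  show "snd (arc_iota2 d t \<gamma>) = snd \<gamma>" by (simp add: arc_iota2_def)
  assume "\<gamma> \<in> Arcs d t"
  then have s: "prod.swap \<gamma> \<in> Arcs (flip d) t" by (simp add: swap_Arcs)
  show "arc_iota2 d t \<gamma> \<in> Arcs d t" using sw.arc_iota1_in[OF s] swap_Arcs[of "arc_iota2 d t \<gamma>" d t] by (simp add: arc_iota2_def)
  show "arc_iota2 d t (arc_iota2 d t \<gamma>) = \<gamma>" using sw.arc_iota1_arc_iota1[OF s] by (simp add: arc_iota2_def)
  show "center (arc_iota2 d t \<gamma>) = iota2 d t (center \<gamma>)"
    using sw.center_arc_iota1[OF s] iota2_flip[OF center_in[OF \<open>\<gamma> \<in> Arcs d t\<close>]] by (simp add: arc_iota2_def center_swap)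
qed

sublocale arcs: dihedral "Arcs d t" "arc_iota1 d t" "arc_iota2 d t"
  by unfold_locales (auto intro: arc_iota1_in arc_iota2_in arc_iota1_arc_iota1 arc_iota2_arc_iota2)

lemma center_rot:
  assumes "\<gamma> \<in> Arcs d t"
  shows "center (arcs.rot n \<gamma>) = pts.rot n (center \<gamma>)"
proof (induction n rule: int_induct[of _ 0])
  case (step1 i)
  then show ?case using assms by (simp add: arcs.rot_succ pts.rot_succ center_in center_arc_iota1 center_arc_iota2 arcs.rot_in arc_iota1_in)
next
  case (step2 i)
  then show ?case using assms by (simp add: arcs.rot_pred pts.rot_pred center_in center_arc_iota1 center_arc_iota2 arcs.rot_in arc_iota2_in)
qed simp

section \<open>Existence of arcs through prescribed points\<close>

lemma arc_over:
  assumes "nonconst f" "G ^ 2 = fls_poly (disc d t) f"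
  shows "(f, (G - fls_poly (pB d t) f) / (2 * fls_poly (pA d t) f)) \<in> Arcs d t"
proof -
  define A B C where "A = fls_poly (pA d t) f" "B = fls_poly (pB d t) f" "C = fls_poly (pC d t) f"
  have A: "A \<noteq> 0" using fls_poly_nonzero[OF assms(1) A1] by (simp add: A_B_C_def)
  have G: "G ^ 2 = B ^ 2 - 4 * A * C" using assms(2) by (simp add: disc_def A_B_C_def)
  define y where "y = (G - B) / (2 * A)"
  have "G = 2 * A * y + B" using A by (simp add: y_def)
  then have "4 * A * (A * y ^ 2 + B * y + C) = G ^ 2 - (B ^ 2 - 4 * A * C)"
    by (simp add: algebra_simps power2_eq_square)
  then have "A * y ^ 2 + B * y + C = 0" using A G by simp
  then have "arc d t f y" using assms(1) nonconst_snd[of f y] by (simp add: arc_def A_B_C_def)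
  then show ?thesis by (simp add: Arcs_def y_def A_B_C_def)
qed

lemma nonconst_X: "nonconst (fls_const a + fls_X ^ Suc n)" "nonconst (fls_X_inv ^ Suc n)"
proof -
  have "fls_ord (fls_X ^ Suc n) \<noteq> fls_ord (fls_const c)" for c by (simp add: fls_subdegree_pow del: power_Suc)
  then have *: "fls_X ^ Suc n \<noteq> fls_const c" for c :: complex by metis
  show "nonconst (fls_const a + fls_X ^ Suc n)" unfolding nonconst_def
  proof safe
    fix c assume "fls_const a + fls_X ^ Suc n = fls_const c"
    then have "fls_X ^ Suc n = fls_const (c - a)" by (simp add: algebra_simps flip: fls_minus_const)
    then show False using * by blast
  qed
  have "fls_ord (fls_X_inv ^ Suc n) \<noteq> fls_ord (fls_const c)" for c by (simp add: fls_subdegree_pow del: power_Suc)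
  then have *: "fls_X_inv ^ Suc n \<noteq> fls_const c" for c :: complex by metis
  then show "nonconst (fls_X_inv ^ Suc n)" unfolding nonconst_def by blast
qed

lemma disc_nz: "disc d t \<noteq> 0"
proof
  assume D: "disc d t = 0"
  have n: "nonconst (fls_const 0 + fls_X ^ Suc 0)" by (rule nonconst_X)
  let ?g = "(fls_const 0 + fls_X ^ Suc 0, (0 - fls_poly (pB d t) (fls_const 0 + fls_X ^ Suc 0)) / (2 * fls_poly (pA d t) (fls_const 0 + fls_X ^ Suc 0)))"
  have "?g \<in> Arcs d t" by (rule arc_over[OF n]) (simp add: D)
  from disc_root_square[OF this] disc_root_nz[OF this] show False by (simp add: D)
qed

lemma ex_arc_over:
  assumes "nonconst f" "even (fls_ord (fls_poly (disc d t) f))"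
  obtains g where "(f, g) \<in> Arcs d t"
proof -
  obtain G where "G ^ 2 = fls_poly (disc d t) f"
    using fls_even_square[OF fls_poly_nonzero[OF assms(1) disc_nz] assms(2)] by blast
  from arc_over[OF assms(1) this] that show ?thesis by blast
qed

text \<open>The substitution doubles the order of D(x), so the square root exists whether or not a
  is a root of D.\<close>

lemma ex_arc_finite: obtains g where "(fls_const a + fls_X ^ 2, g) \<in> Arcs d t"
proof -
  have n: "nonconst (fls_const a + fls_X ^ 2)" using nonconst_X(1)[of a 1] by (simp add: numeral_2_eq_2)
  have s: "fls_ord (fls_const a + fls_X ^ 2 - fls_const a) = 2" by (simp add: fls_subdegree_pow)
  have "even (fls_ord (fls_poly (disc d t) (fls_const a + fls_X ^ 2)))"
    by (subst fls_ord_fls_poly_finite[of _ a]) (simp_all only: s disc_nz, auto)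
  from ex_arc_over[OF n this] that show ?thesis by blast
qed

lemma val_X2: "val (fls_const a + fls_X ^ 2) = cp1_of_complex a"
proof -
  have "0 \<le> fls_ord (fls_const a + fls_X ^ 2)" by (rule fls_ord_add_ge) (auto simp: fls_subdegree_pow)
  moreover have "fls_res (fls_X ^ 2) = 0" by (intro fls_eq0_below_subdegree) (simp add: fls_subdegree_pow)
  ultimately show ?thesis by (simp add: val_def)
qed

lemma ex_arc_at:
  assumes "P \<in> E"
  obtains \<gamma> where "\<gamma> \<in> Arcs d t" "center \<gamma> = P"
proof -
  have "\<exists>f g. (f, g) \<in> Arcs d t \<and> val f = fst P"
  proof (cases "fst P" rule: cp1_exhaust)
    case (fin a)
    then show ?thesis using ex_arc_finite[of a] val_X2[of a] by metis
  next
    case inf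
    have n: "nonconst (fls_X_inv ^ 2)" using nonconst_X(2)[of 1] by (simp add: numeral_2_eq_2)
    have s: "fls_ord (fls_X_inv ^ 2 :: complex fls) = - 2" by (simp add: fls_subdegree_pow)
    have "even (fls_ord (fls_poly (disc d t) (fls_X_inv ^ 2)))"
      by (subst fls_ord_fls_poly_infinity) (simp_all only: s disc_nz, auto)
    from ex_arc_over[OF n this] show ?thesis by (metis inf s val_infinite_iff neg_less_0_iff_less zero_less_numeral)
  qed
  then obtain f g where fg: "(f, g) \<in> Arcs d t" "val f = fst P" by blast
  then have "fst P = fst (center (f, g))" by (simp add: center_def)
  \<comment> \<open>The arc found has the right x-coordinate; if it misses P, its conjugate passes
    through P.\<close>
  then have "P = center (f, g) \<or> P = iota1 d t (center (f, g))"
    using same_fst_cases[OF center_in[OF fg(1)] assms] by simp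
  then show ?thesis using that fg(1) arc_iota1_in center_arc_iota1 by metis
qed

end

text \<open>Rational functions are represented by terms, because a term can be evaluated at points and at
  arcs alike and composition becomes substitution.\<close>

datatype rexp = Cst complex | VX | VY | Add rexp rexp | Mul rexp rexp | Inv rexp

primrec rexp_eval :: "(complex \<Rightarrow> 'a::field) \<Rightarrow> 'a \<Rightarrow> 'a \<Rightarrow> rexp \<Rightarrow> 'a" where
  "rexp_eval h x y (Cst c) = h c"
| "rexp_eval h x y VX = x"
| "rexp_eval h x y VY = y"
| "rexp_eval h x y (Add a b) = rexp_eval h x y a + rexp_eval h x y b"
| "rexp_eval h x y (Mul a b) = rexp_eval h x y a * rexp_eval h x y b"
| "rexp_eval h x y (Inv a) = inverse (rexp_eval h x y a)"

primrec rexp_subst :: "rexp \<Rightarrow> rexp \<Rightarrow> rexp \<Rightarrow> rexp" where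
  "rexp_subst u v (Cst c) = Cst c"
| "rexp_subst u v VX = u"
| "rexp_subst u v VY = v"
| "rexp_subst u v (Add a b) = Add (rexp_subst u v a) (rexp_subst u v b)"
| "rexp_subst u v (Mul a b) = Mul (rexp_subst u v a) (rexp_subst u v b)"
| "rexp_subst u v (Inv a) = Inv (rexp_subst u v a)"

lemma rexp_eval_rexp_subst: "rexp_eval h x y (rexp_subst u v e) = rexp_eval h (rexp_eval h x y u) (rexp_eval h x y v) e"
  by (induction e) auto

abbreviation rf :: "complex fls \<times> complex fls \<Rightarrow> rexp \<Rightarrow> complex fls" where
  "rf \<gamma> e \<equiv> rexp_eval fls_const (fst \<gamma>) (snd \<gamma>) e"

abbreviation rc :: "complex \<Rightarrow> complex \<Rightarrow> rexp \<Rightarrow> complex" where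
  "rc x y e \<equiv> rexp_eval (\<lambda>c. c) x y e"

lemma poly_rexp: "\<exists>e. (\<forall>\<gamma>. rf \<gamma> e = fls_poly p (rf \<gamma> v)) \<and> (\<forall>x y. rc x y e = poly p (rc x y v))"
proof (induction p)
  case 0
  show ?case by (rule exI[of _ "Cst 0"]) simp
next
  case (pCons a p)
  then obtain e where "\<And>\<gamma>. rf \<gamma> e = fls_poly p (rf \<gamma> v)" "\<And>x y. rc x y e = poly p (rc x y v)" by blast
  then show ?case by (intro exI[of _ "Add (Cst a) (Mul v e)"]) simp
qed

lemma arc_iota1_rexp: "\<exists>e. (\<forall>\<gamma>. rf \<gamma> e = snd (arc_iota1 d t \<gamma>)) \<and>
    (\<forall>x y. rc x y e = - poly (pB d t) x / poly (pA d t) x - y)"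
proof -
  obtain a where a: "\<And>\<gamma>. rf \<gamma> a = fls_poly (pA d t) (rf \<gamma> VX)" "\<And>x y. rc x y a = poly (pA d t) (rc x y VX)"
    using poly_rexp by blast
  obtain b where b: "\<And>\<gamma>. rf \<gamma> b = fls_poly (pB d t) (rf \<gamma> VX)" "\<And>x y. rc x y b = poly (pB d t) (rc x y VX)"
    using poly_rexp by blast
  have m: "fls_const (- 1) = (-1 :: complex fls)" by simp
  show ?thesis
    by (rule exI[of _ "Add (Mul (Cst (-1)) (Mul b (Inv a))) (Mul (Cst (-1)) VY)"])
       (simp add: a b arc_iota1_def m divide_inverse)
qed

lemma arc_iota2_rexp: "\<exists>e. (\<forall>\<gamma>. rf \<gamma> e = fst (arc_iota2 d t \<gamma>)) \<and>
    (\<forall>x y. rc x y e = - poly (pB (flip d) t) y / poly (pA (flip d) t) y - x)"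
proof -
  obtain e where e: "\<And>\<gamma>. rf \<gamma> e = snd (arc_iota1 (flip d) t \<gamma>)" "\<And>x y. rc x y e =
    - poly (pB (flip d) t) x / poly (pA (flip d) t) x - y"
    using arc_iota1_rexp by blast
  have "rexp_eval h x y (rexp_subst VY VX e) = rexp_eval h y x e" for h and x y :: "'a::field" by (simp add: rexp_eval_rexp_subst)
  then show ?thesis using e by (intro exI[of _ "rexp_subst VY VX e"]) (simp add: rexp_eval_rexp_subst arc_iota2_def e(1)[of "prod.swap _", simplified])
qed

context biquad
begin

text \<open>Both involutions are given by terms, and substitution composes them, so every power of
  \<tau> acts by one pair of terms on all arcs simultaneously.\<close>

lemma rot_rexp:
  "\<exists>u v. \<forall>\<gamma> \<in> Arcs d t. arcs.rot n \<gamma> = (rf \<gamma> u, rf \<gamma> v)"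
proof -
  obtain e1 where e1: "\<And>\<gamma>. rf \<gamma> e1 = snd (arc_iota1 d t \<gamma>)" using arc_iota1_rexp by blast
  obtain e2 where e2: "\<And>\<gamma>. rf \<gamma> e2 = fst (arc_iota2 d t \<gamma>)" using arc_iota2_rexp by blast
  have j1: "\<exists>u v. \<forall>\<gamma> \<in> Arcs d t. arc_iota1 d t (\<phi> \<gamma>) = (rf \<gamma> u, rf \<gamma> v)"
    if "\<forall>\<gamma> \<in> Arcs d t. \<phi> \<gamma> = (rf \<gamma> u, rf \<gamma> v)" for \<phi> u v
  proof (intro exI ballI)
    fix \<gamma> assume "\<gamma> \<in> Arcs d t"
    then show "arc_iota1 d t (\<phi> \<gamma>) = (rf \<gamma> u, rf \<gamma> (rexp_subst u v e1))"
      using that e1[of "\<phi> \<gamma>"] by (simp add: rexp_eval_rexp_subst prod_eq_iff)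
  qed
  have j2: "\<exists>u v. \<forall>\<gamma> \<in> Arcs d t. arc_iota2 d t (\<phi> \<gamma>) = (rf \<gamma> u, rf \<gamma> v)"
    if "\<forall>\<gamma> \<in> Arcs d t. \<phi> \<gamma> = (rf \<gamma> u, rf \<gamma> v)" for \<phi> u v
  proof (intro exI ballI)
    fix \<gamma> assume "\<gamma> \<in> Arcs d t"
    then show "arc_iota2 d t (\<phi> \<gamma>) = (rf \<gamma> (rexp_subst u v e2), rf \<gamma> v)"
      using that e2[of "\<phi> \<gamma>"] snd_arc_iota2[of "\<phi> \<gamma>"] by (simp add: rexp_eval_rexp_subst prod_eq_iff)
  qed
  show ?thesis
  proof (induction n rule: int_induct[of _ 0])
    case base
    show ?case by (rule exI[of _ VX], rule exI[of _ VY]) simp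
  next
    case (step1 i)
    then obtain u v where "\<forall>\<gamma> \<in> Arcs d t. arcs.rot i \<gamma> = (rf \<gamma> u, rf \<gamma> v)" by blast
    from j1[OF this] obtain u v where "\<forall>\<gamma> \<in> Arcs d t. arc_iota1 d t (arcs.rot i \<gamma>) = (rf \<gamma> u, rf \<gamma> v)" by blast
    from j2[OF this] show ?case by (simp add: arcs.rot_succ)
  next
    case (step2 i)
    then obtain u v where "\<forall>\<gamma> \<in> Arcs d t. arcs.rot i \<gamma> = (rf \<gamma> u, rf \<gamma> v)" by blast
    from j2[OF this] obtain u v where "\<forall>\<gamma> \<in> Arcs d t. arc_iota2 d t (arcs.rot i \<gamma>) = (rf \<gamma> u, rf \<gamma> v)" by blast
    from j1[OF this] show ?case by (simp add: arcs.rot_pred)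
  qed
qed

lemma rot_rexp_subst: "\<exists>e'. \<forall>\<gamma> \<in> Arcs d t. rf \<gamma> e' = rf (arcs.rot n \<gamma>) e"
proof -
  obtain u v where "\<forall>\<gamma> \<in> Arcs d t. arcs.rot n \<gamma> = (rf \<gamma> u, rf \<gamma> v)" using rot_rexp by blast
  then show ?thesis by (intro exI[of _ "rexp_subst u v e"]) (simp add: rexp_eval_rexp_subst)
qed

end

section \<open>Ramification over the coordinate lines\<close>

text \<open>Up to sign, the order at which \<open>f\<close> attains its limit in the projective line.\<close>

definition ramification :: "complex fls \<Rightarrow> int" where
  "ramification f = (if fls_ord f < 0 then fls_ord f else fls_ord (f - fls_const (fls_res f)))"

lemma ramification_cases:
  assumes "nonconst f"
  shows "fls_ord f < 0 \<and> ramification f = fls_ord f \<or> 0 \<le> fls_ord f \<and> 0 < ramification f \<and> ramification f = fls_ord (f - fls_const (fls_res f))"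
proof (cases "fls_ord f < 0")
  case False
  then have "val f = cp1_of_complex (fls_res f)" by (simp add: val_def)
  from val_finiteD[OF this assms] False show ?thesis by (simp add: ramification_def)
qed (simp add: ramification_def)

text \<open>The order of p(f) is the ramification times the multiplicity of the limit of f as a root
  of p, or times the degree of p if f has a pole.\<close>

lemma ramification_dvd_fls_poly:
  assumes "nonconst f"
  shows "ramification f dvd fls_ord (fls_poly p f)"
proof (cases "p = 0")
  case False
  from ramification_cases[OF assms] show ?thesis
    using fls_ord_fls_poly_infinity[OF _ False, of f] fls_ord_fls_poly_finite[OF _ False, of f "fls_res f"] by auto
qed simp

lemma ramification_dvd_quot:
  assumes "nonconst f"
  shows "ramification f dvd fls_ord (fls_poly p f / fls_poly q f)"
proof (cases "fls_poly p f = 0 \<or> fls_poly q f = 0")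
  case False
  then show ?thesis using ramification_dvd_fls_poly[OF assms] by (simp add: fls_divide_subdegree)
qed auto

context biquad
begin

abbreviation \<delta> :: "complex fls \<times> complex fls \<Rightarrow> complex fls" where
  "\<delta> \<gamma> \<equiv> disc_root d t (fst \<gamma>) (snd \<gamma>)"

lemma ex_arc: "\<exists>\<gamma>. \<gamma> \<in> Arcs d t"
  using ex_arc_finite[of 0] by blast

text \<open>The functions form the quadratic extension of C(x) by \<delta>. Inverses come from
  multiplying by the conjugate, the norm being nonzero by \<open>ind1\<close>.\<close>

lemma rexp_normal_form:
  "\<exists>a b c. c \<noteq> 0 \<and> (\<forall>\<gamma>\<in>Arcs d t. rf \<gamma> e = (fls_poly a (fst \<gamma>) + fls_poly b (fst \<gamma>) * \<delta> \<gamma>) / fls_poly c (fst \<gamma>))"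
proof (induction e)
  case (Cst k)
  show ?case by (rule exI[of _ "[:k:]"], rule exI[of _ 0], rule exI[of _ 1]) simp
next
  case VX
  show ?case by (rule exI[of _ "[:0, 1:]"], rule exI[of _ 0], rule exI[of _ 1]) simp
next
  case VY
  show ?case
    by (rule exI[of _ "- pB d t"], rule exI[of _ 1], rule exI[of _ "2 * pA d t"])
       (use A1 ArcsD(5) in \<open>auto simp: disc_root_def\<close>)
next
  case (Add e1 e2)
  then obtain a b c a' b' c' where *: "c \<noteq> 0" "c' \<noteq> 0"
    "\<And>\<gamma>. \<gamma> \<in> Arcs d t \<Longrightarrow> rf \<gamma> e1 = (fls_poly a (fst \<gamma>) + fls_poly b (fst \<gamma>) * \<delta> \<gamma>) / fls_poly c (fst \<gamma>)"
    "\<And>\<gamma>. \<gamma> \<in> Arcs d t \<Longrightarrow> rf \<gamma> e2 = (fls_poly a' (fst \<gamma>) + fls_poly b' (fst \<gamma>) * \<delta> \<gamma>) / fls_poly c' (fst \<gamma>)" by metis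
  show ?case
  proof (rule exI[of _ "a * c' + a' * c"], rule exI[of _ "b * c' + b' * c"], rule exI[of _ "c * c'"], intro conjI ballI)
    fix \<gamma> assume g: "\<gamma> \<in> Arcs d t"
    have "fls_poly c (fst \<gamma>) \<noteq> 0" "fls_poly c' (fst \<gamma>) \<noteq> 0" using fls_poly_nonzero[OF ArcsD(2)[OF g]] * by auto
    then show "rf \<gamma> (Add e1 e2) = (fls_poly (a * c' + a' * c) (fst \<gamma>) + fls_poly (b * c' + b' * c) (fst \<gamma>) * \<delta> \<gamma>) / fls_poly (c * c') (fst \<gamma>)"
      by (simp add: *(3,4)[OF g] add_frac_eq algebra_simps)
  qed (use * in simp)
next
  case (Mul e1 e2)
  then obtain a b c a' b' c' where *: "c \<noteq> 0" "c' \<noteq> 0"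
    "\<And>\<gamma>. \<gamma> \<in> Arcs d t \<Longrightarrow> rf \<gamma> e1 = (fls_poly a (fst \<gamma>) + fls_poly b (fst \<gamma>) * \<delta> \<gamma>) / fls_poly c (fst \<gamma>)"
    "\<And>\<gamma>. \<gamma> \<in> Arcs d t \<Longrightarrow> rf \<gamma> e2 = (fls_poly a' (fst \<gamma>) + fls_poly b' (fst \<gamma>) * \<delta> \<gamma>) / fls_poly c' (fst \<gamma>)" by metis
  show ?case
  proof (rule exI[of _ "a * a' + b * b' * disc d t"], rule exI[of _ "a * b' + a' * b"], rule exI[of _ "c * c'"], intro conjI ballI)
    fix \<gamma> assume g: "\<gamma> \<in> Arcs d t"
    show "rf \<gamma> (Mul e1 e2) = (fls_poly (a * a' + b * b' * disc d t) (fst \<gamma>) + fls_poly (a * b' + a' * b) (fst \<gamma>) * \<delta> \<gamma>) / fls_poly (c * c') (fst \<gamma>)"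
      by (simp add: *(3,4)[OF g] disc_root_square[OF g, symmetric] algebra_simps power2_eq_square)
  qed (use * in simp)
next
  case (Inv e)
  then obtain a b c where *: "c \<noteq> 0"
    "\<And>\<gamma>. \<gamma> \<in> Arcs d t \<Longrightarrow> rf \<gamma> e = (fls_poly a (fst \<gamma>) + fls_poly b (fst \<gamma>) * \<delta> \<gamma>) / fls_poly c (fst \<gamma>)" by metis
  show ?case
  proof (cases "a = 0 \<and> b = 0")
    \<comment> \<open>By the convention \<open>inverse 0 = 0\<close> the inverse of the zero
      function is the fraction 0/1.\<close>
    case True
    show ?thesis
      by (rule exI[of _ 0], rule exI[of _ 0], rule exI[of _ 1]) (simp add: * True)
  next
    case False
    have nz: "fls_poly a (fst \<gamma>) + fls_poly b (fst \<gamma>) * \<delta> \<gamma> \<noteq> 0" "fls_poly a (fst \<gamma>) - fls_poly b (fst \<gamma>) * \<delta> \<gamma> \<noteq> 0"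
      if g: "\<gamma> \<in> Arcs d t" for \<gamma>
      using ind1[OF ArcsD(1)[OF g], of a b] ind1[OF ArcsD(1)[OF g], of a "- b"] False by auto
    have N: "fls_poly (a ^ 2 - b ^ 2 * disc d t) (fst \<gamma>) =
        (fls_poly a (fst \<gamma>) + fls_poly b (fst \<gamma>) * \<delta> \<gamma>) * (fls_poly a (fst \<gamma>) - fls_poly b (fst \<gamma>) * \<delta> \<gamma>)"
      if g: "\<gamma> \<in> Arcs d t" for \<gamma>
      by (simp add: disc_root_square[OF g, symmetric] algebra_simps power2_eq_square)
    show ?thesis
    proof (rule exI[of _ "a * c"], rule exI[of _ "- b * c"], rule exI[of _ "a ^ 2 - b ^ 2 * disc d t"], intro conjI ballI)
      obtain \<gamma> where g: "\<gamma> \<in> Arcs d t" using ex_arc by blast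
      show "a ^ 2 - b ^ 2 * disc d t \<noteq> 0"
      proof
        assume 0: "a ^ 2 - b ^ 2 * disc d t = 0"
        show False using N[OF g] nz[OF g] unfolding 0 by simp
      qed
    next
      fix \<gamma> assume g: "\<gamma> \<in> Arcs d t"
      define x y z where xyz: "x = fls_poly a (fst \<gamma>)" "y = fls_poly b (fst \<gamma>) * \<delta> \<gamma>" "z = fls_poly c (fst \<gamma>)"
      have n: "x + y \<noteq> 0" "x - y \<noteq> 0" using nz[OF g] by (auto simp: xyz)
      have "inverse ((x + y) / z) = ((x - y) * z) / ((x + y) * (x - y))" using n by simp
      also have "(x - y) * z = fls_poly (a * c) (fst \<gamma>) + fls_poly (- b * c) (fst \<gamma>) * \<delta> \<gamma>" by (simp add: xyz algebra_simps)
      finally show "rf \<gamma> (Inv e) = (fls_poly (a * c) (fst \<gamma>) + fls_poly (- b * c) (fst \<gamma>) * \<delta> \<gamma>) / fls_poly (a ^ 2 - b ^ 2 * disc d t) (fst \<gamma>)"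
        unfolding N[OF g] by (simp add: *(2)[OF g] xyz)
    qed
  qed
qed

text \<open>Trace, conjugate difference and norm. Trace and norm lie in C(x), so their orders along
  an arc are multiples of the ramification, which is the source of all bounds on it.\<close>

lemma rexp_conjugates:
  "\<exists>a b c n. c \<noteq> 0 \<and> (\<forall>\<gamma>\<in>Arcs d t.
     rf \<gamma> e + rf (arc_iota1 d t \<gamma>) e = fls_poly a (fst \<gamma>) / fls_poly c (fst \<gamma>) \<and>
     rf \<gamma> e - rf (arc_iota1 d t \<gamma>) e = fls_poly b (fst \<gamma>) / fls_poly c (fst \<gamma>) * \<delta> \<gamma> \<and>
     rf \<gamma> e * rf (arc_iota1 d t \<gamma>) e = fls_poly n (fst \<gamma>) / fls_poly (c ^ 2) (fst \<gamma>))"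
proof -
  obtain a b c where *: "c \<noteq> 0"
    "\<And>\<gamma>. \<gamma> \<in> Arcs d t \<Longrightarrow> rf \<gamma> e = (fls_poly a (fst \<gamma>) + fls_poly b (fst \<gamma>) * \<delta> \<gamma>) / fls_poly c (fst \<gamma>)"
    using rexp_normal_form by metis
  show ?thesis
  proof (rule exI[of _ "2 * a"], rule exI[of _ "2 * b"], rule exI[of _ c],
      rule exI[of _ "a ^ 2 - b ^ 2 * disc d t"], intro conjI ballI)
    fix \<gamma> assume g: "\<gamma> \<in> Arcs d t"
    have g': "rf (arc_iota1 d t \<gamma>) e = (fls_poly a (fst \<gamma>) - fls_poly b (fst \<gamma>) * \<delta> \<gamma>) / fls_poly c (fst \<gamma>)"
      using *(2)[OF arc_iota1_in[OF g]] by (simp add: disc_root_arc_iota1[OF g])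
    show "rf \<gamma> e + rf (arc_iota1 d t \<gamma>) e = fls_poly (2 * a) (fst \<gamma>) / fls_poly c (fst \<gamma>)"
      unfolding g' *(2)[OF g] by (simp add: add_divide_distrib diff_divide_distrib)
    show "rf \<gamma> e - rf (arc_iota1 d t \<gamma>) e = fls_poly (2 * b) (fst \<gamma>) / fls_poly c (fst \<gamma>) * \<delta> \<gamma>"
      unfolding g' *(2)[OF g] by (simp add: add_divide_distrib diff_divide_distrib)
    show "rf \<gamma> e * rf (arc_iota1 d t \<gamma>) e = fls_poly (a ^ 2 - b ^ 2 * disc d t) (fst \<gamma>) / fls_poly (c ^ 2) (fst \<gamma>)"
      unfolding g' *(2)[OF g]
      by (simp add: disc_root_square[OF g, symmetric] algebra_simps power2_eq_square)
  qed (rule *)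
qed

text \<open>The assumption \<open>rf \<gamma> e = fls_X\<close> says that the arc is a parametrisation without repetition.\<close>

lemma ramification_dvd_2:
  assumes g: "\<gamma> \<in> Arcs d t" and X: "rf \<gamma> e = fls_X"
  shows "ramification (fst \<gamma>) dvd 2"
    and "ramification (fst \<gamma>) dvd fls_ord (\<delta> \<gamma>) \<Longrightarrow> ramification (fst \<gamma>) dvd 1"
proof -
  let ?w = "ramification (fst \<gamma>)" and ?x = "fls_X :: complex fls" and ?x' = "rf (arc_iota1 d t \<gamma>) e"
  note n = ArcsD(2)[OF g]
  obtain a b c m where c: "c \<noteq> 0" and *:
     "?x + ?x' = fls_poly a (fst \<gamma>) / fls_poly c (fst \<gamma>)"
     "?x - ?x' = fls_poly b (fst \<gamma>) / fls_poly c (fst \<gamma>) * \<delta> \<gamma>"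
     "?x * ?x' = fls_poly m (fst \<gamma>) / fls_poly (c ^ 2) (fst \<gamma>)"
    using rexp_conjugates[of e] g X by metis
  have S: "?w dvd fls_ord (?x + ?x')" and N: "?w dvd fls_ord (?x * ?x')"
    unfolding * by (rule ramification_dvd_quot[OF n])+
  have D: "?w dvd fls_ord (?x - ?x')" if "?w dvd fls_ord (\<delta> \<gamma>)"
  proof (cases "fls_poly b (fst \<gamma>) / fls_poly c (fst \<gamma>) = 0")
    case False
    then have "fls_ord (?x - ?x') = fls_ord (fls_poly b (fst \<gamma>) / fls_poly c (fst \<gamma>)) + fls_ord (\<delta> \<gamma>)"
      unfolding * using disc_root_nz[OF g] by (rule fls_subdegree_mult)
    then show ?thesis using that ramification_dvd_quot[OF n] by simp
  next
    case True
    then have "?x - ?x' = 0" unfolding * by (simp only: mult_zero_left)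
    then show ?thesis by (simp only: fls_zero_subdegree dvd_0_right)
  qed
  \<comment> \<open>If the conjugate of \<open>fls_X\<close> is zero or its order differs from 1,
    the trace has the smaller of the orders present, and trace and norm together force
    \<open>?w dvd 1\<close>. In the remaining case the norm has order 2.\<close>
  have 1: "?w dvd 1 \<or> ?x' \<noteq> 0 \<and> fls_ord ?x' = 1"
  proof (cases "?x' = 0")
    case False
    have N': "?w dvd 1 + fls_ord ?x'" using N False by simp
    consider "fls_ord ?x' < 1" | "fls_ord ?x' = 1" | "1 < fls_ord ?x'" by linarith
    then show ?thesis
    proof cases
      case 1
      then have "?w dvd fls_ord ?x'" using S False fls_subdegree_add_eq2[of ?x' ?x] by simp
      then have "?w dvd (1 + fls_ord ?x') - fls_ord ?x'" using N' dvd_diff by blast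
      then show ?thesis by simp
    next
      case 3
      then have "fls_ord (?x + ?x') = 1" using fls_subdegree_add_eq1[of ?x ?x'] by simp
      then show ?thesis using S by simp
    qed (use False in simp)
  qed (use S in simp)
  then show "?w dvd 2"
  proof
    assume "?w dvd 1"
    then show ?thesis by (rule dvd_trans) simp
  next
    assume "?x' \<noteq> 0 \<and> fls_ord ?x' = 1"
    then show ?thesis using N by simp
  qed
  show "?w dvd 1" if "?w dvd fls_ord (\<delta> \<gamma>)"
    using 1
  proof
    assume x': "?x' \<noteq> 0 \<and> fls_ord ?x' = 1"
    have nz: "fls_nth ?x' 0 = 0" "fls_nth ?x' k = 0" if "k < 1" for k using x' that by auto
    have s: "fls_ord f = 1" if "fls_nth f 1 \<noteq> 0" "\<And>k. k < 1 \<Longrightarrow> fls_nth f k = 0" for f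
      by (rule fls_subdegree_eqI) (use that in auto)
    \<comment> \<open>Trace and difference add up to twice \<open>fls_X\<close>, so one of them has
      order exactly 1.\<close>
    have "fls_nth (?x + ?x') 1 + fls_nth (?x - ?x') 1 \<noteq> 0" by simp
    then consider "fls_nth (?x + ?x') 1 \<noteq> 0" | "fls_nth (?x - ?x') 1 \<noteq> 0" by fastforce
    then show ?thesis
    proof cases
      case 1
      then have "fls_ord (?x + ?x') = 1" by (rule s) (use nz in auto)
      then show ?thesis using S by simp
    next
      case 2
      then have "fls_ord (?x - ?x') = 1" by (rule s) (use nz in auto)
      then show ?thesis using D[OF that] by simp
    qed
  qed
qed

lemma fls_ord_disc_root: "\<gamma> \<in> Arcs d t \<Longrightarrow> 2 * fls_ord (\<delta> \<gamma>) = fls_ord (fls_poly (disc d t) (fst \<gamma>))"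
  by (simp add: disc_root_square[symmetric] fls_subdegree_pow)

lemma disc_root_integral: "\<gamma> \<in> Arcs d t \<Longrightarrow> 0 \<le> fls_ord (fst \<gamma>) \<Longrightarrow> 0 \<le> fls_ord (\<delta> \<gamma>)"
  using fls_ord_disc_root[of \<gamma>] fls_poly_integral[of "fst \<gamma>" "disc d t"] by simp

lemma finite_fst:
  assumes "finite F"
  shows "finite {P \<in> E. fst P \<in> F}"
proof -
  have "finite {P \<in> E. fst P = a}" for a
  proof (cases "\<exists>Q\<in>E. fst Q = a")
    case True
    then obtain Q where "Q \<in> E" "fst Q = a" by blast
    then have "{P \<in> E. fst P = a} \<subseteq> {Q, iota1 d t Q}" using same_fst_cases[of Q] by auto
    then show ?thesis by (rule finite_subset) simp
  next
    case False
    then have "{P \<in> E. fst P = a} = {}" by auto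
    then show ?thesis by (simp only: finite.emptyI)
  qed
  moreover have "{P \<in> E. fst P \<in> F} = (\<Union>a\<in>F. {P \<in> E. fst P = a})" by auto
  ultimately show ?thesis using assms by simp
qed

text \<open>Away from infinity and from the roots of the denominator, the normal form divides a
  regular series by a unit, because \<delta> is regular wherever x is.\<close>

lemma finite_poles: "finite {center \<gamma> | \<gamma>. \<gamma> \<in> Arcs d t \<and> fls_ord (rf \<gamma> e) < 0}"
proof -
  obtain a b c where *: "c \<noteq> 0"
    "\<And>\<gamma>. \<gamma> \<in> Arcs d t \<Longrightarrow> rf \<gamma> e = (fls_poly a (fst \<gamma>) + fls_poly b (fst \<gamma>) * \<delta> \<gamma>) / fls_poly c (fst \<gamma>)"
    using rexp_normal_form by metis
  define F where "F = insert cp1_infinity (cp1_of_complex ` {x. poly c x = 0})"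
  have "finite F" using poly_roots_finite[OF *(1)] by (simp add: F_def)
  moreover have "val (fst \<gamma>) \<in> F" if g: "\<gamma> \<in> Arcs d t" and p: "fls_ord (rf \<gamma> e) < 0" for \<gamma>
  proof (rule ccontr)
    assume n: "val (fst \<gamma>) \<notin> F"
    then have f: "0 \<le> fls_ord (fst \<gamma>)" by (auto simp: F_def val_def split: if_splits)
    then have "poly c (fls_res (fst \<gamma>)) \<noteq> 0" using n by (auto simp: F_def val_def)
    then have "fls_res (fls_poly c (fst \<gamma>)) \<noteq> 0" "0 \<le> fls_ord (fls_poly c (fst \<gamma>))" using fls_poly_integral[OF f] by auto
    then have c: "fls_ord (fls_poly c (fst \<gamma>)) = 0" "fls_poly c (fst \<gamma>) \<noteq> 0" using fls_ord_pos_iff[of "fls_poly c (fst \<gamma>)"] by auto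
    have "0 \<le> fls_ord (fls_poly a (fst \<gamma>) + fls_poly b (fst \<gamma>) * \<delta> \<gamma>)"
      by (intro fls_ord_add_ge fls_ord_mult_ge0 disc_root_integral[OF g f]) (use fls_poly_integral[OF f] in auto)
    then have "0 \<le> fls_ord ((fls_poly a (fst \<gamma>) + fls_poly b (fst \<gamma>) * \<delta> \<gamma>) / fls_poly c (fst \<gamma>))"
      using c by (cases "fls_poly a (fst \<gamma>) + fls_poly b (fst \<gamma>) * \<delta> \<gamma> = 0") (simp_all add: fls_divide_subdegree)
    then show False using p *(2)[OF g] by simp
  qed
  ultimately show ?thesis
    by (intro finite_subset[OF _ finite_fst[OF \<open>finite F\<close>]]) (use center_in in \<open>fastforce simp: center_def\<close>)
qed

end

section \<open>Functions with poles over infinity only\<close>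

lemma split_coprime:
  fixes b c :: "complex poly"
  assumes "c \<noteq> 0"
  obtains g b' c' where "g \<noteq> 0" "b = g * b'" "c = g * c'" "c' \<noteq> 0"
    "\<And>a. poly c' a = 0 \<Longrightarrow> poly b' a \<noteq> 0"
proof -
  obtain b' c' where bc: "b = gcd b c * b'" "c = gcd b c * c'" "coprime b' c'"
    using gcd_coprime_exists[of b c] assms by (metis gcd_eq_0_iff mult.commute)
  show ?thesis
  proof (rule that[of "gcd b c" b' c'])
    fix a assume "poly c' a = 0"
    then show "poly b' a \<noteq> 0"
      using bc(3) by (metis coprime_common_divisor is_unit_poly_iff pCons_eq_iff poly_eq_0_iff_dvd
          one_neq_zero zero_neq_one pCons_one dvd_refl poly_1)
  qed (use bc assms in auto)
qed

locale walk = biquad +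
  assumes O_on: "kernel_coeff d t 2 2 = 0"
    and O1: "iota1 d t (cp1_infinity, cp1_infinity) \<noteq> (cp1_infinity, cp1_infinity)"
    and O2: "iota2 d t (cp1_infinity, cp1_infinity) \<noteq> (cp1_infinity, cp1_infinity)"
begin

abbreviation "pt_inf \<equiv> (cp1_infinity, cp1_infinity)"

lemma pt_inf_in: "pt_inf \<in> E"
  by (simp add: kernel_curve_def infinity_mk on_curve_mk kernel_hom_form fA_def O_on)

text \<open>Over x = infinity the y0^2 term is absent, and this is the coefficient of y0 y1. If it
  vanished too, only y1^2 would remain, so O would be a double zero fixed by
  \<open>iota1\<close>.\<close>

lemma kc21: "kernel_coeff d t 2 1 \<noteq> 0"
proof
  assume 0: "kernel_coeff d t 2 1 = 0"
  have "kernel_hom d t 1 0 y0 y1 = kernel_coeff d t 2 0 * y1 ^ 2" for y0 y1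
    by (simp add: kernel_hom_form fA_def fB_def fC_def O_on 0[unfolded One_nat_def])
  moreover from this have "kernel_coeff d t 2 0 \<noteq> 0" using fibx[of 1 0] by auto
  ultimately have "x_fibre d t cp1_infinity cp1_infinity cp1_infinity"
    by (auto simp: infinity_mk x_fibre_mk power2_eq_square)
  then have "same_x_pair d t cp1_infinity pt_inf pt_inf" by (simp add: same_x_pair_def)
  then show False using same_x_pair_in(3) O1 by metis
qed

lemma walk_flip: "walk (flip d) t"
proof -
  interpret sw: biquad "flip d" t by (rule biquad_flip)
  show ?thesis
  proof unfold_locales
    show "kernel_coeff (flip d) t 2 2 = 0" by (simp add: kernel_coeff_flip O_on)
    show "iota1 (flip d) t pt_inf \<noteq> pt_inf" using O2 iota2_flip[OF pt_inf_in] by auto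
    have "pt_inf \<in> kernel_curve (flip d) t" using swap_in[of pt_inf] pt_inf_in by simp
    then show "iota2 (flip d) t pt_inf \<noteq> pt_inf" using O1 sw.iota2_flip[of pt_inf] by (metis flip_flip swap_simp swap_swap)
  qed
qed

lemma kc12: "kernel_coeff d t 1 2 \<noteq> 0"
  using walk.kc21[OF walk_flip] by (simp add: kernel_coeff_flip)

text \<open>A has lost its x^2 term, so A C has degree at most 3, and the square of the quadratic B
  dominates.\<close>

lemma degree_disc: "degree (disc d t) = 4"
proof -
  have "degree (pA d t) \<le> 1" unfolding pA_def O_on by simp
  moreover have "degree (pC d t) \<le> 2" unfolding pC_def by simp
  ultimately have "degree (pA d t * pC d t) \<le> 3" using degree_mult_le[of "pA d t" "pC d t"] by linarith
  then have "degree (Polynomial.smult (-4) (pA d t * pC d t)) < 4"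
    using degree_smult_le[of "-4" "pA d t * pC d t"] by linarith
  moreover have B: "degree (pB d t) = 2" unfolding pB_def using kc21 by simp
  then have "degree (pB d t ^ 2) = 4" by (subst degree_power_eq) auto
  moreover have "disc d t = pB d t ^ 2 + Polynomial.smult (-4) (pA d t * pC d t)"
    by (simp add: disc_def numeral_poly)
  ultimately show ?thesis by (simp only: degree_add_eq_left)
qed

text \<open>D has even degree, so x = 1/s needs no squaring of the parameter: the curve is
  unramified over infinity. These arcs measure pole orders faithfully.\<close>

lemma ex_arc_infinity: "\<exists>g. (fls_X_inv, g) \<in> Arcs d t"
proof -
  have n: "nonconst fls_X_inv" using nonconst_X(2)[of 0] by simp
  have "even (fls_ord (fls_poly (disc d t) fls_X_inv))"
    by (subst fls_ord_fls_poly_infinity) (simp_all add: disc_nz degree_disc)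
  from ex_arc_over[OF n this] show ?thesis by blast
qed

lemma fls_ord_disc_root_infinity: "\<gamma> \<in> Arcs d t \<Longrightarrow> fls_ord (fst \<gamma>) < 0 \<Longrightarrow> fls_ord (\<delta> \<gamma>) = 2 * fls_ord (fst \<gamma>)"
  using fls_ord_disc_root[of \<gamma>] fls_ord_fls_poly_infinity[OF _ disc_nz, of "fst \<gamma>"] by (simp add: degree_disc)

text \<open>At infinity the order of \<delta> is twice that of x, so the ramification divides the
  order of \<delta> and hence divides 1.\<close>

lemma ramification_infinity:
  assumes "\<gamma> \<in> Arcs d t" "rf \<gamma> e = fls_X" "fls_ord (fst \<gamma>) < 0"
  shows "fls_ord (fst \<gamma>) = - 1"
proof -
  have r: "ramification (fst \<gamma>) = fls_ord (fst \<gamma>)" using assms by (simp add: ramification_def)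
  then have "ramification (fst \<gamma>) dvd 1" using ramification_dvd_2(2)[OF assms(1,2)] fls_ord_disc_root_infinity[OF assms(1,3)] by simp
  then show ?thesis using r assms(3) by auto
qed

lemma fst_infinity_cases: "P \<in> E \<Longrightarrow> fst P = cp1_infinity \<Longrightarrow> P = pt_inf \<or> P = iota1 d t pt_inf"
  using same_fst_cases[OF pt_inf_in, of P] by simp

lemma snd_infinity_cases: "P \<in> E \<Longrightarrow> snd P = cp1_infinity \<Longrightarrow> P = pt_inf \<or> P = iota2 d t pt_inf"
proof -
  assume "P \<in> E" "snd P = cp1_infinity"
  moreover have "prod.swap P \<in> kernel_curve (flip d) t" using \<open>P \<in> E\<close> by (simp add: swap_in)
  ultimately have "prod.swap P = pt_inf \<or> prod.swap P = iota1 (flip d) t pt_inf"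
    using walk.fst_infinity_cases[OF walk_flip, of "prod.swap P"] by simp
  then show ?thesis using iota2_flip[OF pt_inf_in] by (auto simp: prod_eq_iff)
qed

end

locale smooth_walk = walk +
  assumes squarefree: "Polynomial.order a (disc d t) \<le> 1"
    and tau_infinite: "tau_infinite_order d t"
begin

text \<open>Along x = a + s^2 a root a of \<open>c\<close> that is not cancelled by \<open>b\<close>
  gives the denominator order at least 2, more than the order at most 1 of \<open>m\<close>. It is
  applied with \<open>m\<close> equal to 1 and to \<delta>; the bound for \<delta> is exactly
  squarefreeness of D.\<close>

lemma dvd_if_regular:
  assumes "c \<noteq> 0"
    and m: "\<And>a h. (fls_const a + fls_X ^ 2, h) \<in> Arcs d t \<Longrightarrow>
      m (fls_const a + fls_X ^ 2, h) \<noteq> 0 \<and> fls_ord (m (fls_const a + fls_X ^ 2, h)) \<le> 1"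
    and reg: "\<And>\<gamma>. \<gamma> \<in> Arcs d t \<Longrightarrow> 0 \<le> fls_ord (fst \<gamma>) \<Longrightarrow> 0 \<le> fls_ord (fls_poly b (fst \<gamma>) * m \<gamma> / fls_poly c (fst \<gamma>))"
  shows "c dvd b"
proof -
  obtain g b' c' where *: "g \<noteq> 0" "b = g * b'" "c = g * c'" "c' \<noteq> 0"
    "\<And>a. poly c' a = 0 \<Longrightarrow> poly b' a \<noteq> 0" using split_coprime[OF assms(1)] by blast
  have "degree c' = 0"
  proof (rule ccontr)
    assume "degree c' \<noteq> 0"
    then obtain a where a: "poly c' a = 0"
      using fundamental_theorem_of_algebra[of c'] constant_degree[of c'] by auto
    let ?f = "fls_const a + fls_X ^ 2"
    obtain h where h: "(?f, h) \<in> Arcs d t" using ex_arc_finite by blast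
    have n: "nonconst ?f" using nonconst_X(1)[of a 1] by (simp add: numeral_2_eq_2)
    have s: "fls_ord (?f - fls_const a) = 2" by (simp add: fls_subdegree_pow)
    have nz: "fls_poly g ?f \<noteq> 0" "fls_poly b' ?f \<noteq> 0" "fls_poly c' ?f \<noteq> 0" "m (?f, h) \<noteq> 0"
      using fls_poly_nonzero[OF n] * a m[OF h] by (auto, metis poly_0)
    have "b' \<noteq> 0" using * a by auto
    moreover have "Polynomial.order a b' = 0" using *(5)[OF a] order_root by blast
    ultimately have 1: "fls_ord (fls_poly b' ?f) = 0" using fls_ord_fls_poly_finite[of ?f a b'] s by simp
    have "Polynomial.order a c' > 0" using a *(4) order_root by blast
    then have 2: "fls_ord (fls_poly c' ?f) \<ge> 2" using fls_ord_fls_poly_finite[of ?f a c'] s *(4) by simp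
    have "fls_poly b ?f * m (?f, h) / fls_poly c ?f = fls_poly b' ?f * m (?f, h) / fls_poly c' ?f" using nz by (simp add: *(2,3))
    then have "fls_ord (fls_poly b ?f * m (?f, h) / fls_poly c ?f) < 0" using 1 2 m[OF h] nz by (simp add: fls_divide_subdegree)
    moreover have "0 \<le> fls_ord ?f" by (rule fls_ord_add_ge) (auto simp: fls_subdegree_pow)
    ultimately show False using reg[OF h] by simp
  qed
  then have "is_unit c'" using *(4) by (simp add: is_unit_iff_degree)
  then show ?thesis using *(2,3) by (metis dvd_mult_cancel_left mult_dvd_mono dvd_refl unit_imp_dvd)
qed

text \<open>Trace and conjugate difference of a function regular over the affine line are regular
  too, so both coefficients are polynomials. The pole of order 2 of \<delta> then bounds the degree
  of \<open>q\<close>. With n = 1 only polynomials in x remain, with n = 2 also a constant multiple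
  of \<delta>.\<close>

lemma riemann_roch_infinity:
  assumes reg: "\<And>\<gamma>. \<gamma> \<in> Arcs d t \<Longrightarrow> 0 \<le> fls_ord (fst \<gamma>) \<Longrightarrow> 0 \<le> fls_ord (rf \<gamma> e)"
    and inf: "\<And>\<gamma>. \<gamma> \<in> Arcs d t \<Longrightarrow> fst \<gamma> = fls_X_inv \<Longrightarrow> - int n \<le> fls_ord (rf \<gamma> e)"
  obtains p q where "\<And>\<gamma>. \<gamma> \<in> Arcs d t \<Longrightarrow> rf \<gamma> e = fls_poly p (fst \<gamma>) + fls_poly q (fst \<gamma>) * \<delta> \<gamma>"
    "q = 0 \<or> degree q + 2 \<le> n"
proof -
  obtain a b c where c: "c \<noteq> 0" and
    nf: "\<And>\<gamma>. \<gamma> \<in> Arcs d t \<Longrightarrow> rf \<gamma> e = (fls_poly a (fst \<gamma>) + fls_poly b (fst \<gamma>) * \<delta> \<gamma>) / fls_poly c (fst \<gamma>)"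
    using rexp_normal_form by metis
  have nf': "rf (arc_iota1 d t \<gamma>) e = (fls_poly a (fst \<gamma>) - fls_poly b (fst \<gamma>) * \<delta> \<gamma>) / fls_poly c (fst \<gamma>)" if g: "\<gamma> \<in> Arcs d t" for \<gamma>
    using nf[OF arc_iota1_in[OF g]] by (simp add: disc_root_arc_iota1[OF g])
  have sym: "fls_poly (2 * a) (fst \<gamma>) / fls_poly c (fst \<gamma>) = rf \<gamma> e + rf (arc_iota1 d t \<gamma>) e"
    and anti: "fls_poly (2 * b) (fst \<gamma>) * \<delta> \<gamma> / fls_poly c (fst \<gamma>) = rf \<gamma> e - rf (arc_iota1 d t \<gamma>) e" if g: "\<gamma> \<in> Arcs d t" for \<gamma>
    unfolding nf'[OF g] nf[OF g] by (simp_all add: add_divide_distrib diff_divide_distrib)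
  have reg': "0 \<le> fls_ord (rf (arc_iota1 d t \<gamma>) e)" if g: "\<gamma> \<in> Arcs d t" "0 \<le> fls_ord (fst \<gamma>)" for \<gamma>
    using reg[OF arc_iota1_in[OF g(1)]] g(2) by simp
  have "c dvd 2 * a"
  proof (rule dvd_if_regular[OF c, of "\<lambda>_. 1"])
    fix \<gamma> assume g: "\<gamma> \<in> Arcs d t" "0 \<le> fls_ord (fst \<gamma>)"
    show "0 \<le> fls_ord (fls_poly (2 * a) (fst \<gamma>) * 1 / fls_poly c (fst \<gamma>))"
      unfolding mult_1_right sym[OF g(1)] by (intro fls_ord_add_ge reg[OF g] reg'[OF g]) auto
  qed simp
  then obtain p where p: "2 * a = c * p" by blast
  have "c dvd 2 * b"
  proof (rule dvd_if_regular[OF c, of \<delta>])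
    fix x h assume h: "(fls_const x + fls_X ^ 2, h) \<in> Arcs d t"
    have "fls_ord (fls_const x + fls_X ^ 2 - fls_const x) = 2" by (simp add: fls_subdegree_pow)
    then show "\<delta> (fls_const x + fls_X ^ 2, h) \<noteq> 0 \<and> fls_ord (\<delta> (fls_const x + fls_X ^ 2, h)) \<le> 1"
      using disc_root_nz[OF h] fls_ord_disc_root[OF h] fls_ord_fls_poly_finite[of "fls_const x + fls_X ^ 2" x, OF _ disc_nz] squarefree[of x] by simp
  next
    fix \<gamma> assume g: "\<gamma> \<in> Arcs d t" "0 \<le> fls_ord (fst \<gamma>)"
    show "0 \<le> fls_ord (fls_poly (2 * b) (fst \<gamma>) * \<delta> \<gamma> / fls_poly c (fst \<gamma>))"
      unfolding anti[OF g(1)] by (intro fls_ord_diff_ge reg[OF g] reg'[OF g]) auto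
  qed
  then obtain q where q: "2 * b = c * q" by blast
  have S: "fls_poly p (fst \<gamma>) = rf \<gamma> e + rf (arc_iota1 d t \<gamma>) e" and A: "fls_poly q (fst \<gamma>) * \<delta> \<gamma> = rf \<gamma> e - rf (arc_iota1 d t \<gamma>) e"
    if g: "\<gamma> \<in> Arcs d t" for \<gamma>
    unfolding sym[OF g, symmetric] anti[OF g, symmetric] unfolding p q
    using fls_poly_nonzero[OF ArcsD(2)[OF g] c] by simp_all
  show ?thesis
  \<comment> \<open>The polynomials were obtained from \<open>2 * a\<close> and
    \<open>2 * b\<close>, that is, from trace and conjugate difference; hence the halves.\<close>
  proof (rule that[of "Polynomial.smult (1/2) p" "Polynomial.smult (1/2) q"])
    fix \<gamma> assume g: "\<gamma> \<in> Arcs d t"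
    have h: "fls_const (1/2) * 2 = (1 :: complex fls)"
      by (simp only: fls_const_numeral[symmetric] fls_const_mult_const) simp
    have "2 * rf \<gamma> e = fls_poly p (fst \<gamma>) + fls_poly q (fst \<gamma>) * \<delta> \<gamma>" unfolding A[OF g] S[OF g] by simp
    then have "rf \<gamma> e = fls_const (1/2) * (fls_poly p (fst \<gamma>) + fls_poly q (fst \<gamma>) * \<delta> \<gamma>)"
      by (metis h mult.assoc mult_1)
    then show "rf \<gamma> e = fls_poly (Polynomial.smult (1/2) p) (fst \<gamma>) + fls_poly (Polynomial.smult (1/2) q) (fst \<gamma>) * \<delta> \<gamma>"
      by (simp only: fls_poly_smult distrib_left mult.assoc)
  next
    show "Polynomial.smult (1/2) q = 0 \<or> degree (Polynomial.smult (1/2) q) + 2 \<le> n"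
    proof (cases "q = 0")
      case False
      obtain g where g: "(fls_X_inv, g) \<in> Arcs d t" using ex_arc_infinity by blast
      have s: "fls_ord (fst (fls_X_inv :: complex fls, g)) = - 1" by simp
      have "- int n \<le> fls_ord (fls_poly q (fst (fls_X_inv, g)) * \<delta> (fls_X_inv, g))"
        unfolding A[OF g] by (intro fls_ord_diff_ge inf g arc_iota1_in) auto
      also have "\<dots> = fls_ord (fls_poly q fls_X_inv) + fls_ord (\<delta> (fls_X_inv, g))"
        using disc_root_nz[OF g] fls_poly_nonzero[OF ArcsD(2)[OF g] False] by simp
      also have "\<dots> = - int (degree q) - 2"
        using fls_ord_disc_root_infinity[OF g] fls_ord_fls_poly_infinity[OF _ False, of fls_X_inv] by simp
      finally show ?thesis by simp
    qed simp
  qed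
qed

lemma rot_pt_inf_neq:
  assumes "n \<noteq> 0"
  shows "pts.rot n pt_inf \<noteq> pt_inf"
proof
  assume fix0: "pts.rot n pt_inf = pt_inf"
  have "pts.rot (- n) pt_inf = pt_inf" using pts.rot_add[OF pt_inf_in, of "- n" n] fix0 by simp
  \<comment> \<open>The dihedral relation turns the fixed point O of \<tau>^(-n) into the fixed
    point \<open>iota1\<close> O of \<tau>^n.\<close>
  then have fix1: "pts.rot n (iota1 d t pt_inf) = iota1 d t pt_inf" using pts.i1_rot[OF pt_inf_in, of "- n"] by simp
  obtain h where h: "\<And>\<gamma>. \<gamma> \<in> Arcs d t \<Longrightarrow> rf \<gamma> h = fst (arcs.rot n \<gamma>)"
    using rot_rexp_subst[of n VX] by auto
  have stab: "fst (pts.rot n P) = cp1_infinity \<longleftrightarrow> fst P = cp1_infinity" if P: "P \<in> E" for P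
  proof
    assume "fst P = cp1_infinity"
    then show "fst (pts.rot n P) = cp1_infinity"
      using fst_infinity_cases[OF P] fix0 fix1 fst_iota1[OF pt_inf_in] by auto
  next
    assume "fst (pts.rot n P) = cp1_infinity"
    then have "pts.rot n P = pt_inf \<or> pts.rot n P = iota1 d t pt_inf" using fst_infinity_cases pts.rot_in[OF P] by blast
    then have "P = pt_inf \<or> P = iota1 d t pt_inf"
    proof
      assume "pts.rot n P = pt_inf"
      then have "pts.rot n P = pts.rot n pt_inf" by (simp only: fix0)
      from pts.rot_inj[OF P pt_inf_in this] show ?thesis ..
    next
      assume "pts.rot n P = iota1 d t pt_inf"
      then have "pts.rot n P = pts.rot n (iota1 d t pt_inf)" by (simp only: fix1)
      from pts.rot_inj[OF P iota1_in[OF pt_inf_in] this] show ?thesis ..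
    qed
    then show "fst P = cp1_infinity" using fst_iota1[OF pt_inf_in] by auto
  qed
  have stab': "fls_ord (fst (arcs.rot n \<gamma>)) < 0 \<longleftrightarrow> fls_ord (fst \<gamma>) < 0" if g: "\<gamma> \<in> Arcs d t" for \<gamma>
    using stab[OF center_in[OF g]] unfolding center_rot[OF g, symmetric]
    by (simp add: center_def val_infinite_iff)
  obtain p q where pq: "\<And>\<gamma>. \<gamma> \<in> Arcs d t \<Longrightarrow> rf \<gamma> h = fls_poly p (fst \<gamma>) + fls_poly q (fst \<gamma>) * \<delta> \<gamma>"
    "q = 0 \<or> degree q + 2 \<le> 1"
  proof (rule riemann_roch_infinity[of h 1])
    fix \<gamma> assume g: "\<gamma> \<in> Arcs d t" "0 \<le> fls_ord (fst \<gamma>)"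
    then show "0 \<le> fls_ord (rf \<gamma> h)" using stab'[OF g(1)] by (simp add: h)
  next
    fix \<gamma> assume g: "\<gamma> \<in> Arcs d t" "fst \<gamma> = fls_X_inv"
    have n: "fls_ord (fst (arcs.rot n \<gamma>)) < 0" using stab'[OF g(1)] g(2) by simp
    note r = arcs.rot_in[OF g(1), of n]
    \<comment> \<open>The function 1/x composed with \<tau>^(-n) takes the value
      \<open>fls_X\<close> on the rotated arc. So that arc too is traversed only once, and its
      x-coordinate has a simple pole.\<close>
    obtain e where "\<And>\<gamma>. \<gamma> \<in> Arcs d t \<Longrightarrow> rf \<gamma> e = rf (arcs.rot (- n) \<gamma>) (Inv VX)"
      using rot_rexp_subst[of "- n" "Inv VX"] by auto
    from this[OF r] have "rf (arcs.rot n \<gamma>) e = inverse fls_X_inv"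
      using arcs.rot_add[OF g(1), of "- n" n] g(2) by simp
    then have "fls_ord (fst (arcs.rot n \<gamma>)) = - 1" by (intro ramification_infinity[OF r _ n]) (simp add: fls_inverse_X_inv)
    then show "- int 1 \<le> fls_ord (rf \<gamma> h)" by (simp add: h[OF g(1)])
  qed blast
  \<comment> \<open>The alternative \<open>degree q + 2 \<le> 1\<close> is impossible, so
    \<open>q\<close> is zero and x \<circ> \<tau>^n is a polynomial in x.\<close>
  have even: "fst (arcs.rot n \<gamma>) = fls_poly p (fst \<gamma>)" if "\<gamma> \<in> Arcs d t" for \<gamma>
    using pq(1)[OF that] pq(2) h[OF that] by simp
  have m2: "fst (arcs.rot (2 * n) \<gamma>) = fst \<gamma>" if g: "\<gamma> \<in> Arcs d t" for \<gamma>
  proof -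
    note r = arcs.rot_in[OF g, of n]
    \<comment> \<open>A polynomial in x does not distinguish the arc \<tau>^n \<gamma> from its
      conjugate. By the dihedral relation \<tau>^n sends that conjugate to the conjugate of
      \<gamma>, whose x-coordinate is that of \<gamma>.\<close>
    have "fst (arcs.rot n (arc_iota1 d t (arcs.rot n \<gamma>))) = fst (arcs.rot n (arcs.rot n \<gamma>))"
      using even[OF arc_iota1_in[OF r]] even[OF r] by simp
    moreover have "arcs.rot n (arc_iota1 d t (arcs.rot n \<gamma>)) = arc_iota1 d t \<gamma>"
      using arcs.i1_rot[OF r, of "- n"] unfolding arcs.rot_add[OF g, of "- n" n, symmetric] by simp
    moreover have "arcs.rot n (arcs.rot n \<gamma>) = arcs.rot (2 * n) \<gamma>"
      unfolding arcs.rot_add[OF g, symmetric] by (simp only: mult_2)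
    ultimately show ?thesis by simp
  qed
  have m4: "arcs.rot (4 * n) \<gamma> = \<gamma>" if g: "\<gamma> \<in> Arcs d t" for \<gamma>
  proof -
    have 4: "arcs.rot (4 * n) \<gamma> = arcs.rot (2 * n) (arcs.rot (2 * n) \<gamma>)"
      using arcs.rot_add[OF g, of "2 * n" "2 * n"] by simp
    note j = arc_iota1_in[OF g]
    consider "arcs.rot (2 * n) \<gamma> = \<gamma>" | "arcs.rot (2 * n) \<gamma> = arc_iota1 d t \<gamma>"
      using arcs_same_fst[OF g arcs.rot_in[OF g] m2[OF g]] by blast
    then show ?thesis
    proof cases
      case 2
      have "arcs.rot (2 * n) (arc_iota1 d t \<gamma>) = arc_iota1 d t \<gamma> \<or> arcs.rot (2 * n) (arc_iota1 d t \<gamma>) = \<gamma>"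
        using arcs_same_fst[OF j arcs.rot_in[OF j] m2[OF j]] arc_iota1_arc_iota1[OF g] by simp
      \<comment> \<open>If \<tau>^(2n) fixed the conjugate arc while sending \<gamma> to it,
        injectivity would identify \<gamma> with its conjugate.\<close>
      then show ?thesis using 2 4 arcs.rot_inj[OF j g] arc_iota1_neq[OF g] by metis
    qed (simp add: 4)
  qed
  have p4: "pts.rot (4 * n) P = P" if P: "P \<in> E" for P
  proof -
    obtain \<gamma> where "\<gamma> \<in> Arcs d t" "center \<gamma> = P" using ex_arc_at[OF P] by blast
    then show ?thesis using center_rot[of \<gamma> "4 * n"] m4 by simp
  qed
  have "pts.rot (\<bar>4 * n\<bar>) P = P" if P: "P \<in> E" for P
    using p4[OF P] pts.rot_add[OF P, of "- (4 * n)" "4 * n"] by (simp add: abs_if)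
  then have "(tau d t ^^ nat \<bar>4 * n\<bar>) P = P" if P: "P \<in> E" for P
    using P by (simp add: pts.rot_def tau_def)
  moreover have "0 < nat \<bar>4 * n\<bar>" using assms by simp
  ultimately show False using tau_infinite unfolding tau_infinite_order_def by blast
qed

text \<open>For n > 0 the witness is f + f \<circ> \<tau> + ... + f \<circ> \<tau>^(n-1); for n < 0
  it is minus the sum of f \<circ> \<tau>^i over n \<le> i < 0.\<close>

lemma telescope:
  "\<exists>g. \<forall>\<gamma>\<in>Arcs d t. rf (arcs.rot n \<gamma>) f - rf \<gamma> f = rf (arcs.rot 1 \<gamma>) g - rf \<gamma> g"
proof (induction n rule: int_induct[of _ 0])
  case base
  show ?case by (rule exI[of _ "Cst 0"]) simp
next
  case (step1 i)
  then obtain g where g: "\<And>\<gamma>. \<gamma> \<in> Arcs d t \<Longrightarrow> rf (arcs.rot i \<gamma>) f - rf \<gamma> f = rf (arcs.rot 1 \<gamma>) g - rf \<gamma> g" by blast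
  obtain k where k: "\<And>\<gamma>. \<gamma> \<in> Arcs d t \<Longrightarrow> rf \<gamma> k = rf (arcs.rot i \<gamma>) f" using rot_rexp_subst by blast
  show ?case
  proof (rule exI[of _ "Add g k"], rule ballI)
    fix \<gamma> assume \<gamma>: "\<gamma> \<in> Arcs d t"
    have "rf (arcs.rot 1 \<gamma>) k = rf (arcs.rot (i + 1) \<gamma>) f"
      using k[OF arcs.rot_in[OF \<gamma>, of 1]] arcs.rot_add[OF \<gamma>, of i 1] by simp
    then show "rf (arcs.rot (i + 1) \<gamma>) f - rf \<gamma> f = rf (arcs.rot 1 \<gamma>) (Add g k) - rf \<gamma> (Add g k)"
      using k[OF \<gamma>] g[OF \<gamma>] by (simp add: algebra_simps)
  qed
next
  case (step2 i)
  then obtain g where g: "\<And>\<gamma>. \<gamma> \<in> Arcs d t \<Longrightarrow> rf (arcs.rot i \<gamma>) f - rf \<gamma> f = rf (arcs.rot 1 \<gamma>) g - rf \<gamma> g" by blast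
  obtain k where k: "\<And>\<gamma>. \<gamma> \<in> Arcs d t \<Longrightarrow> rf \<gamma> k = rf (arcs.rot (i - 1) \<gamma>) f" using rot_rexp_subst by blast
  have m: "rf \<gamma> (Mul (Cst (-1)) k) = - rf \<gamma> k" for \<gamma> by (simp del: fls_const_uminus add: fls_const_uminus[of 1])
  show ?case
  proof (rule exI[of _ "Add g (Mul (Cst (-1)) k)"], rule ballI)
    fix \<gamma> assume \<gamma>: "\<gamma> \<in> Arcs d t"
    have "rf (arcs.rot 1 \<gamma>) k = rf (arcs.rot i \<gamma>) f"
      using k[OF arcs.rot_in[OF \<gamma>, of 1]] arcs.rot_add[OF \<gamma>, of "i - 1" 1] by simp
    then show "rf (arcs.rot (i - 1) \<gamma>) f - rf \<gamma> f =
      rf (arcs.rot 1 \<gamma>) (Add g (Mul (Cst (-1)) k)) - rf \<gamma> (Add g (Mul (Cst (-1)) k))"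
      using k[OF \<gamma>] g[OF \<gamma>] unfolding rexp_eval.simps(4) m by (simp add: algebra_simps)
  qed
qed

end

section \<open>Certificates for the square root of the discriminant\<close>

context smooth_walk
begin

lemma disc_root_pole_iff: "\<gamma> \<in> Arcs d t \<Longrightarrow> fls_ord (\<delta> \<gamma>) < 0 \<longleftrightarrow> fst (center \<gamma>) = cp1_infinity"
  using disc_root_integral[of \<gamma>] fls_ord_disc_root_infinity[of \<gamma>]
  by (cases "fls_ord (fst \<gamma>) < 0") (auto simp: center_def val_infinite_iff)

lemma certificate_imp_orbit:
  assumes cert: "\<And>\<gamma>. \<gamma> \<in> Arcs d t \<Longrightarrow> rf (arcs.rot 1 \<gamma>) e - rf \<gamma> e = \<delta> \<gamma>"
  shows "\<exists>n. pts.rot n pt_inf = iota1 d t pt_inf"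
proof (rule ccontr)
  assume no: "\<nexists>n. pts.rot n pt_inf = iota1 d t pt_inf"
  obtain \<gamma> where g: "\<gamma> \<in> Arcs d t" and c: "center \<gamma> = pt_inf" using ex_arc_at[OF pt_inf_in] by blast
  define reg where "reg m \<longleftrightarrow> 0 \<le> fls_ord (rf (arcs.rot m \<gamma>) e)" for m
  \<comment> \<open>The orbit of O being infinite, distinct indices have distinct centres; finitely
    many poles therefore means finitely many indices without regularity.\<close>
  have inj: "inj (\<lambda>m. center (arcs.rot m \<gamma>))"
  proof (rule injI)
    fix m m' assume "center (arcs.rot m \<gamma>) = center (arcs.rot m' \<gamma>)"
    then have "pts.rot m pt_inf = pts.rot m' pt_inf" by (simp add: center_rot[OF g] c)
    then have "pts.rot (- m') (pts.rot m pt_inf) = pt_inf" using pts.rot_add[OF pt_inf_in, of "- m'" m'] by simp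
    then have "pts.rot (m - m') pt_inf = pt_inf" using pts.rot_add[OF pt_inf_in, of "- m'" m] by simp
    then show "m = m'" using rot_pt_inf_neq[of "m - m'"] by auto
  qed
  have "center (arcs.rot m \<gamma>) \<in> {center \<gamma> | \<gamma>. \<gamma> \<in> Arcs d t \<and> fls_ord (rf \<gamma> e) < 0}" if "\<not> reg m" for m
    using that arcs.rot_in[OF g, of m] unfolding reg_def by (intro CollectI exI[of _ "arcs.rot m \<gamma>"]) auto
  then have "{m. \<not> reg m} = (\<lambda>m. center (arcs.rot m \<gamma>)) -` {center \<gamma> | \<gamma>. \<gamma> \<in> Arcs d t \<and> fls_ord (rf \<gamma> e) < 0} \<inter> {m. \<not> reg m}"
    by blast
  also have "finite \<dots>" using finite_vimageI[OF finite_poles inj] by blast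
  finally have fin: "finite {m. \<not> reg m}" .
  \<comment> \<open>By assumption the orbit of O misses \<open>iota1\<close> O, so it meets the
    poles of \<delta> at m = 0 only; elsewhere the values of \<open>e\<close> at consecutive arcs
    differ by a regular series.\<close>
  have step: "reg (m + 1) \<longleftrightarrow> reg m" if "m \<noteq> 0" for m
  proof -
    note r = arcs.rot_in[OF g, of m]
    have "fst (center (arcs.rot m \<gamma>)) \<noteq> cp1_infinity"
    proof
      assume "fst (center (arcs.rot m \<gamma>)) = cp1_infinity"
      then have "pts.rot m pt_inf = pt_inf \<or> pts.rot m pt_inf = iota1 d t pt_inf"
        using fst_infinity_cases[OF center_in[OF r]] by (simp add: center_rot[OF g] c)
      then show False using no rot_pt_inf_neq[OF that] by blast
    qed
    then have "0 \<le> fls_ord (\<delta> (arcs.rot m \<gamma>))" using disc_root_pole_iff[OF r] by simp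
    moreover have "rf (arcs.rot (m + 1) \<gamma>) e = rf (arcs.rot m \<gamma>) e + \<delta> (arcs.rot m \<gamma>)"
      "rf (arcs.rot m \<gamma>) e = rf (arcs.rot (m + 1) \<gamma>) e - \<delta> (arcs.rot m \<gamma>)"
      using cert[OF r] arcs.rot_add[OF g, of 1 m] by (simp_all add: algebra_simps)
    ultimately show ?thesis unfolding reg_def using fls_ord_add_ge fls_ord_diff_ge by (metis order_refl)
  qed
  \<comment> \<open>Regularity is constant on m \<ge> 1 and on m \<le> 0, and finiteness makes it
    hold on both half-lines. Then \<delta> would be regular at O.\<close>
  have up: "reg (1 + int j) \<longleftrightarrow> reg 1" for j
    by (induction j) (use step[of "1 + int _"] in \<open>auto simp: add_ac\<close>)
  have down: "reg (- int j) \<longleftrightarrow> reg 0" for j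
  proof (induction j)
    case (Suc j)
    then show ?case using step[of "- int (Suc j)"] by simp
  qed simp
  have "reg 1"
  proof (rule ccontr)
    assume "\<not> reg 1"
    then have "range (\<lambda>j. 1 + int j) \<subseteq> {m. \<not> reg m}" using up by auto
    then show False using fin finite_subset range_inj_infinite[of "\<lambda>j. 1 + int j"] by (auto simp: inj_def)
  qed
  moreover have "reg 0"
  proof (rule ccontr)
    assume "\<not> reg 0"
    then have "range (\<lambda>j. - int j) \<subseteq> {m. \<not> reg m}" using down by auto
    then show False using fin finite_subset range_inj_infinite[of "\<lambda>j. - int j"] by (auto simp: inj_def)
  qed
  ultimately have "0 \<le> fls_ord (\<delta> \<gamma>)"
    unfolding cert[OF g, symmetric] reg_def by (intro fls_ord_diff_ge) auto
  then show False using disc_root_pole_iff[OF g] c by simp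
qed

text \<open>A function with a double pole at a single point of the orbit of \<open>O\<close>, pulled back to \<open>O\<close> and
  antisymmetrised under \<open>\<iota>\<^sub>1\<close>, has the poles of \<open>\<delta>\<close> and hence is a multiple of \<open>\<delta>\<close>.\<close>

lemma double_pole_imp_certificate:
  assumes R: "R = pts.rot p pt_inf"
    and pole: "\<And>\<gamma>. \<gamma> \<in> Arcs d t \<Longrightarrow> fls_ord (rf \<gamma> f) < 0 \<longleftrightarrow> center \<gamma> = R"
    and double: "\<And>\<gamma> e. \<gamma> \<in> Arcs d t \<Longrightarrow> rf \<gamma> e = fls_X \<Longrightarrow> - 2 \<le> fls_ord (rf \<gamma> f)"
    and anti: "\<And>\<gamma>. \<gamma> \<in> Arcs d t \<Longrightarrow> rf (arcs.rot p (arc_iota1 d t \<gamma>)) f = rf (arcs.rot q \<gamma>) f"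
  shows "\<exists>e. \<forall>\<gamma>\<in>Arcs d t. rf (arcs.rot 1 \<gamma>) e - rf \<gamma> e = \<delta> \<gamma>"
proof -
  obtain f1 where f1: "\<And>\<gamma>. \<gamma> \<in> Arcs d t \<Longrightarrow> rf \<gamma> f1 = rf (arcs.rot p \<gamma>) f" using rot_rexp_subst by blast
  obtain f2 where f2: "\<And>\<gamma>. \<gamma> \<in> Arcs d t \<Longrightarrow> rf \<gamma> f2 = rf (arcs.rot q \<gamma>) f" using rot_rexp_subst by blast
  \<comment> \<open>The difference of the two translates; by \<open>anti\<close> the second is the
    conjugate of the first, which makes \<open>u\<close> antisymmetric.\<close>
  define u where "u = Add f1 (Mul (Cst (-1)) f2)"
  have u: "rf \<gamma> u = rf (arcs.rot p \<gamma>) f - rf (arcs.rot p (arc_iota1 d t \<gamma>)) f" if g: "\<gamma> \<in> Arcs d t" for \<gamma>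
    using f1[OF g] f2[OF g] anti[OF g] by (simp add: u_def)
  have pole': "fls_ord (rf (arcs.rot p \<gamma>) f) < 0 \<longleftrightarrow> center \<gamma> = pt_inf" if g: "\<gamma> \<in> Arcs d t" for \<gamma>
  proof -
    have "fls_ord (rf (arcs.rot p \<gamma>) f) < 0 \<longleftrightarrow> pts.rot p (center \<gamma>) = pts.rot p pt_inf"
      using pole[OF arcs.rot_in[OF g]] by (simp add: center_rot[OF g] R)
    then show ?thesis using pts.rot_inj[OF center_in[OF g] pt_inf_in] by auto
  qed
  have double': "- 2 \<le> fls_ord (rf (arcs.rot p \<gamma>) f)" if g: "\<gamma> \<in> Arcs d t" "fst \<gamma> = fls_X_inv" for \<gamma>
  proof -
    note r = arcs.rot_in[OF g(1), of p]
    \<comment> \<open>As before, 1/x transported back along the rotation certifies that the rotated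
      arc is traversed once, so that \<open>double\<close> applies to it.\<close>
    obtain e where "\<And>\<gamma>. \<gamma> \<in> Arcs d t \<Longrightarrow> rf \<gamma> e = rf (arcs.rot (- p) \<gamma>) (Inv VX)"
      using rot_rexp_subst[of "- p" "Inv VX"] by auto
    from this[OF r] have "rf (arcs.rot p \<gamma>) e = fls_X"
      using arcs.rot_add[OF g(1), of "- p" p] g(2) by (simp add: fls_inverse_X_inv)
    then show ?thesis by (rule double[OF r])
  qed
  obtain P Q where PQ: "\<And>\<gamma>. \<gamma> \<in> Arcs d t \<Longrightarrow> rf \<gamma> u = fls_poly P (fst \<gamma>) + fls_poly Q (fst \<gamma>) * \<delta> \<gamma>"
    "Q = 0 \<or> degree Q + 2 \<le> 2"
  proof (rule riemann_roch_infinity[of u 2])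
    fix \<gamma> assume g: "\<gamma> \<in> Arcs d t" "0 \<le> fls_ord (fst \<gamma>)"
    have "center \<gamma> \<noteq> pt_inf" "center (arc_iota1 d t \<gamma>) \<noteq> pt_inf" using g(2) by (auto simp: center_def val_def)
    then have "0 \<le> fls_ord (rf (arcs.rot p \<gamma>) f)" "0 \<le> fls_ord (rf (arcs.rot p (arc_iota1 d t \<gamma>)) f)"
      using pole'[OF g(1)] pole'[OF arc_iota1_in[OF g(1)]] by auto
    then show "0 \<le> fls_ord (rf \<gamma> u)" unfolding u[OF g(1)] by (intro fls_ord_diff_ge) auto
  next
    fix \<gamma> assume g: "\<gamma> \<in> Arcs d t" "fst \<gamma> = fls_X_inv"
    show "- int 2 \<le> fls_ord (rf \<gamma> u)"
      unfolding u[OF g(1)] using double'[OF g] double'[OF arc_iota1_in[OF g(1)]] g(2) by (intro fls_ord_diff_ge) auto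
  qed blast
  have uJ: "rf (arc_iota1 d t \<gamma>) u = - rf \<gamma> u" if g: "\<gamma> \<in> Arcs d t" for \<gamma>
    using u[OF g] u[OF arc_iota1_in[OF g]] arc_iota1_arc_iota1[OF g] by simp
  \<comment> \<open>Antisymmetry kills the trace of \<open>u\<close>, which is twice its part in
    C[x].\<close>
  have P0: "2 * fls_poly P (fst \<gamma>) = 0" if g: "\<gamma> \<in> Arcs d t" for \<gamma>
  proof -
    have "fls_poly P (fst \<gamma>) - fls_poly Q (fst \<gamma>) * \<delta> \<gamma> = rf (arc_iota1 d t \<gamma>) u"
      using PQ(1)[OF arc_iota1_in[OF g]] by (simp add: disc_root_arc_iota1[OF g])
    also have "\<dots> = - (fls_poly P (fst \<gamma>) + fls_poly Q (fst \<gamma>) * \<delta> \<gamma>)" using uJ[OF g] PQ(1)[OF g] by simp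
    finally show ?thesis by (simp add: algebra_simps)
  qed
  obtain \<kappa> where \<kappa>: "Q = [:\<kappa>:]" using PQ(2) by (metis degree_eq_zeroE add_le_same_cancel2 le_zero_eq degree_0)
  have u': "rf \<gamma> u = fls_const \<kappa> * \<delta> \<gamma>" if g: "\<gamma> \<in> Arcs d t" for \<gamma>
    using PQ(1)[OF g] P0[OF g] by (simp add: \<kappa>)
  \<comment> \<open>If \<open>u\<close> were zero, the first translate of \<open>f\<close>, whose
    only pole is O, would agree with its conjugate, whose only pole is \<open>iota1\<close>
    O.\<close>
  have "\<kappa> \<noteq> 0"
  proof
    assume 0: "\<kappa> = 0"
    obtain \<gamma> where g: "\<gamma> \<in> Arcs d t" and c: "center \<gamma> = pt_inf" using ex_arc_at[OF pt_inf_in] by blast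
    have "rf (arcs.rot p \<gamma>) f = rf (arcs.rot p (arc_iota1 d t \<gamma>)) f" using u[OF g] u'[OF g] 0 by simp
    then have "center (arc_iota1 d t \<gamma>) = pt_inf" using pole'[OF g] pole'[OF arc_iota1_in[OF g]] c by simp
    then show False using center_arc_iota1[OF g] c O1 by simp
  qed
  obtain g1 where g1: "\<And>\<gamma>. \<gamma> \<in> Arcs d t \<Longrightarrow> rf (arcs.rot p \<gamma>) f - rf \<gamma> f = rf (arcs.rot 1 \<gamma>) g1 - rf \<gamma> g1"
    using telescope by blast
  obtain g2 where g2: "\<And>\<gamma>. \<gamma> \<in> Arcs d t \<Longrightarrow> rf (arcs.rot q \<gamma>) f - rf \<gamma> f = rf (arcs.rot 1 \<gamma>) g2 - rf \<gamma> g2"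
    using telescope by blast
  show ?thesis
  \<comment> \<open>\<open>u\<close> is the difference of two telescoping differences, each measured
    against the same untranslated \<open>f\<close>.\<close>
  proof (rule exI[of _ "Mul (Cst (1 / \<kappa>)) (Add g1 (Mul (Cst (-1)) g2))"], rule ballI)
    fix \<gamma> assume g: "\<gamma> \<in> Arcs d t"
    have e: "rf \<gamma>' (Mul (Cst (1 / \<kappa>)) (Add g1 (Mul (Cst (-1)) g2))) = fls_const (1 / \<kappa>) * (rf \<gamma>' g1 - rf \<gamma>' g2)" for \<gamma>'
      by simp
    have "fls_const (1 / \<kappa>) * (rf (arcs.rot 1 \<gamma>) g1 - rf (arcs.rot 1 \<gamma>) g2) - fls_const (1 / \<kappa>) * (rf \<gamma> g1 - rf \<gamma> g2) =
      fls_const (1 / \<kappa>) * ((rf (arcs.rot 1 \<gamma>) g1 - rf \<gamma> g1) - (rf (arcs.rot 1 \<gamma>) g2 - rf \<gamma> g2))"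
      by (simp only: right_diff_distrib) simp
    also have "\<dots> = fls_const (1 / \<kappa>) * rf \<gamma> u"
      unfolding g1[OF g, symmetric] g2[OF g, symmetric] u[OF g] anti[OF g] by simp
    also have "\<dots> = \<delta> \<gamma>" unfolding u'[OF g]
      by (simp only: mult.assoc[symmetric] fls_const_mult_const) (use \<open>\<kappa> \<noteq> 0\<close> in simp)
    finally show "rf (arcs.rot 1 \<gamma>) (Mul (Cst (1 / \<kappa>)) (Add g1 (Mul (Cst (-1)) g2))) -
      rf \<gamma> (Mul (Cst (1 / \<kappa>)) (Add g1 (Mul (Cst (-1)) g2))) = \<delta> \<gamma>" unfolding e .
  qed
qed

lemma inverse_pole:
  assumes "nonconst f"
  shows "fls_ord (inverse (f - fls_const c)) < 0 \<longleftrightarrow> val f = cp1_of_complex c"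
    and "ramification f dvd 2 \<Longrightarrow> - 2 \<le> fls_ord (inverse (f - fls_const c))"
proof -
  note nz = nonconst_nz[OF assms, of c]
  show "fls_ord (inverse (f - fls_const c)) < 0 \<longleftrightarrow> val f = cp1_of_complex c"
  proof
    assume "fls_ord (inverse (f - fls_const c)) < 0"
    then have "0 < fls_ord (f - fls_const c)" using nz by simp
    moreover from this have "fls_res (f - fls_const c) = 0" by (rule fls_eq0_below_subdegree)
    then have "fls_res f = c" by simp
    moreover have "0 \<le> fls_ord ((f - fls_const c) + fls_const c)" by (rule fls_ord_add_ge) (use calculation in auto)
    ultimately show "val f = cp1_of_complex c" by (simp add: val_def)
  next
    assume "val f = cp1_of_complex c"
    from val_finiteD(1)[OF this assms] show "fls_ord (inverse (f - fls_const c)) < 0" using nz by simp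
  qed
  show "- 2 \<le> fls_ord (inverse (f - fls_const c))" if "ramification f dvd 2"
  proof (cases "val f = cp1_of_complex c")
    case True
    from val_finiteD[OF this assms] have "ramification f = fls_ord (f - fls_const c)" by (simp add: ramification_def)
    then show ?thesis using that nz zdvd_imp_le[of "ramification f" 2] by simp
  next
    case False
    then show ?thesis using \<open>fls_ord (inverse (f - fls_const c)) < 0 \<longleftrightarrow> val f = cp1_of_complex c\<close> by simp
  qed
qed

lemma orbit_imp_certificate:
  assumes n: "pts.rot n pt_inf = iota1 d t pt_inf"
  shows "\<exists>e. \<forall>\<gamma>\<in>Arcs d t. rf (arcs.rot 1 \<gamma>) e - rf \<gamma> e = \<delta> \<gamma>"
proof (cases "even n")
  case True
  then obtain k where k: "n = 2 * k" by blast
  \<comment> \<open>The midpoint between O and \<open>iota1\<close> O: applying \<open>iota1\<close>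
    to \<tau>^k O gives \<tau>^(-k) of \<open>iota1\<close> O, that is \<tau>^(n-k) O, which is R
    again.\<close>
  define R where "R = pts.rot k pt_inf"
  have R_in: "R \<in> E" unfolding R_def by (rule pts.rot_in[OF pt_inf_in])
  have fixed: "iota1 d t R = R"
    unfolding R_def pts.i1_rot[OF pt_inf_in] n[symmetric] pts.rot_add[OF pt_inf_in, symmetric] k by simp
  have "fst R \<noteq> cp1_infinity"
    using fst_infinity_cases[OF R_in] fixed O1 iota1_iota1[OF pt_inf_in] by auto
  then obtain c where c: "fst R = cp1_of_complex c" by (cases "fst R" rule: cp1_exhaust) auto
  define f where "f = Inv (Add VX (Cst (- c)))"
  have f: "rf \<gamma> f = inverse (fst \<gamma> - fls_const c)" for \<gamma> by (simp add: f_def)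
  show ?thesis
  proof (rule double_pole_imp_certificate[of R k f "- k"])
    fix \<gamma> assume g: "\<gamma> \<in> Arcs d t"
    have "val (fst \<gamma>) = fst R \<longleftrightarrow> center \<gamma> = R"
      using same_fst_cases[OF R_in center_in[OF g]] fixed by (auto simp: center_def)
    then show "fls_ord (rf \<gamma> f) < 0 \<longleftrightarrow> center \<gamma> = R"
      unfolding f inverse_pole(1)[OF ArcsD(2)[OF g]] c by simp
    show "- 2 \<le> fls_ord (rf \<gamma> f)" if "rf \<gamma> e = fls_X" for e
      unfolding f by (rule inverse_pole(2)[OF ArcsD(2)[OF g] ramification_dvd_2(1)[OF g that]])
    have "arcs.rot k (arc_iota1 d t \<gamma>) = arc_iota1 d t (arcs.rot (- k) \<gamma>)" using arcs.i1_rot[OF g, of "- k"] by simp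
    then show "rf (arcs.rot k (arc_iota1 d t \<gamma>)) f = rf (arcs.rot (- k) \<gamma>) f" unfolding f by simp
  qed (rule R_def)
next
  case False
  then obtain k where k: "n = 2 * k + 1" by (metis oddE)
  interpret sw: biquad "flip d" t by (rule biquad_flip)
  \<comment> \<open>For odd n the reflection \<open>iota1\<close> exchanges \<tau>^k O and
    \<tau>^(k+1) O. As \<open>iota2\<close> after \<open>iota1\<close> advances by one step,
    \<open>iota2\<close> fixes the latter.\<close>
  define R where "R = pts.rot (k + 1) pt_inf"
  have R_in: "R \<in> E" unfolding R_def by (rule pts.rot_in[OF pt_inf_in])
  have "iota1 d t R = pts.rot k pt_inf"
    unfolding R_def pts.i1_rot[OF pt_inf_in] n[symmetric] pts.rot_add[OF pt_inf_in, symmetric] k by simp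
  then have "iota1 d t (pts.rot k pt_inf) = R" using iota1_iota1[OF R_in] by simp
  then have "iota2 d t R = pts.rot (k + 1) pt_inf" using pts.rot_succ[OF pt_inf_in, of k] by simp
  then have fixed: "iota2 d t R = R" by (simp add: R_def)
  have "snd R \<noteq> cp1_infinity"
    using snd_infinity_cases[OF R_in] fixed O2 iota2_iota2[OF pt_inf_in] by auto
  then obtain c where c: "snd R = cp1_of_complex c" by (cases "snd R" rule: cp1_exhaust) auto
  define f where "f = Inv (Add VY (Cst (- c)))"
  have f: "rf \<gamma> f = inverse (snd \<gamma> - fls_const c)" for \<gamma> by (simp add: f_def)
  show ?thesis
  proof (rule double_pole_imp_certificate[of R "k + 1" f "- k"])
    fix \<gamma> assume g: "\<gamma> \<in> Arcs d t"
    have s: "prod.swap R \<in> sw.E" "prod.swap (center \<gamma>) \<in> sw.E" using R_in center_in[OF g] by (simp_all add: swap_in)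
    have "iota1 (flip d) t (prod.swap R) = prod.swap R" using fixed iota2_flip[OF R_in] by (metis swap_swap)
    then have "val (snd \<gamma>) = snd R \<longleftrightarrow> center \<gamma> = R"
      using sw.same_fst_cases[OF s] by (auto simp: center_def prod_eq_iff)
    then show "fls_ord (rf \<gamma> f) < 0 \<longleftrightarrow> center \<gamma> = R"
      unfolding f inverse_pole(1)[OF ArcsD(3)[OF g]] c by simp
    show "- 2 \<le> fls_ord (rf \<gamma> f)" if X: "rf \<gamma> e = fls_X" for e
    proof -
      have g': "prod.swap \<gamma> \<in> Arcs (flip d) t" using g by (simp add: swap_Arcs)
      have "rf (prod.swap \<gamma>) (rexp_subst VY VX e) = fls_X" using X by (simp add: rexp_eval_rexp_subst)
      from sw.ramification_dvd_2(1)[OF g' this] have "ramification (snd \<gamma>) dvd 2" by simp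
      then show ?thesis unfolding f by (rule inverse_pole(2)[OF ArcsD(3)[OF g]])
    qed
    \<comment> \<open>Here the two translates are exchanged only up to \<open>iota2\<close>, which
      preserves y and hence the value of \<open>f\<close>.\<close>
    have "arcs.rot (k + 1) (arc_iota1 d t \<gamma>) = arc_iota1 d t (arcs.rot (- k - 1) \<gamma>)" using arcs.i1_rot[OF g, of "- k - 1"] by (simp add: algebra_simps)
    also have "\<dots> = arc_iota2 d t (arcs.rot (- k) \<gamma>)"
      unfolding arcs.rot_pred[OF g] using arc_iota1_arc_iota1 arc_iota2_in arcs.rot_in[OF g] by simp
    finally show "rf (arcs.rot (k + 1) (arc_iota1 d t \<gamma>)) f = rf (arcs.rot (- k) \<gamma>) f" unfolding f by (simp add: snd_arc_iota2)
  qed (rule R_def)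
qed

theorem certificate_iff:
  "(\<exists>e. \<forall>\<gamma>\<in>Arcs d t. rf (arcs.rot 1 \<gamma>) e - rf \<gamma> e = \<delta> \<gamma>) \<longleftrightarrow> (\<exists>n. pts.rot n pt_inf = iota1 d t pt_inf)"
  using certificate_imp_orbit orbit_imp_certificate by metis

end

section \<open>Elimination and the function field\<close>

definition arc_poly :: "complex poly poly \<Rightarrow> complex fls \<times> complex fls \<Rightarrow> complex fls" where
  "arc_poly P \<gamma> = fold_coeffs (\<lambda>c r. fls_poly c (fst \<gamma>) + snd \<gamma> * r) P 0"

lemma arc_poly_0 [simp]: "arc_poly 0 \<gamma> = 0"
  by (simp add: arc_poly_def)

lemma arc_poly_pCons [simp]: "arc_poly (pCons c p) \<gamma> = fls_poly c (fst \<gamma>) + snd \<gamma> * arc_poly p \<gamma>"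
  by (cases "p = 0 \<and> c = 0") (auto simp: arc_poly_def)

lemma arc_poly_1 [simp]: "arc_poly 1 \<gamma> = 1"
  by (simp add: one_pCons)

lemma arc_poly_add [simp]: "arc_poly (p + q) \<gamma> = arc_poly p \<gamma> + arc_poly q \<gamma>"
  by (induction p q rule: poly_induct2) (auto simp: algebra_simps)

lemma arc_poly_minus [simp]: "arc_poly (- p) \<gamma> = - arc_poly p \<gamma>"
  by (induction p) (auto simp: algebra_simps)

lemma arc_poly_diff [simp]: "arc_poly (p - q) \<gamma> = arc_poly p \<gamma> - arc_poly q \<gamma>"
  using arc_poly_add[of p "- q" \<gamma>] by simp

lemma arc_poly_smult [simp]: "arc_poly (Polynomial.smult c p) \<gamma> = fls_poly c (fst \<gamma>) * arc_poly p \<gamma>"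
  by (induction p) (auto simp: algebra_simps)

lemma arc_poly_mult [simp]: "arc_poly (p * q) \<gamma> = arc_poly p \<gamma> * arc_poly q \<gamma>"
  by (induction p) (auto simp: algebra_simps)

lemma eval2_simps [simp]:
  "eval2 0 x y = 0" "eval2 1 x y = 1" "eval2 (pCons c p) x y = poly c x + y * eval2 p x y"
  "eval2 (p + q) x y = eval2 p x y + eval2 q x y" "eval2 (p - q) x y = eval2 p x y - eval2 q x y"
  "eval2 (- p) x y = - eval2 p x y"
  "eval2 (p * q) x y = eval2 p x y * eval2 q x y"
  by (simp_all add: eval2_def)

lemma degree_linear_le: "degree [:u, v:] \<le> 1"
  using degree_pCons_le[of u "[:v:]"] by simp

lemma unit_poly_degree: "p dvd 1 \<Longrightarrow> degree p = 0" for p :: "'a::idom poly"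
  using dvd_imp_degree_le[of p 1] by simp

lemma walk_kernel_pCons: "walk_kernel d t = [:pC d t, pB d t, pA d t:]"
proof -
  have c: "const2 c = [:[:c:]:]" for c by (simp add: const2_def)
  show ?thesis
    unfolding walk_kernel_def c X_def Y_def pA_def pB_def pC_def kernel_coeff_def
    by (simp add: numeral_2_eq_2 algebra_simps)
qed

section \<open>Consequences of irreducibility of the kernel\<close>

locale kern =
  fixes d :: "int \<Rightarrow> int \<Rightarrow> complex" and t :: complex
  assumes irr: "irreducible (walk_kernel d t)"
    and degx: "degree_x (walk_kernel d t) = 2"
    and degy: "degree_y (walk_kernel d t) = 2"
begin

abbreviation "K \<equiv> walk_kernel d t"

lemma prime_K: "prime_elem K"
  using irr by (rule irreducible_imp_prime_elem)

lemma degree_K: "degree K = 2"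
  using degy by (simp add: degree_y_def)

lemma pA_nz: "pA d t \<noteq> 0"
  using degree_K degree_linear_le[of "pC d t" "pB d t"] by (auto simp: walk_kernel_pCons simp del: degree_pCons_eq_if)

lemma kc2_nz: "kernel_coeff d t 2 0 \<noteq> 0 \<or> kernel_coeff d t 2 1 \<noteq> 0 \<or> kernel_coeff d t 2 2 \<noteq> 0"
proof (rule ccontr)
  assume n: "\<not> ?thesis"
  have "degree (poly.coeff K j) \<le> 1" for j
  proof -
    have "j = 0 \<or> j = 1 \<or> j = 2 \<or> 2 < j" by linarith
    then show ?thesis using n
      by (auto simp: walk_kernel_pCons pA_def pB_def pC_def numeral_2_eq_2 coeff_pCons split: nat.splits)
  qed
  then have "degree_x K \<le> 1" unfolding degree_x_def by (intro Max.boundedI) auto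
  then show False using degx by simp
qed

lemma not_K_dvd:
  assumes "q \<noteq> 0" "degree q < 2"
  shows "\<not> K dvd q"
  using dvd_imp_degree_le[of K q] degree_K assms by auto

lemma not_K_dvd_linear: "u \<noteq> 0 \<or> v \<noteq> 0 \<Longrightarrow> \<not> K dvd [:u, v:]"
  using not_K_dvd[of "[:u, v:]"] degree_linear_le[of u v] by auto

lemma not_K_dvd_mult: "\<not> K dvd p \<Longrightarrow> \<not> K dvd q \<Longrightarrow> \<not> K dvd p * q"
  using prime_K by (simp add: prime_elem_dvd_mult_iff)

text \<open>If the whole fibre over x = a lay on the curve, x - a would divide A, B and C and thus
  K. Over x = infinity the degree 2 in x excludes this.\<close>

lemma fibre_x_nz:
  assumes "(x0, x1) \<noteq> (0, 0)"
  shows "\<exists>y0 y1. kernel_hom d t x0 x1 y0 y1 \<noteq> 0"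
proof (rule ccontr)
  assume "\<not> ?thesis"
  then have z: "kernel_hom d t x0 x1 y0 y1 = 0" for y0 y1 by blast
  have "fA d t x0 x1 = 0" "fC d t x0 x1 = 0" using z[of 1 0] z[of 0 1] by (simp_all add: kernel_hom_form)
  moreover from this have "fB d t x0 x1 = 0" using z[of 1 1] by (simp add: kernel_hom_form)
  ultimately have f: "fA d t x0 x1 = 0" "fB d t x0 x1 = 0" "fC d t x0 x1 = 0" by auto
  show False
  proof (cases "x1 = 0")
    case True
    then show False using f assms kc2_nz by (simp add: fA_def fB_def fC_def)
  next
    case False
    define a where "a = x0 / x1"
    have x0: "x0 = a * x1" using False by (simp add: a_def)
    have r: "poly (pA d t) a = 0" "poly (pB d t) a = 0" "poly (pC d t) a = 0"
    proof -
      have "x1 ^ 2 * poly (pA d t) a = fA d t x0 x1" "x1 ^ 2 * poly (pB d t) a = fB d t x0 x1"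
        "x1 ^ 2 * poly (pC d t) a = fC d t x0 x1"
        unfolding x0 by (simp_all add: pA_def pB_def pC_def fA_def fB_def fC_def algebra_simps power2_eq_square)
      with f False show "poly (pA d t) a = 0" "poly (pB d t) a = 0" "poly (pC d t) a = 0" by simp_all
    qed
    let ?l = "[:- a, 1:]"
    obtain A B C where "pA d t = ?l * A" "pB d t = ?l * B" "pC d t = ?l * C"
      using r unfolding poly_eq_0_iff_dvd dvd_def by blast
    then have K: "K = [:?l:] * [:C, B, A:]" by (simp add: walk_kernel_pCons)
    then have "is_unit [:?l:] \<or> is_unit [:C, B, A:]" using irr irreducibleD by blast
    moreover have "\<not> is_unit [:?l:]" by (simp add: is_unit_const_poly_iff is_unit_iff_degree)
    moreover have "\<not> is_unit [:C, B, A:]"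
    proof
      assume "is_unit [:C, B, A:]"
      then have "degree [:C, B, A:] = 0" by (rule unit_poly_degree)
      moreover have "degree K \<le> degree [:?l:] + degree [:C, B, A:]" unfolding K by (rule degree_mult_le)
      ultimately have "degree K = 0" by (simp only: degree_pCons_0)
      then show False using degree_K by simp
    qed
    ultimately show False by blast
  qed
qed

lemma poly_K: "poly K [:y:] = pC d t + Polynomial.smult y (pB d t + Polynomial.smult y (pA d t))"
  by (simp add: walk_kernel_pCons)

lemma poly_K_flip: "poly K [:y:] = [:poly (pC (flip d) t) y, poly (pB (flip d) t) y, poly (pA (flip d) t) y:]"
  by (simp add: poly_K pA_def pB_def pC_def kernel_coeff_flip algebra_simps)

text \<open>A horizontal line y = a in the curve would split off the factor y - a, leaving a
  cofactor of degree 1 in y. The line y = infinity would force A = 0, against the degree 2 in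
  y.\<close>

lemma fibre_y_nz:
  assumes "(y0, y1) \<noteq> (0, 0)"
  shows "\<exists>x0 x1. kernel_hom d t x0 x1 y0 y1 \<noteq> 0"
proof (rule ccontr)
  assume "\<not> ?thesis"
  then have z: "kernel_hom d t x0 x1 y0 y1 = 0" for x0 x1 by blast
  show False
  proof (cases "y1 = 0")
    case True
    then have f: "fA d t x0 x1 = 0" for x0 x1 using z[of x0 x1] assms by (simp add: kernel_hom_form)
    have "poly (pA d t) x = fA d t x 1" for x
      by (simp add: pA_def fA_def algebra_simps power2_eq_square)
    then have "poly (pA d t) x = 0" for x using f by simp
    then show False using pA_nz by (simp add: poly_all_0_iff_0[symmetric])
  next
    case False
    define a where "a = y0 / y1"
    have y0: "y0 = a * y1" using False by (simp add: a_def)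
    have "y1 ^ 2 * poly (poly K [:a:]) x = kernel_hom d t x 1 y0 y1" for x
      unfolding y0 by (simp add: poly_K kernel_hom_form pA_def pB_def pC_def fA_def fB_def fC_def algebra_simps power2_eq_square)
    then have "poly (poly K [:a:]) x = 0" for x using z False by simp
    then have "poly K [:a:] = 0" by (simp add: poly_all_0_iff_0[symmetric])
    then obtain M where M: "K = [:- [:a:], 1:] * M" by (metis poly_eq_0_iff_dvd dvdE)
    then have "M \<noteq> 0" using degree_K by auto
    then have "degree K = 1 + degree M" unfolding M by (subst degree_mult_eq) auto
    then have "degree M = 1" using degree_K by simp
    then have "\<not> is_unit M" using unit_poly_degree[of M] unit_poly_degree[of "[:- [:a:], 1:]"] by auto
    moreover have "\<not> is_unit [:- [:a:], 1:]" using unit_poly_degree[of M] unit_poly_degree[of "[:- [:a:], 1:]"] by auto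
    ultimately show False using irreducibleD[OF irr M] by blast
  qed
qed

text \<open>Elimination of \<open>y\<close>: reduce \<open>q\<close> modulo \<open>K\<close> to \<open>u + v y\<close> and multiply by a conjugate.\<close>

lemma eliminate_y:
  assumes "\<not> K dvd q"
  shows "\<exists>U V r. r \<noteq> 0 \<and> U * K + V * q = [:r:]"
proof -
  have K0: "K \<noteq> 0" using degree_K by auto
  obtain S R where SR: "pseudo_divmod q K = (S, R)" by fastforce
  have lc: "poly.coeff K 2 = pA d t" by (simp add: walk_kernel_pCons numeral_2_eq_2)
  obtain n where n: "Polynomial.smult (pA d t ^ n) q = K * S + R"
    using pseudo_divmod(1)[OF K0 SR] unfolding degree_K lc by blast
  have R: "R = 0 \<or> degree R < 2" using pseudo_divmod(2)[OF K0 SR] degree_K by simp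
  have A: "\<not> K dvd [:pA d t ^ n:]" by (rule not_K_dvd) (use pA_nz in auto)
  have "\<not> K dvd R"
  proof
    assume "K dvd R"
    then have "K dvd [:pA d t ^ n:] * q" using n by simp
    then show False using not_K_dvd_mult[OF A assms] by blast
  qed
  then have R0: "R \<noteq> 0" by auto
  define u v where uv: "u = poly.coeff R 0" "v = poly.coeff R 1"
  have Ruv: "R = [:u, v:]"
  proof (rule poly_eqI)
    fix i
    have "i = 0 \<or> i = 1 \<or> degree R < i" using R R0 by linarith
    then show "poly.coeff R i = poly.coeff [:u, v:] i"
      by (auto simp: uv coeff_eq_0 coeff_pCons split: nat.splits)
  qed
  \<comment> \<open>\<open>W\<close> is A times the conjugate u + v (-B/A - y) of the remainder u +
    v y, and \<open>N\<close> is A times its norm.\<close>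
  define W where "W = [:pA d t * u - pB d t * v, - pA d t * v:]"
  define N where "N = pA d t * u ^ 2 - pB d t * u * v + pC d t * v ^ 2"
  have RW: "R * W = [:N:] - [:v ^ 2:] * K"
    by (simp add: Ruv W_def N_def walk_kernel_pCons algebra_simps power2_eq_square)
  have "W \<noteq> 0" using R0 pA_nz by (auto simp: W_def Ruv)
  then have "\<not> K dvd W" unfolding W_def by (intro not_K_dvd_linear) auto
  then have "\<not> K dvd R * W" using \<open>\<not> K dvd R\<close> not_K_dvd_mult by blast
  moreover have "R * W = K * (- [:v ^ 2:])" if "N = 0" using RW that by simp
  ultimately have N: "N \<noteq> 0" by (metis dvd_triv_left)
  have "([:v ^ 2:] - S * W) * K + ([:pA d t ^ n:] * W) * q =
      [:v ^ 2:] * K - K * S * W + W * Polynomial.smult (pA d t ^ n) q"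
    by (simp add: algebra_simps)
  also have "\<dots> = [:v ^ 2:] * K + R * W" unfolding n by (simp only: algebra_simps)
  also have "\<dots> = [:N:]" unfolding RW by (simp only: algebra_simps)
  finally show ?thesis using N by blast
qed

lemma arc_poly_K: "arc d t f g \<Longrightarrow> arc_poly K (f, g) = 0"
  by (simp add: arc_def walk_kernel_pCons algebra_simps power2_eq_square)

text \<open>Every arc is a generic point of the curve: if \<open>K\<close> did not divide
  \<open>q\<close>, elimination would produce a nonzero polynomial in x alone that vanishes at a
  transcendental series.\<close>

lemma arc_poly_eq_0_iff:
  assumes "arc d t f g"
  shows "arc_poly q (f, g) = 0 \<longleftrightarrow> K dvd q"
proof
  assume 0: "arc_poly q (f, g) = 0"
  show "K dvd q"
  proof (rule ccontr)
    assume "\<not> K dvd q"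
    then obtain U V r where r: "r \<noteq> 0" "U * K + V * q = [:r:]" using eliminate_y by blast
    have "fls_poly r f = arc_poly (U * K + V * q) (f, g)" unfolding r(2) by simp
    also have "\<dots> = 0" using 0 arc_poly_K[OF assms] by simp
    finally show False using r(1) fls_poly_nonzero assms by (auto simp: arc_def)
  qed
qed (auto simp: arc_poly_K[OF assms])

end

sublocale kern \<subseteq> biquad
proof
  show "pA d t \<noteq> 0" by (rule pA_nz)
  show A2: "pA (flip d) t \<noteq> 0" using kc2_nz by (auto simp: pA_def kernel_coeff_flip)
  show "a = 0 \<and> b = 0" if "arc d t f g" "fls_poly a f + fls_poly b f * disc_root d t f g = 0" for f g a b
  proof -
    \<comment> \<open>The expression a + b \<delta> as a polynomial of degree below 2 in y, which
      \<open>K\<close> divides only if it is zero.\<close>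
    define q where "q = [:a + b * pB d t, 2 * b * pA d t:]"
    have "arc_poly q (f, g) = 0" using that(2) by (simp add: q_def disc_root_def algebra_simps)
    then have "K dvd q" using arc_poly_eq_0_iff that(1) by blast
    then have "a + b * pB d t = 0" "2 * b * pA d t = 0" using not_K_dvd_linear unfolding q_def by blast+
    then show ?thesis using pA_nz by auto
  qed
  show "a = 0 \<and> b = 0" if g: "arc d t f g" and z: "fls_poly a g + fls_poly b g * disc_root (flip d) t g f = 0" for f g a b
  proof -
    \<comment> \<open>A polynomial in y lifted to the outer variable. The degree comparison has to
      take place in x, although \<open>K\<close> is represented as a polynomial in y.\<close>
    define L where "L p = map_poly (\<lambda>c. [:c:]) p" for p :: "complex poly"
    have L: "arc_poly (L p) (f, g) = fls_poly p g" "poly (L p) [:y:] = [:poly p y:]" for p y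
      unfolding L_def by (induction p) (auto simp: map_poly_pCons)
    define q where "q = L (a + b * pB (flip d) t) + [:[:0, 1:]:] * L (2 * b * pA (flip d) t)"
    have "arc_poly q (f, g) = 0" using z by (simp add: q_def L disc_root_def algebra_simps)
    then obtain M where M: "q = K * M" using arc_poly_eq_0_iff[OF g] by blast
    \<comment> \<open>At a number y where the leading coefficient in x survives, \<open>K\<close>
      specialises to degree 2 in x and \<open>q\<close> to degree at most 1, so divisibility makes
      the latter zero.\<close>
    have ab: "poly a y = 0 \<and> poly b y = 0" if y: "poly (pA (flip d) t) y \<noteq> 0" for y
    proof -
      have "poly q [:y:] = [:poly (a + b * pB (flip d) t) y, poly (2 * b * pA (flip d) t) y:]"
        by (simp add: q_def L)
      moreover have "poly q [:y:] = poly K [:y:] * poly M [:y:]" by (simp add: M)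
      moreover have "degree (poly K [:y:]) = 2" using y by (simp add: poly_K_flip)
      ultimately have "[:poly (a + b * pB (flip d) t) y, poly (2 * b * pA (flip d) t) y:] = 0"
        using degree_linear_le[of "poly (a + b * pB (flip d) t) y" "poly (2 * b * pA (flip d) t) y"]
          degree_mult_eq[of "poly K [:y:]" "poly M [:y:]"] by (cases "poly M [:y:] = 0"; cases "poly K [:y:] = 0") simp_all
      then show ?thesis using y by auto
    qed
    \<comment> \<open>The finitely many excluded values of y are absorbed by multiplying with that
      leading coefficient.\<close>
    have z0: "p = 0" if "\<And>y. poly (pA (flip d) t) y \<noteq> 0 \<Longrightarrow> poly p y = 0" for p
    proof -
      have "poly (pA (flip d) t * p) y = 0" for y using that[of y] by auto
      then have "pA (flip d) t * p = 0" using poly_all_0_iff_0 by blast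
      then show ?thesis using A2 by simp
    qed
    show ?thesis using z0[of a] z0[of b] ab by blast
  qed
qed (use fibre_x_nz fibre_y_nz in auto)

section \<open>The field of fractions modulo the kernel\<close>

context kern
begin

abbreviation "F \<equiv> function_field K"

lemma arc_poly_zero_iff: "\<gamma> \<in> Arcs d t \<Longrightarrow> arc_poly q \<gamma> = 0 \<longleftrightarrow> K dvd q"
  using arc_poly_eq_0_iff[of "fst \<gamma>" "snd \<gamma>"] ArcsD(1)[of \<gamma>] by simp

lemma ratio_eq_iff:
  assumes "\<not> K dvd q" "\<not> K dvd q'"
  shows "ratio K p q = ratio K p' q' \<longleftrightarrow> K dvd p * q' - p' * q"
proof
  assume "ratio K p q = ratio K p' q'"
  moreover have "(p', q') \<in> ratio K p' q'" using assms by (simp add: ratio_def frac_rel_def)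
  ultimately have "(p', q') \<in> ratio K p q" by simp
  then show "K dvd p * q' - p' * q" by (simp add: ratio_def frac_rel_def)
next
  \<comment> \<open>Transitivity of equality of fractions: the middle denominator is cancelled
    because \<open>K\<close> is prime.\<close>
  have *: "K dvd p * s - r * q"
    if "K dvd p * q' - p' * q" "K dvd p' * s - r * q'" "\<not> K dvd q'" for p q p' q' r s
  proof -
    have "q' * (p * s - r * q) = (p * q' - p' * q) * s + (p' * s - r * q') * q" by (simp add: algebra_simps)
    then have "K dvd q' * (p * s - r * q)" using that by simp
    then show ?thesis using that(3) prime_K by (simp add: prime_elem_dvd_mult_iff)
  qed
  assume d: "K dvd p * q' - p' * q"
  then have d': "K dvd p' * q - p * q'" by (metis dvd_minus_iff minus_diff_eq)
  show "ratio K p q = ratio K p' q'"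
    using *[OF d _ assms(2)] *[OF d' _ assms(1)] assms
    by (auto simp: ratio_def frac_rel_def)
qed

lemma ratio_self: "\<not> K dvd q \<Longrightarrow> (p, q) \<in> ratio K p q"
  by (simp add: ratio_def frac_rel_def)

lemma mem_ratio: "\<not> K dvd q \<Longrightarrow> (p', q') \<in> ratio K p q \<longleftrightarrow> \<not> K dvd q' \<and> ratio K p' q' = ratio K p q"
proof (cases "K dvd q'")
  case False
  assume q: "\<not> K dvd q"
  have "K dvd p' * q - p * q' \<longleftrightarrow> K dvd p * q' - p' * q" by (metis dvd_minus_iff minus_diff_eq)
  then show ?thesis using ratio_eq_iff[OF False q] q False by (simp add: ratio_def frac_rel_def)
qed (simp add: ratio_def frac_rel_def)

text \<open>Any one arc embeds the field of fractions into the Laurent series, so equality is tested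
  by a single evaluation. This replaces divisibility computations in showing the operations well
  defined.\<close>

lemma ratio_eq_iff':
  assumes "\<gamma> \<in> Arcs d t" "\<not> K dvd q" "\<not> K dvd q'"
  shows "ratio K p q = ratio K p' q' \<longleftrightarrow> arc_poly p \<gamma> / arc_poly q \<gamma> = arc_poly p' \<gamma> / arc_poly q' \<gamma>"
proof -
  have nz: "arc_poly q \<gamma> \<noteq> 0" "arc_poly q' \<gamma> \<noteq> 0" using arc_poly_zero_iff[OF assms(1)] assms(2,3) by blast+
  have "arc_poly p \<gamma> / arc_poly q \<gamma> = arc_poly p' \<gamma> / arc_poly q' \<gamma> \<longleftrightarrow> arc_poly (p * q' - p' * q) \<gamma> = 0"
    unfolding frac_eq_eq[OF nz] by simp
  then show ?thesis using ratio_eq_iff[OF assms(2,3)] arc_poly_zero_iff[OF assms(1)] by blast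
qed

lemma ratio_in: "\<not> K dvd q \<Longrightarrow> ratio K p q \<in> carrier F"
  by (auto simp: function_field_def ratio_def quotient_def)

lemma carrier_cases:
  assumes "f \<in> carrier F"
  obtains p q where "f = ratio K p q" "\<not> K dvd q"
  using assms by (auto simp: function_field_def ratio_def quotient_def)

lemma UN_const2:
  assumes "f \<noteq> {}" "g \<noteq> {}" "\<And>x y. x \<in> f \<Longrightarrow> y \<in> g \<Longrightarrow> h x y = c"
  shows "(\<Union>x\<in>f. \<Union>y\<in>g. h x y) = c"
  using assms by auto

text \<open>The product in \<open>function_field\<close> is a union over all representatives. Each
  pair of them contributes the same class, since the values along an arc agree.\<close>

lemma mult_ratio:
  assumes "\<not> K dvd q" "\<not> K dvd q'"
  shows "ratio K p q \<otimes>\<^bsub>F\<^esub> ratio K p' q' = ratio K (p * p') (q * q')"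
proof -
  obtain \<gamma> where g: "\<gamma> \<in> Arcs d t" using ex_arc by blast
  have e: "arc_poly (p * p') \<gamma> / arc_poly (q * q') \<gamma> = arc_poly p \<gamma> / arc_poly q \<gamma> * (arc_poly p' \<gamma> / arc_poly q' \<gamma>)" for p q p' q'
    by simp
  have "(\<Union>x\<in>ratio K p q. \<Union>y\<in>ratio K p' q'. case x of (r, s) \<Rightarrow> case y of (r', s') \<Rightarrow> ratio K (r * r') (s * s'))
      = ratio K (p * p') (q * q')"
  proof (rule UN_const2)
    show "ratio K p q \<noteq> {}" "ratio K p' q' \<noteq> {}" using ratio_self assms by blast+
    fix x y assume "x \<in> ratio K p q" "y \<in> ratio K p' q'"
    then obtain r s r' s' where xy: "x = (r, s)" "y = (r', s')" and s: "\<not> K dvd s" "\<not> K dvd s'"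
      and "ratio K r s = ratio K p q" "ratio K r' s' = ratio K p' q'"
      using assms by (cases x; cases y) (auto simp: mem_ratio)
    then have v: "arc_poly r \<gamma> / arc_poly s \<gamma> = arc_poly p \<gamma> / arc_poly q \<gamma>" "arc_poly r' \<gamma> / arc_poly s' \<gamma> = arc_poly p' \<gamma> / arc_poly q' \<gamma>"
      using ratio_eq_iff'[OF g] assms by blast+
    show "(case x of (r, s) \<Rightarrow> case y of (r', s') \<Rightarrow> ratio K (r * r') (s * s')) = ratio K (p * p') (q * q')"
      unfolding xy prod.case ratio_eq_iff'[OF g not_K_dvd_mult[OF s] not_K_dvd_mult[OF assms]] e
      by (simp only: v)
  qed
  then show ?thesis by (simp add: function_field_def case_prod_beta)
qed

lemma add_ratio:
  assumes "\<not> K dvd q" "\<not> K dvd q'"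
  shows "ratio K p q \<oplus>\<^bsub>F\<^esub> ratio K p' q' = ratio K (p * q' + p' * q) (q * q')"
proof -
  obtain \<gamma> where g: "\<gamma> \<in> Arcs d t" using ex_arc by blast
  have e: "arc_poly (p * q' + p' * q) \<gamma> / arc_poly (q * q') \<gamma> = arc_poly p \<gamma> / arc_poly q \<gamma> + arc_poly p' \<gamma> / arc_poly q' \<gamma>"
    if "\<not> K dvd q" "\<not> K dvd q'" for p q p' q'
    using that arc_poly_zero_iff[OF g] by (simp add: add_frac_eq)
  have "(\<Union>x\<in>ratio K p q. \<Union>y\<in>ratio K p' q'. case x of (r, s) \<Rightarrow> case y of (r', s') \<Rightarrow> ratio K (r * s' + r' * s) (s * s'))
      = ratio K (p * q' + p' * q) (q * q')"
  proof (rule UN_const2)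
    show "ratio K p q \<noteq> {}" "ratio K p' q' \<noteq> {}" using ratio_self assms by blast+
    fix x y assume "x \<in> ratio K p q" "y \<in> ratio K p' q'"
    then obtain r s r' s' where xy: "x = (r, s)" "y = (r', s')" and s: "\<not> K dvd s" "\<not> K dvd s'"
      and "ratio K r s = ratio K p q" "ratio K r' s' = ratio K p' q'"
      using assms by (cases x; cases y) (auto simp: mem_ratio)
    then have v: "arc_poly r \<gamma> / arc_poly s \<gamma> = arc_poly p \<gamma> / arc_poly q \<gamma>" "arc_poly r' \<gamma> / arc_poly s' \<gamma> = arc_poly p' \<gamma> / arc_poly q' \<gamma>"
      using ratio_eq_iff'[OF g] assms by blast+
    show "(case x of (r, s) \<Rightarrow> case y of (r', s') \<Rightarrow> ratio K (r * s' + r' * s) (s * s')) = ratio K (p * q' + p' * q) (q * q')"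
      unfolding xy prod.case ratio_eq_iff'[OF g not_K_dvd_mult[OF s] not_K_dvd_mult[OF assms]] e[OF s] e[OF assms]
      by (simp only: v)
  qed
  then show ?thesis by (simp add: function_field_def case_prod_beta)
qed

lemma zero_F: "\<zero>\<^bsub>F\<^esub> = ratio K 0 1" and one_F: "\<one>\<^bsub>F\<^esub> = ratio K 1 1"
  by (simp_all add: function_field_def)

lemma K_not_dvd_1: "\<not> K dvd 1"
  using prime_K by (auto simp: prime_elem_def)

lemma function_field_field: "field F"
proof -
  note [simp] = zero_F one_F mult_ratio add_ratio K_not_dvd_1 not_K_dvd_mult ratio_in ratio_eq_iff
  have "cring F"
  proof (rule cringI)
    show "abelian_group F"
    proof (rule abelian_groupI)
      fix x y assume "x \<in> carrier F" "y \<in> carrier F"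
      then show "x \<oplus>\<^bsub>F\<^esub> y \<in> carrier F" by (elim carrier_cases) simp
    next
      show "\<zero>\<^bsub>F\<^esub> \<in> carrier F" by simp
    next
      fix x y z assume "x \<in> carrier F" "y \<in> carrier F" "z \<in> carrier F"
      then show "x \<oplus>\<^bsub>F\<^esub> y \<oplus>\<^bsub>F\<^esub> z = x \<oplus>\<^bsub>F\<^esub> (y \<oplus>\<^bsub>F\<^esub> z)" by (elim carrier_cases) (simp add: algebra_simps)
    next
      fix x y assume "x \<in> carrier F" "y \<in> carrier F"
      then show "x \<oplus>\<^bsub>F\<^esub> y = y \<oplus>\<^bsub>F\<^esub> x" by (elim carrier_cases) (simp add: algebra_simps)
    next
      fix x assume "x \<in> carrier F"
      then show "\<zero>\<^bsub>F\<^esub> \<oplus>\<^bsub>F\<^esub> x = x" by (elim carrier_cases) simp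
    next
      fix x assume "x \<in> carrier F"
      then obtain p q where "x = ratio K p q" "\<not> K dvd q" by (rule carrier_cases)
      then show "\<exists>y\<in>carrier F. y \<oplus>\<^bsub>F\<^esub> x = \<zero>\<^bsub>F\<^esub>"
        by (intro bexI[of _ "ratio K (- p) q"]) (simp_all)
    qed
    show "comm_monoid F"
    proof (rule comm_monoidI)
      fix x y assume "x \<in> carrier F" "y \<in> carrier F"
      then show "x \<otimes>\<^bsub>F\<^esub> y \<in> carrier F" by (elim carrier_cases) simp
    next
      fix x y z assume "x \<in> carrier F" "y \<in> carrier F" "z \<in> carrier F"
      then show "x \<otimes>\<^bsub>F\<^esub> y \<otimes>\<^bsub>F\<^esub> z = x \<otimes>\<^bsub>F\<^esub> (y \<otimes>\<^bsub>F\<^esub> z)" by (elim carrier_cases) (simp add: algebra_simps)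
    next
      fix x y assume "x \<in> carrier F" "y \<in> carrier F"
      then show "x \<otimes>\<^bsub>F\<^esub> y = y \<otimes>\<^bsub>F\<^esub> x" by (elim carrier_cases) (simp add: algebra_simps)
    next
      fix x assume "x \<in> carrier F"
      then show "\<one>\<^bsub>F\<^esub> \<otimes>\<^bsub>F\<^esub> x = x" by (elim carrier_cases) simp
    qed simp
    fix x y z assume "x \<in> carrier F" "y \<in> carrier F" "z \<in> carrier F"
    then show "(x \<oplus>\<^bsub>F\<^esub> y) \<otimes>\<^bsub>F\<^esub> z = x \<otimes>\<^bsub>F\<^esub> z \<oplus>\<^bsub>F\<^esub> y \<otimes>\<^bsub>F\<^esub> z" by (elim carrier_cases) (simp add: algebra_simps)
  qed
  then interpret cring F .
  show "field F"
  proof (rule cring_fieldI)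
    have "Units F = {x \<in> carrier F. x \<noteq> \<zero>\<^bsub>F\<^esub>}"
    proof (intro equalityI subsetI CollectI conjI)
      fix x assume x: "x \<in> Units F"
      then show "x \<in> carrier F" by (rule Units_closed)
      show "x \<noteq> \<zero>\<^bsub>F\<^esub>"
      proof
        assume "x = \<zero>\<^bsub>F\<^esub>"
        then have "\<one>\<^bsub>F\<^esub> = \<zero>\<^bsub>F\<^esub>" using Units_r_inv[OF x] Units_inv_closed[OF x] l_null by metis
        then show False by simp
      qed
    next
      fix x assume "x \<in> {x \<in> carrier F. x \<noteq> \<zero>\<^bsub>F\<^esub>}"
      then have x: "x \<in> carrier F" "x \<noteq> \<zero>\<^bsub>F\<^esub>" by auto
      then obtain p q where pq: "x = ratio K p q" "\<not> K dvd q" by (metis carrier_cases)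
      then have p: "\<not> K dvd p" using x by simp
      have "ratio K (q * p) (p * q) = ratio K 1 1" "ratio K (p * q) (q * p) = ratio K 1 1"
        using pq p by (simp_all del: not_K_dvd_mult add: not_K_dvd_mult mult.commute)
      then show "x \<in> Units F"
        unfolding Units_def using x(1) pq p by (intro CollectI conjI bexI[of _ "ratio K q p"]) simp_all
    qed
    then show "Units F = carrier F - {\<zero>\<^bsub>F\<^esub>}" by auto
  qed
qed

lemma minus_ratio:
  assumes "\<not> K dvd q" "\<not> K dvd q'"
  shows "ratio K p q \<ominus>\<^bsub>F\<^esub> ratio K p' q' = ratio K (p * q' - p' * q) (q * q')"
proof -
  interpret field F by (rule function_field_field)
  have "ratio K (- p') q' \<oplus>\<^bsub>F\<^esub> ratio K p' q' = \<zero>\<^bsub>F\<^esub>"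
    using assms by (simp add: add_ratio zero_F ratio_eq_iff not_K_dvd_mult K_not_dvd_1)
  then have "\<ominus>\<^bsub>F\<^esub> ratio K p' q' = ratio K (- p') q'"
    using assms by (intro minus_equality) (simp_all add: ratio_in)
  then show ?thesis using assms by (simp add: a_minus_def add_ratio)
qed

section \<open>Values at all but finitely many points, and pullbacks\<close>

definition almost_all :: "(complex \<Rightarrow> complex \<Rightarrow> bool) \<Rightarrow> bool" where
  "almost_all Q \<longleftrightarrow> finite {(x, y). eval2 K x y = 0 \<and> \<not> Q x y}"

lemma almost_all_mono:
  assumes "almost_all Q" "\<And>x y. eval2 K x y = 0 \<Longrightarrow> Q x y \<Longrightarrow> Q' x y"
  shows "almost_all Q'"
  using assms(1) unfolding almost_all_def by (rule finite_subset[rotated]) (use assms(2) in auto)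

lemma almost_all_conj:
  assumes "almost_all Q" "almost_all Q'"
  shows "almost_all (\<lambda>x y. Q x y \<and> Q' x y)"
proof -
  have "{(x, y). eval2 K x y = 0 \<and> \<not> (Q x y \<and> Q' x y)} =
    {(x, y). eval2 K x y = 0 \<and> \<not> Q x y} \<union> {(x, y). eval2 K x y = 0 \<and> \<not> Q' x y}" by auto
  then show ?thesis using assms unfolding almost_all_def by simp
qed

lemma on_curve_affine: "(affine x y) \<in> E \<longleftrightarrow> eval2 K x y = 0"
proof -
  have "kernel_hom d t x 1 y 1 = eval2 K x y"
    by (simp add: kernel_hom_form walk_kernel_pCons fA_def fB_def fC_def pA_def pB_def pC_def
        algebra_simps power2_eq_square)
  then show ?thesis by (simp add: kernel_curve_def of_complex_mk on_curve_mk)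
qed

lemma almost_all_poly_nz:
  assumes "r \<noteq> 0" shows "almost_all (\<lambda>x y. poly r x \<noteq> 0)"
proof -
  have f: "finite (cp1_of_complex ` {x. poly r x = 0})" using poly_roots_finite[OF assms] by simp
  have "(\<lambda>(x, y). (affine x y)) ` {(x, y). eval2 K x y = 0 \<and> \<not> poly r x \<noteq> 0}
      \<subseteq> {P \<in> E. fst P \<in> cp1_of_complex ` {x. poly r x = 0}}"
    by (auto simp: on_curve_affine)
  then have "finite ((\<lambda>(x, y). (affine x y)) ` {(x, y). eval2 K x y = 0 \<and> \<not> poly r x \<noteq> 0})"
    using finite_subset finite_fst[OF f] by blast
  then show ?thesis unfolding almost_all_def by (rule finite_imageD) (auto simp: inj_on_def)
qed

text \<open>A common zero of \<open>K\<close> and \<open>q\<close> has as x-coordinate a root of the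
  eliminant, and finitely many points lie over these roots.\<close>

lemma almost_all_eval2_nz:
  assumes "\<not> K dvd q" shows "almost_all (\<lambda>x y. eval2 q x y \<noteq> 0)"
proof -
  obtain U V r where r: "r \<noteq> 0" "U * K + V * q = [:r:]" using eliminate_y[OF assms] by blast
  show ?thesis
  proof (rule almost_all_mono[OF almost_all_poly_nz[OF r(1)]])
    fix x y assume "eval2 K x y = 0" "poly r x \<noteq> 0"
    moreover have "eval2 (U * K + V * q) x y = poly r x" unfolding r(2) by simp
    ultimately show "eval2 q x y \<noteq> 0" by auto
  qed
qed

text \<open>The affine part of the curve is infinite, since it has a point over every x that is not
  a root of A.\<close>

lemma almost_all_nontrivial: "\<not> almost_all (\<lambda>x y. False)"
proof
  assume "almost_all (\<lambda>x y. False)"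
  then have f: "finite (fst ` {(x, y). eval2 K x y = 0})" unfolding almost_all_def by simp
  have "x \<in> fst ` {(x, y). eval2 K x y = 0}" if x: "poly (pA d t) x \<noteq> 0" for x
  proof -
    have "\<not> constant (poly [:poly (pC d t) x, poly (pB d t) x, poly (pA d t) x:])"
      using x constant_degree[of "[:poly (pC d t) x, poly (pB d t) x, poly (pA d t) x:]"] by simp
    then obtain y where "poly [:poly (pC d t) x, poly (pB d t) x, poly (pA d t) x:] y = 0"
      using fundamental_theorem_of_algebra by blast
    then have "eval2 K x y = 0" by (simp add: walk_kernel_pCons)
    then show ?thesis by force
  qed
  then have "UNIV = {x. poly (pA d t) x = 0} \<union> fst ` {(x, y). eval2 K x y = 0}" by auto
  then have "finite (UNIV :: complex set)" using f poly_roots_finite[OF pA_nz] by (metis finite_UnI)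
  then show False using infinite_UNIV_char_0 by blast
qed

text \<open>The bridge between classes of fractions and terms. It is a relation because different
  terms may have the same values on all arcs.\<close>

definition repr :: "rat_fun \<Rightarrow> rexp \<Rightarrow> bool" where
  "repr f e \<longleftrightarrow> (\<exists>p q. f = ratio K p q \<and> \<not> K dvd q \<and> (\<forall>\<gamma>\<in>Arcs d t. rf \<gamma> e = arc_poly p \<gamma> / arc_poly q \<gamma>))"

lemma repr_in: "repr f e \<Longrightarrow> f \<in> carrier F"
  by (auto simp: repr_def ratio_in)

lemma repr_eq_iff:
  assumes "repr f e" "repr f' e'"
  shows "f = f' \<longleftrightarrow> (\<forall>\<gamma>\<in>Arcs d t. rf \<gamma> e = rf \<gamma> e')"
proof -
  obtain \<gamma> where g: "\<gamma> \<in> Arcs d t" using ex_arc by blast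
  show ?thesis using assms g ratio_eq_iff' unfolding repr_def by metis
qed

lemma poly2_rexp: "\<exists>e. (\<forall>\<gamma>. rf \<gamma> e = arc_poly p \<gamma>) \<and> (\<forall>x y. rc x y e = eval2 p x y)"
proof (induction p)
  case 0
  show ?case by (rule exI[of _ "Cst 0"]) simp
next
  case (pCons a p)
  then obtain e where "\<And>\<gamma>. rf \<gamma> e = arc_poly p \<gamma>" "\<And>x y. rc x y e = eval2 p x y" by blast
  moreover obtain c where "\<And>\<gamma>. rf \<gamma> c = fls_poly a (fst \<gamma>)" "\<And>x y. rc x y c = poly a x"
    using poly_rexp[of a VX] by auto
  ultimately show ?case by (intro exI[of _ "Add c (Mul VY e)"]) simp
qed

lemma ex_repr_rexp:
  assumes "f \<in> carrier F" shows "\<exists>e. repr f e"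
proof -
  obtain p q where f: "f = ratio K p q" "\<not> K dvd q" by (rule carrier_cases[OF assms])
  obtain a where a: "\<And>\<gamma>. rf \<gamma> a = arc_poly p \<gamma>" using poly2_rexp by blast
  obtain b where b: "\<And>\<gamma>. rf \<gamma> b = arc_poly q \<gamma>" using poly2_rexp by blast
  show ?thesis unfolding repr_def f(1)
    by (intro exI[of _ "Mul a (Inv b)"] exI[of _ p] exI[of _ q]) (simp add: a b f(2) divide_inverse)
qed

text \<open>One fraction has to serve both evaluations: the argument about poles uses arcs, whereas
  \<open>has_value\<close> and \<open>pullback\<close> speak of points.\<close>

lemma rexp_fraction:
  "\<exists>p q. \<not> K dvd q \<and> (\<forall>\<gamma>\<in>Arcs d t. rf \<gamma> e = arc_poly p \<gamma> / arc_poly q \<gamma>) \<and>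
     almost_all (\<lambda>x y. eval2 q x y \<noteq> 0 \<and> rc x y e = eval2 p x y / eval2 q x y)"
proof (induction e)
  case (Cst c)
  show ?case by (rule exI[of _ "[:[:c:]:]"], rule exI[of _ 1]) (simp add: K_not_dvd_1 almost_all_def)
next
  case VX
  show ?case by (rule exI[of _ "[:[:0, 1:]:]"], rule exI[of _ 1]) (simp add: K_not_dvd_1 almost_all_def)
next
  case VY
  show ?case by (rule exI[of _ "[:0, 1:]"], rule exI[of _ 1]) (simp add: K_not_dvd_1 almost_all_def)
next
  case (Add a b)
  then obtain p q p' q' where a: "\<not> K dvd q" "\<forall>\<gamma>\<in>Arcs d t. rf \<gamma> a = arc_poly p \<gamma> / arc_poly q \<gamma>"
     "almost_all (\<lambda>x y. eval2 q x y \<noteq> 0 \<and> rc x y a = eval2 p x y / eval2 q x y)"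
    and b: "\<not> K dvd q'" "\<forall>\<gamma>\<in>Arcs d t. rf \<gamma> b = arc_poly p' \<gamma> / arc_poly q' \<gamma>"
     "almost_all (\<lambda>x y. eval2 q' x y \<noteq> 0 \<and> rc x y b = eval2 p' x y / eval2 q' x y)" by blast
  show ?case
    by (intro exI[of _ "p * q' + p' * q"] exI[of _ "q * q'"] conjI ballI not_K_dvd_mult a(1) b(1)
        almost_all_mono[OF almost_all_conj[OF a(3) b(3)]])
      (use a b arc_poly_zero_iff in \<open>auto simp: add_frac_eq\<close>)
next
  case (Mul a b)
  then obtain p q p' q' where a: "\<not> K dvd q" "\<forall>\<gamma>\<in>Arcs d t. rf \<gamma> a = arc_poly p \<gamma> / arc_poly q \<gamma>"
     "almost_all (\<lambda>x y. eval2 q x y \<noteq> 0 \<and> rc x y a = eval2 p x y / eval2 q x y)"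
    and b: "\<not> K dvd q'" "\<forall>\<gamma>\<in>Arcs d t. rf \<gamma> b = arc_poly p' \<gamma> / arc_poly q' \<gamma>"
     "almost_all (\<lambda>x y. eval2 q' x y \<noteq> 0 \<and> rc x y b = eval2 p' x y / eval2 q' x y)" by blast
  show ?case
    by (intro exI[of _ "p * p'"] exI[of _ "q * q'"] conjI ballI not_K_dvd_mult a(1) b(1)
        almost_all_mono[OF almost_all_conj[OF a(3) b(3)]])
      (use a b arc_poly_zero_iff in auto)
next
  case (Inv a)
  then obtain p q where a: "\<not> K dvd q" "\<forall>\<gamma>\<in>Arcs d t. rf \<gamma> a = arc_poly p \<gamma> / arc_poly q \<gamma>"
     "almost_all (\<lambda>x y. eval2 q x y \<noteq> 0 \<and> rc x y a = eval2 p x y / eval2 q x y)" by blast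
  show ?case
  proof (cases "K dvd p")
    \<comment> \<open>The term vanishes on the curve, so the convention \<open>inverse 0 = 0\<close>
      calls for the fraction 0/1 instead of the reciprocal.\<close>
    case True
    then have "arc_poly p \<gamma> = 0" if "\<gamma> \<in> Arcs d t" for \<gamma> using arc_poly_zero_iff that by blast
    moreover have "eval2 p x y = 0" if "eval2 K x y = 0" for x y using True that by auto
    ultimately show ?thesis
      by (intro exI[of _ 0] exI[of _ 1] conjI ballI K_not_dvd_1 almost_all_mono[OF a(3)]) (use a in auto)
  next
    case False
    show ?thesis
      by (intro exI[of _ q] exI[of _ p] conjI ballI False almost_all_mono[OF almost_all_conj[OF a(3) almost_all_eval2_nz[OF False]]])
         (use a in auto)
  qed
qed

lemma ex_repr_fun: "\<exists>f. repr f e"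
  using rexp_fraction[of e] unfolding repr_def by blast

lemma
  assumes "repr f e" "repr f' e'"
  shows repr_mult: "repr (f \<otimes>\<^bsub>F\<^esub> f') (Mul e e')"
    and repr_add: "repr (f \<oplus>\<^bsub>F\<^esub> f') (Add e e')"
    and repr_minus: "repr (f \<ominus>\<^bsub>F\<^esub> f') (Add e (Mul (Cst (-1)) e'))"
proof -
  obtain p q p' q' where *: "f = ratio K p q" "f' = ratio K p' q'" "\<not> K dvd q" "\<not> K dvd q'"
    "\<forall>\<gamma>\<in>Arcs d t. rf \<gamma> e = arc_poly p \<gamma> / arc_poly q \<gamma>" "\<forall>\<gamma>\<in>Arcs d t. rf \<gamma> e' = arc_poly p' \<gamma> / arc_poly q' \<gamma>"
    using assms unfolding repr_def by blast
  note [simp] = *(3,4) not_K_dvd_mult arc_poly_zero_iff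
  show "repr (f \<otimes>\<^bsub>F\<^esub> f') (Mul e e')" unfolding repr_def using *(5,6)
    by (intro exI[of _ "p * p'"] exI[of _ "q * q'"]) (simp add: *(1,2) mult_ratio)
  show "repr (f \<oplus>\<^bsub>F\<^esub> f') (Add e e')" unfolding repr_def using *(5,6)
    by (intro exI[of _ "p * q' + p' * q"] exI[of _ "q * q'"]) (simp add: *(1,2) add_ratio add_frac_eq)
  show "repr (f \<ominus>\<^bsub>F\<^esub> f') (Add e (Mul (Cst (-1)) e'))" unfolding repr_def using *(5,6)
    by (intro exI[of _ "p * q' - p' * q"] exI[of _ "q * q'"]) (simp add: *(1,2) minus_ratio diff_frac_eq)
qed

lemma dvd_eval2: "K dvd q \<Longrightarrow> eval2 K x y = 0 \<Longrightarrow> eval2 q x y = 0"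
  by (elim dvdE) simp

lemma has_value_ratio:
  assumes "\<not> K dvd q" "(affine x y) \<in> E"
    "has_value (ratio K p q) (affine x y) c"
  shows "eval2 p x y = c * eval2 q x y"
proof -
  obtain p' q' where pq: "(p', q') \<in> ratio K p q" "eval2 q' x y \<noteq> 0" "c = eval2 p' x y / eval2 q' x y"
    using assms(3) unfolding has_value_def by auto
  then have "K dvd p' * q - p * q'" using assms(1) by (auto simp: mem_ratio ratio_eq_iff)
  moreover have "eval2 K x y = 0" using assms(2) by (simp add: on_curve_affine)
  ultimately have "eval2 (p' * q - p * q') x y = 0" using dvd_eval2 by blast
  then have "eval2 p' x y * eval2 q x y = eval2 p x y * eval2 q' x y" by simp
  moreover have "eval2 p' x y = c * eval2 q' x y" using pq(2,3) by simp
  ultimately have "eval2 q' x y * eval2 p x y = eval2 q' x y * (c * eval2 q x y)"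
    by (metis mult.assoc mult.commute)
  then show ?thesis using mult_left_cancel[OF pq(2)] by blast
qed

lemma has_value_unique:
  assumes "f \<in> carrier F" "P \<in> E" "has_value f P c" "has_value f P c'"
  shows "c = c'"
proof -
  obtain p' q' x y where pq: "P = (affine x y)" "(p', q') \<in> f" "eval2 q' x y \<noteq> 0"
    using assms(3) unfolding has_value_def by auto
  obtain p q where f: "f = ratio K p q" "\<not> K dvd q" by (rule carrier_cases[OF assms(1)])
  then have f': "f = ratio K p' q'" "\<not> K dvd q'" using pq(2) by (auto simp: mem_ratio)
  from has_value_ratio[OF f'(2)] assms(2-4) pq(1,3) f'(1) show ?thesis by (metis mult_cancel_right)
qed

lemma finite_at_infinity: "finite {P \<in> E. fst P = cp1_infinity \<or> snd P = cp1_infinity}"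
proof -
  interpret sw: biquad "flip d" t by (rule biquad_flip)
  have "finite (prod.swap ` {P \<in> sw.E. fst P \<in> {cp1_infinity}})" by (intro finite_imageI sw.finite_fst) simp
  moreover have "{P \<in> E. fst P = cp1_infinity \<or> snd P = cp1_infinity} \<subseteq>
    {P \<in> E. fst P \<in> {cp1_infinity}} \<union> prod.swap ` {P \<in> sw.E. fst P \<in> {cp1_infinity}}"
    using swap_in by (force simp: image_iff)
  ultimately show ?thesis using finite_fst[of "{cp1_infinity}"] by (meson finite.emptyI finite.insertI finite_UnI finite_subset)
qed

lemma finite_exceptions_iff:
  "finite {P \<in> E. \<not> Q P} \<longleftrightarrow> almost_all (\<lambda>x y. Q (affine x y))"
proof
  let ?h = "\<lambda>(x, y). (affine x y)"
  let ?B = "{(x, y). eval2 K x y = 0 \<and> \<not> Q (affine x y)}"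
  have sub: "?h ` ?B \<subseteq> {P \<in> E. \<not> Q P}" by (auto simp: on_curve_affine)
  have inj: "inj_on ?h ?B" by (auto simp: inj_on_def)
  show "finite {P \<in> E. \<not> Q P} \<Longrightarrow> almost_all (\<lambda>x y. Q (affine x y))"
    unfolding almost_all_def using finite_subset[OF sub] finite_imageD[OF _ inj] by blast
  assume "almost_all (\<lambda>x y. Q (affine x y))"
  then have f: "finite (?h ` ?B)" unfolding almost_all_def by simp
  have "{P \<in> E. \<not> Q P} \<subseteq> ?h ` ?B \<union> {P \<in> E. fst P = cp1_infinity \<or> snd P = cp1_infinity}"
  proof
    fix P assume P: "P \<in> {P \<in> E. \<not> Q P}"
    show "P \<in> ?h ` ?B \<union> {P \<in> E. fst P = cp1_infinity \<or> snd P = cp1_infinity}"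
    proof (cases "fst P = cp1_infinity \<or> snd P = cp1_infinity")
      case False
      then obtain x y where "P = (affine x y)" by (metis cp1_exhaust prod.collapse)
      then show ?thesis using P on_curve_affine by (auto simp: image_iff)
    qed (use P in auto)
  qed
  then show "finite {P \<in> E. \<not> Q P}" using f finite_at_infinity by (meson finite_UnI finite_subset)
qed

lemma almost_all_rexp_nz:
  assumes "\<And>\<gamma>. \<gamma> \<in> Arcs d t \<Longrightarrow> rf \<gamma> e \<noteq> 0"
  shows "almost_all (\<lambda>x y. rc x y e \<noteq> 0)"
proof -
  obtain p q where pq: "\<not> K dvd q" "\<forall>\<gamma>\<in>Arcs d t. rf \<gamma> e = arc_poly p \<gamma> / arc_poly q \<gamma>"
     "almost_all (\<lambda>x y. eval2 q x y \<noteq> 0 \<and> rc x y e = eval2 p x y / eval2 q x y)" using rexp_fraction by blast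
  obtain \<gamma> where g: "\<gamma> \<in> Arcs d t" using ex_arc by blast
  have "\<not> K dvd p" using assms[OF g] pq(2) g arc_poly_zero_iff[OF g, of p] by auto
  from almost_all_mono[OF almost_all_conj[OF pq(3) almost_all_eval2_nz[OF this]]] show ?thesis by simp
qed

text \<open>The definite description in \<open>pullback\<close> needs existence and uniqueness.
  Substitution into \<open>f\<close> yields a candidate with the right values off a finite set. Two
  candidates agree at almost all points, so their cross difference vanishes there and is divisible
  by \<open>K\<close>.\<close>

lemma repr_pullback:
  assumes f: "repr f e"
    and arcs: "\<And>\<gamma>. \<gamma> \<in> Arcs d t \<Longrightarrow> (rf \<gamma> u, rf \<gamma> v) \<in> Arcs d t"
    and pts: "almost_all (\<lambda>x y. \<sigma> (affine x y) = affine (rc x y u) (rc x y v))"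
    and closed: "\<And>P. P \<in> E \<Longrightarrow> \<sigma> P \<in> E"
  shows "repr (pullback d t \<sigma> f) (rexp_subst u v e)"
proof -
  obtain p q where pq: "f = ratio K p q" "\<not> K dvd q" "\<And>\<gamma>. \<gamma> \<in> Arcs d t \<Longrightarrow> rf \<gamma> e = arc_poly p \<gamma> / arc_poly q \<gamma>"
    using f unfolding repr_def by blast
  obtain a where a: "\<And>\<gamma>. rf \<gamma> a = arc_poly p \<gamma>" "\<And>x y. rc x y a = eval2 p x y" using poly2_rexp by blast
  obtain b where b: "\<And>\<gamma>. rf \<gamma> b = arc_poly q \<gamma>" "\<And>x y. rc x y b = eval2 q x y" using poly2_rexp by blast
  define e' where "e' = rexp_subst u v (Mul a (Inv b))"
  obtain P Q where PQ: "\<not> K dvd Q" "\<forall>\<gamma>\<in>Arcs d t. rf \<gamma> e' = arc_poly P \<gamma> / arc_poly Q \<gamma>"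
     "almost_all (\<lambda>x y. eval2 Q x y \<noteq> 0 \<and> rc x y e' = eval2 P x y / eval2 Q x y)" using rexp_fraction by blast
  have nz: "almost_all (\<lambda>x y. rc x y (rexp_subst u v b) \<noteq> 0)"
    by (rule almost_all_rexp_nz) (use b(1)[of "(_, _)"] arcs arc_poly_zero_iff pq(2) in \<open>auto simp: rexp_eval_rexp_subst\<close>)
  let ?good = "\<lambda>h P. \<exists>c. has_value f (\<sigma> P) c \<and> has_value h P c"
  have "almost_all (\<lambda>x y. ?good (ratio K P Q) (affine x y))"
  proof (rule almost_all_mono[OF almost_all_conj[OF pts almost_all_conj[OF nz PQ(3)]]], elim conjE)
    fix x y
    assume s: "\<sigma> (affine x y) = affine (rc x y u) (rc x y v)"
      and n: "rc x y (rexp_subst u v b) \<noteq> 0"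
      and q: "eval2 Q x y \<noteq> 0" "rc x y e' = eval2 P x y / eval2 Q x y"
    have "has_value f (\<sigma> (affine x y)) (rc x y e')"
      unfolding has_value_def s using n ratio_self[OF pq(2)]
      by (intro exI[of _ "rc x y u"] exI[of _ "rc x y v"] exI[of _ p] exI[of _ q])
         (auto simp: e'_def rexp_eval_rexp_subst a b pq(1) divide_inverse)
    moreover have "has_value (ratio K P Q) (affine x y) (rc x y e')"
      unfolding has_value_def using q ratio_self[OF PQ(1)] by blast
    ultimately show "?good (ratio K P Q) (affine x y)" by blast
  qed
  then have good: "finite {R \<in> E. \<not> ?good (ratio K P Q) R}"
    using finite_exceptions_iff[of "?good (ratio K P Q)"] by blast
  have "pullback d t \<sigma> f = ratio K P Q"
    unfolding pullback_def
  proof (rule the_equality)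
    show "ratio K P Q \<in> carrier F \<and> finite {R \<in> E. \<not> ?good (ratio K P Q) R}"
      using good ratio_in[OF PQ(1)] by blast
  next
    fix h assume h: "h \<in> carrier F \<and> finite {R \<in> E. \<not> ?good h R}"
    then obtain P' Q' where h': "h = ratio K P' Q'" "\<not> K dvd Q'" by (metis carrier_cases)
    have fin: "f \<in> carrier F" using repr_in[OF f] .
    have "almost_all (\<lambda>x y. ?good h (affine x y) \<and> ?good (ratio K P Q) (affine x y))"
      using good h finite_exceptions_iff[of "?good (ratio K P Q)"] finite_exceptions_iff[of "?good h"]
      by (intro almost_all_conj) blast+
    then have "almost_all (\<lambda>x y. eval2 (P * Q' - P' * Q) x y = 0)"
    proof (rule almost_all_mono, elim conjE exE)
      fix x y c c'
      assume xy: "eval2 K x y = 0" and v: "has_value f (\<sigma> (affine x y)) c" "has_value h (affine x y) c"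
        "has_value f (\<sigma> (affine x y)) c'" "has_value (ratio K P Q) (affine x y) c'"
      have xy': "(affine x y) \<in> E" using xy on_curve_affine by blast
      have "c' = c" using has_value_unique[OF fin closed[OF xy'] v(3) v(1)] .
      then have "eval2 P x y = c * eval2 Q x y" "eval2 P' x y = c * eval2 Q' x y"
        using has_value_ratio[OF PQ(1) xy' v(4)] has_value_ratio[OF h'(2) xy'] v(2) h'(1) by auto
      then show "eval2 (P * Q' - P' * Q) x y = 0" by simp
    qed
    \<comment> \<open>Otherwise almost all points would be both zeros and nonzeros of the cross
      difference, against the infinitude of the curve.\<close>
    then have "K dvd P * Q' - P' * Q"
      using almost_all_nontrivial almost_all_mono[OF almost_all_conj[OF almost_all_eval2_nz[of "P * Q' - P' * Q"]], of _ "\<lambda>x y. False"] by blast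
    then show "h = ratio K P Q" using ratio_eq_iff[OF PQ(1) h'(2)] h'(1) by blast
  qed
  moreover have "rf \<gamma> (rexp_subst u v e) = rf \<gamma> e'" if "\<gamma> \<in> Arcs d t" for \<gamma>
    using pq(3)[OF arcs[OF that]] by (simp add: e'_def rexp_eval_rexp_subst a(1)[of "(_, _)", simplified] b(1)[of "(_, _)", simplified] divide_inverse)
  ultimately show ?thesis unfolding repr_def using PQ(1,2) by auto
qed

end

section \<open>Rational function fields have genus zero\<close>

lemma order_prod_linear:
  fixes c :: "'i \<Rightarrow> complex"
  assumes "finite S"
  shows "(\<Prod>u\<in>S. [:- c u, 1:] ^ n u) \<noteq> 0 \<and>
    Polynomial.order a (\<Prod>u\<in>S. [:- c u, 1:] ^ n u) = (\<Sum>u\<in>{u\<in>S. c u = a}. n u) \<and>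
    degree (\<Prod>u\<in>S. [:- c u, 1:] ^ n u) = (\<Sum>u\<in>S. n u)"
  using assms
proof (induction S rule: finite_induct)
  case (insert x S)
  let ?P = "\<Prod>u\<in>S. [:- c u, 1:] ^ n u"
  have nz: "[:- c x, 1:] ^ n x * ?P \<noteq> 0" using insert.IH by simp
  have e: "Polynomial.order a ([:- c x, 1:] ^ n x) = (if c x = a then n x else 0)"
    by (auto simp: order_power_n_n intro: order_0I)
  have s: "{u \<in> insert x S. c u = a} = (if c x = a then insert x {u \<in> S. c u = a} else {u \<in> S. c u = a})" by auto
  have sumeq: "(\<Sum>u\<in>{u \<in> insert x S. c u = a}. n u) =
      (if c x = a then n x else 0) + (\<Sum>u\<in>{u \<in> S. c u = a}. n u)"
    unfolding s using insert(1,2) by simp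
  have i: "(\<Prod>u\<in>insert x S. [:- c u, 1:] ^ n u) = [:- c x, 1:] ^ n x * ?P" using insert(1,2) by simp
  have "degree ([:- c x, 1:] ^ n x * ?P) = n x + degree ?P"
    using nz by (simp add: degree_mult_eq degree_linear_power)
  then show ?case
    unfolding i sumeq using insert(1,2) insert.IH nz order_mult[OF nz, of a] e by (simp only: sum.insert) simp
qed simp

text \<open>An abstract field with an isomorphism \<phi> onto C(Z) inside the Laurent series,
  carrying \<open>k\<close> to the constants. As Z is transcendental, computations take place with
  polynomials.\<close>

locale rational_field = field R for R :: "'a ring" (structure) +
  fixes k :: "'a set" and \<phi> :: "'a \<Rightarrow> complex fls" and Z :: "complex fls"
  assumes subf: "subfield k R"
    and inj: "inj_on \<phi> (carrier R)"
    and \<phi>_add: "x \<in> carrier R \<Longrightarrow> y \<in> carrier R \<Longrightarrow> \<phi> (x \<oplus> y) = \<phi> x + \<phi> y"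
    and \<phi>_mult: "x \<in> carrier R \<Longrightarrow> y \<in> carrier R \<Longrightarrow> \<phi> (x \<otimes> y) = \<phi> x * \<phi> y"
    and img: "\<phi> ` carrier R = {fls_poly p Z / fls_poly q Z | p q. q \<noteq> 0}"
    and \<phi>_k: "\<phi> ` k = range fls_const"
    and Znc: "nonconst Z"
begin

lemma k_sub: "k \<subseteq> carrier R"
  using subfieldE(3)[OF subf] .

definition el :: "complex poly \<Rightarrow> complex poly \<Rightarrow> 'a" where
  "el p q = inv_into (carrier R) \<phi> (fls_poly p Z / fls_poly q Z)"

lemma el_in: "q \<noteq> 0 \<Longrightarrow> el p q \<in> carrier R"
  and \<phi>_el: "q \<noteq> 0 \<Longrightarrow> \<phi> (el p q) = fls_poly p Z / fls_poly q Z"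
proof -
  assume "q \<noteq> 0"
  then have *: "fls_poly p Z / fls_poly q Z \<in> \<phi> ` carrier R" using img by blast
  show "el p q \<in> carrier R" unfolding el_def by (rule inv_into_into[OF *])
  show "\<phi> (el p q) = fls_poly p Z / fls_poly q Z" unfolding el_def by (rule f_inv_into_f[OF *])
qed

lemma el_eqI: "q \<noteq> 0 \<Longrightarrow> x \<in> carrier R \<Longrightarrow> \<phi> x = fls_poly p Z / fls_poly q Z \<Longrightarrow> x = el p q"
  using inj_onD[OF inj] el_in \<phi>_el by metis

lemma el_cases: assumes "x \<in> carrier R" obtains p q where "q \<noteq> 0" "x = el p q"
  using assms img el_eqI by (smt (verit) image_eqI mem_Collect_eq)

lemma \<phi>_0: "\<phi> \<zero> = 0"
  using \<phi>_add[of \<zero> \<zero>] by simp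

lemma el_zero_iff: "q \<noteq> 0 \<Longrightarrow> el p q = \<zero> \<longleftrightarrow> p = 0"
proof -
  assume q: "q \<noteq> 0"
  have "el p q = \<zero> \<longleftrightarrow> \<phi> (el p q) = \<phi> \<zero>" using inj_onD[OF inj _ el_in[OF q]] by auto
  also have "\<dots> \<longleftrightarrow> fls_poly p Z = 0" using fls_poly_nonzero[OF Znc q] by (simp add: \<phi>_el[OF q] \<phi>_0)
  also have "\<dots> \<longleftrightarrow> p = 0" using fls_poly_nonzero[OF Znc] by auto
  finally show ?thesis .
qed

abbreviation "pl p \<equiv> el p 1"

lemma pl_mult: "pl (p * q) = pl p \<otimes> pl q"
  by (rule el_eqI[symmetric]) (simp_all add: el_in \<phi>_el \<phi>_mult)

lemma pl_add: "pl (p + q) = pl p \<oplus> pl q"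
  by (rule el_eqI[symmetric]) (simp_all add: el_in \<phi>_el \<phi>_add)

lemma el_mult_pl: "q \<noteq> 0 \<Longrightarrow> el p q \<otimes> pl q = pl p"
  by (rule el_eqI) (simp_all add: el_in \<phi>_el \<phi>_mult fls_poly_nonzero[OF Znc])

lemma pl_const: "pl [:c:] \<in> k"
proof -
  have "fls_const c \<in> \<phi> ` k" using \<phi>_k by blast
  then obtain x where "x \<in> k" "\<phi> x = fls_const c" by auto
  then show ?thesis using el_eqI[of 1 x "[:c:]"] k_sub by auto
qed

section \<open>The discrete valuations of a rational function field\<close>

context
  fixes v assumes v: "v \<in> places R k"
begin

lemma v_mult: "f \<in> carrier R - {\<zero>} \<Longrightarrow> g \<in> carrier R - {\<zero>} \<Longrightarrow> v (f \<otimes> g) = v f + v g"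
  and v_add: "f \<in> carrier R - {\<zero>} \<Longrightarrow> g \<in> carrier R - {\<zero>} \<Longrightarrow> f \<oplus> g \<noteq> \<zero> \<Longrightarrow> min (v f) (v g) \<le> v (f \<oplus> g)"
  and v_const: "c \<in> k - {\<zero>} \<Longrightarrow> v c = 0"
  and v_surj: "v ` (carrier R - {\<zero>}) = UNIV"
  using v unfolding places_def by auto

abbreviation "w p \<equiv> v (pl p)"

lemma pl_nz: "p \<noteq> 0 \<Longrightarrow> pl p \<in> carrier R - {\<zero>}"
  using el_in[of 1 p] el_zero_iff[of 1 p] by simp

lemma w_mult: "p \<noteq> 0 \<Longrightarrow> q \<noteq> 0 \<Longrightarrow> w (p * q) = w p + w q"
  using v_mult[OF pl_nz pl_nz] by (simp add: pl_mult)

lemma w_add: "p \<noteq> 0 \<Longrightarrow> q \<noteq> 0 \<Longrightarrow> p + q \<noteq> 0 \<Longrightarrow> min (w p) (w q) \<le> w (p + q)"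
  using v_add[OF pl_nz pl_nz] el_zero_iff[of 1 "p + q"] by (simp add: pl_add)

lemma w_const: "c \<noteq> 0 \<Longrightarrow> w [:c:] = 0"
  using v_const[of "pl [:c:]"] pl_const pl_nz[of "[:c:]"] by simp

lemma w_add_strict:
  assumes "p \<noteq> 0" "q \<noteq> 0" "w p < w q"
  shows "p + q \<noteq> 0 \<and> w (p + q) = w p"
proof -
  have m: "w (- q) = w q"
  proof -
    have "- q = [:-1:] * q" by simp
    then show ?thesis using w_mult[of "[:-1:]" q] w_const[of "-1"] assms by simp
  qed
  have n: "p + q \<noteq> 0"
  proof
    assume "p + q = 0"
    then have "q = - p" by (simp add: eq_neg_iff_add_eq_0 add.commute)
    then show False using m assms(3) by simp
  qed
  have "min (w (p + q)) (w (- q)) \<le> w ((p + q) + - q)" by (rule w_add) (use assms n in auto)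
  then have "min (w (p + q)) (w q) \<le> w p" by (simp add: m)
  moreover have "min (w p) (w q) \<le> w (p + q)" by (rule w_add) (use assms n in auto)
  ultimately show ?thesis using n assms(3) by auto
qed

lemma v_el: "p \<noteq> 0 \<Longrightarrow> q \<noteq> 0 \<Longrightarrow> v (el p q) = w p - w q"
  using v_mult[of "el p q" "pl q"] el_in[of q p] el_zero_iff[of q p] pl_nz[of q] by (simp add: el_mult_pl)

text \<open>A valuation takes the value 1 at some quotient of polynomials, so a common divisor of
  the values at polynomials divides 1. This normalises the value at a uniformiser below.\<close>

lemma w_dvd_imp_unit:
  assumes "\<And>p. p \<noteq> 0 \<Longrightarrow> m dvd w p"
  shows "m dvd 1"
proof -
  obtain f where f: "f \<in> carrier R - {\<zero>}" "v f = 1" using v_surj by (metis UNIV_I imageE)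
  then have "f \<in> carrier R" by blast
  then obtain p q where pq: "q \<noteq> 0" "f = el p q" by (rule el_cases)
  then have "p \<noteq> 0" using f el_zero_iff by auto
  have "w p - w q = 1" using v_el[OF \<open>p \<noteq> 0\<close> pq(1)] pq f by simp
  have "m dvd w p - w q" by (rule dvd_diff[OF assms[OF \<open>p \<noteq> 0\<close>] assms[OF pq(1)]])
  then show ?thesis unfolding \<open>w p - w q = 1\<close> .
qed

text \<open>When Z has negative value the leading term dominates, so every value is the degree times
  the value of Z, and normalisation makes the latter -1.\<close>

lemma place_infinite:
  assumes "w [:0, 1:] < 0" "p \<noteq> 0"
  shows "w p = - int (degree p)"
proof -
  have gen: "w p = int (degree p) * w [:0, 1:]" if "p \<noteq> 0" for p
    using that
  proof (induction p)
    case (pCons c p)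
    show ?case
    proof (cases "p = 0")
      case False
      have s: "w ([:0, 1:] * p) = w [:0, 1:] + int (degree p) * w [:0, 1:]"
        using w_mult[of "[:0, 1:]" p] False pCons by simp
      have n: "int (degree p) * w [:0, 1:] \<le> 0" using assms(1) by (simp add: mult_nonneg_nonpos)
      have "w ([:0, 1:] * p + [:c:]) = w ([:0, 1:] * p)"
      proof (cases "c = 0")
        case False
        then show ?thesis using w_add_strict[of "[:0, 1:] * p" "[:c:]"] w_const[of c] s n assms(1) \<open>p \<noteq> 0\<close> by simp
      qed simp
      then show ?thesis using s False by (simp add: algebra_simps)
    qed (use pCons w_const in simp)
  qed simp
  have "w [:0, 1:] dvd 1" by (intro w_dvd_imp_unit) (metis gen dvd_triv_right)
  then have "w [:0, 1:] = - 1" using assms(1) by auto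
  then show ?thesis using gen[OF assms(2)] by simp
qed

text \<open>All polynomials have nonnegative value, and some linear one has positive value:
  otherwise splitting into linear factors would give value 0 everywhere. Its root c determines the
  place.\<close>

lemma place_finite:
  assumes "0 \<le> w [:0, 1:]"
  obtains c where "\<And>p. p \<noteq> 0 \<Longrightarrow> w p = int (Polynomial.order c p)"
proof -
  have pos: "0 \<le> w p" if "p \<noteq> 0" for p
    using that
  proof (induction p)
    case (pCons c p)
    show ?case
    proof (cases "p = 0 \<or> c = 0")
      case True
      then show ?thesis
      proof
        assume "c = 0"
        then have "p \<noteq> 0" using pCons by simp
        then show ?thesis using w_mult[of "[:0, 1:]" p] pCons.IH assms \<open>c = 0\<close> by simp
      qed (use pCons w_const in simp)
    next
      case False
      have "min (w [:c:]) (w ([:0, 1:] * p)) \<le> w ([:c:] + [:0, 1:] * p)"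
        by (rule w_add) (use False in auto)
      then show ?thesis using w_mult[of "[:0, 1:]" p] pCons.IH assms False w_const[of c] by simp
    qed
  qed simp
  have "\<exists>c. w [:- c, 1:] > 0"
  proof (rule ccontr)
    assume "\<not> ?thesis"
    then have z: "w [:- c, 1:] = 0" for c using pos[of "[:- c, 1:]"] by (simp add: order.antisym not_less)
    have "w p = 0" if "p \<noteq> 0" for p
      using that
    proof (induction "degree p" arbitrary: p)
      case 0
      then obtain c where "p = [:c:]" by (metis degree_eq_zeroE)
      then show ?case using w_const 0 by simp
    next
      case (Suc n)
      then have "\<not> constant (poly p)" using constant_degree by (metis nat.distinct(1))
      then obtain x where "poly p x = 0" using fundamental_theorem_of_algebra by blast
      then obtain q where q: "p = [:- x, 1:] * q" by (metis poly_eq_0_iff_dvd dvdE)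
      with Suc have "q \<noteq> 0" by auto
      then have "degree p = Suc (degree q)" unfolding q by (subst degree_mult_eq) auto
      then have "n = degree q" using Suc(2) by simp
      then have "w q = 0" using Suc(1) \<open>q \<noteq> 0\<close> by blast
      then show ?case unfolding q using w_mult[of "[:- x, 1:]" q] z \<open>q \<noteq> 0\<close> by simp
    qed
    then have "(0 :: int) dvd 1" by (intro w_dvd_imp_unit) simp
    then show False by simp
  qed
  then obtain c where c: "w [:- c, 1:] > 0" by blast
  \<comment> \<open>A polynomial q is the nonzero constant q(c), of value 0, plus a multiple of Z -
    c, which is zero or of positive value.\<close>
  have unit: "w q = 0" if q: "poly q c \<noteq> 0" for q
  proof -
    obtain r where "q - [:poly q c:] = [:- c, 1:] * r"
      using poly_eq_0_iff_dvd[of "q - [:poly q c:]" c] by (auto elim: dvdE)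
    then have r: "q = [:poly q c:] + [:- c, 1:] * r" by (simp add: algebra_simps)
    show ?thesis
    proof (cases "r = 0")
      case False
      have "w [:poly q c:] < w ([:- c, 1:] * r)"
        using w_const[OF q] w_mult[of "[:- c, 1:]" r] False pos[OF False] c by simp
      then have "w ([:poly q c:] + [:- c, 1:] * r) = w [:poly q c:]"
        using w_add_strict[of "[:poly q c:]" "[:- c, 1:] * r"] q False
        by (metis mult_eq_0_iff one_neq_zero pCons_eq_0_iff)
      then show ?thesis using r w_const[OF q] by simp
    next
      case True
      then show ?thesis using r w_const[OF q] by simp
    qed
  qed
  have gen: "w p = int (Polynomial.order c p) * w [:- c, 1:]" if p: "p \<noteq> 0" for p
  proof -
    obtain q where q: "p = [:- c, 1:] ^ Polynomial.order c p * q" "\<not> [:- c, 1:] dvd q"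
      using order_decomp[OF p] by blast
    have "w ([:- c, 1:] ^ n * q) = int n * w [:- c, 1:]" for n
    proof (induction n)
      case 0
      show ?case using unit[of q] q(2) by (simp add: poly_eq_0_iff_dvd)
    next
      case (Suc n)
      have "q \<noteq> 0" using q(2) by auto
      then have "w ([:- c, 1:] * ([:- c, 1:] ^ n * q)) = w [:- c, 1:] + w ([:- c, 1:] ^ n * q)"
        by (intro w_mult) auto
      then show ?case using Suc by (simp add: algebra_simps)
    qed
    from this[of "Polynomial.order c p"] q(1) show ?thesis by simp
  qed
  have "w [:- c, 1:] dvd 1" by (intro w_dvd_imp_unit) (metis gen dvd_triv_right)
  then have 1: "w [:- c, 1:] = 1" using c by auto
  have "w p = int (Polynomial.order c p)" if "p \<noteq> 0" for p
    using gen[OF that] unfolding 1 by simp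
  then show ?thesis by (rule that)
qed

end

lemma place_eqI:
  assumes "v \<in> places R k" "v' \<in> places R k" "\<And>p. p \<noteq> 0 \<Longrightarrow> v (pl p) = v' (pl p)"
  shows "v = v'"
proof (rule extensionalityI)
  show "v \<in> extensional (carrier R - {\<zero>})" "v' \<in> extensional (carrier R - {\<zero>})"
    using assms by (auto simp: places_def)
  fix f assume f: "f \<in> carrier R - {\<zero>}"
  then have "f \<in> carrier R" by blast
  then obtain p q where q: "q \<noteq> 0" and fe: "f = el p q" by (rule el_cases)
  then have p: "p \<noteq> 0" using f el_zero_iff by auto
  show "v f = v' f" unfolding fe
    using v_el[OF assms(1) p q] v_el[OF assms(2) p q] assms(3)[OF p] assms(3)[OF q] by linarith
qed

section \<open>Dimensions of Riemann-Roch spaces in a rational function field\<close>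

definition kval :: "'a \<Rightarrow> complex" where "kval x = fls_res (\<phi> x)"

lemma \<phi>_kval: "x \<in> k \<Longrightarrow> \<phi> x = fls_const (kval x)"
proof -
  assume "x \<in> k"
  then obtain c where "\<phi> x = fls_const c" using \<phi>_k by blast
  then show ?thesis by (simp add: kval_def)
qed

text \<open>A combination of shifted powers is p/q times a polynomial in Z whose coefficients are
  the scalars. \<open>take m\<close> reflects that \<open>combine\<close> stops at the shorter list;
  the offset \<open>j\<close> is there for the induction.\<close>

lemma combine_powers:
  assumes "q \<noteq> 0" "set Ks \<subseteq> k"
  shows "combine Ks (map (\<lambda>i. el (p * [:0, 1:] ^ i) q) [j..<j + m]) \<in> carrier R \<and>
    \<phi> (combine Ks (map (\<lambda>i. el (p * [:0, 1:] ^ i) q) [j..<j + m])) =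
    fls_poly p Z / fls_poly q Z * Z ^ j * fls_poly (Poly (map kval (take m Ks))) Z"
  using assms(2)
proof (induction m arbitrary: j Ks)
  case (Suc m)
  show ?case
  proof (cases Ks)
    case (Cons x Ks')
    have u: "[j..<j + Suc m] = j # [Suc j..<Suc j + m]" by (simp add: upt_rec)
    have x: "x \<in> carrier R" "\<phi> x = fls_const (kval x)" using Suc.prems Cons k_sub \<phi>_kval by auto
    have "set Ks' \<subseteq> k" using Suc.prems Cons by simp
    note IH = Suc.IH[OF this, of "Suc j"]
    note e = el_in[OF assms(1), of "p * [:0, 1:] ^ j"]
    have "fls_poly [:0, 1:] Z = Z" by simp
    then show ?thesis using IH e x unfolding u Cons
      by (simp add: \<phi>_add \<phi>_mult \<phi>_el[OF assms(1)] algebra_simps add_divide_distrib)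
  qed (simp add: \<phi>_0)
qed (simp add: \<phi>_0)

lemma independent_powers:
  assumes "p \<noteq> 0" "q \<noteq> 0"
  shows "independent k (map (\<lambda>i. el (p * [:0, 1:] ^ i) q) [0..<m])"
proof (rule trivial_combine_imp_independent[OF subf])
  show "set (map (\<lambda>i. el (p * [:0, 1:] ^ i) q) [0..<m]) \<subseteq> carrier R" using el_in[OF assms(2)] by auto
  fix Ks assume Ks: "set Ks \<subseteq> k" and z: "combine Ks (map (\<lambda>i. el (p * [:0, 1:] ^ i) q) [0..<m]) = \<zero>"
  have "fls_poly p Z / fls_poly q Z * fls_poly (Poly (map kval (take m Ks))) Z = 0"
    using combine_powers[OF assms(2) Ks, of p 0 m] z \<phi>_0 by simp
  then have "fls_poly (Poly (map kval (take m Ks))) Z = 0" using fls_poly_nonzero[OF Znc] assms by simp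
  then have "Poly (map kval (take m Ks)) = 0" using fls_poly_nonzero[OF Znc] by blast
  then obtain n where n: "map kval (take m Ks) = replicate n 0" by (auto simp: Poly_eq_0)
  have "x = \<zero>" if x: "x \<in> set (take m Ks)" for x
  proof -
    have "kval x \<in> set (map kval (take m Ks))" using x by simp
    then have "kval x = 0" unfolding n by simp
    moreover have "x \<in> k" using x Ks by (meson in_set_takeD subsetD)
    ultimately have "\<phi> x = 0" using \<phi>_kval by simp
    then show ?thesis using inj_onD[OF inj, of x \<zero>] \<phi>_0 \<open>x \<in> k\<close> k_sub by auto
  qed
  then show "set (take (length (map (\<lambda>i. el (p * [:0, 1:] ^ i) q) [0..<m])) Ks) \<subseteq> {\<zero>}" by auto
qed

text \<open>If n \<le> deg D, a fraction whose finite zeros and poles are prescribed by -D can be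
  multiplied by Z^i for all i \<le> n within L(D), the degree of D leaving that much room at
  infinity. These are n + 1 independent elements.\<close>

lemma dimension_ge:
  assumes D: "D \<in> divisors R k" and dim: "dimension n k (riemann_roch_space R k D)"
  shows "div_degree D < int n"
proof (rule ccontr)
  assume "\<not> ?thesis"
  then have deg: "int n \<le> div_degree D" by simp
  define S where "S = {v. D v \<noteq> 0}"
  have S: "finite S" "S \<subseteq> places R k" using D by (auto simp: divisors_def S_def)
  define fin where "fin v c \<longleftrightarrow> (\<forall>p. p \<noteq> 0 \<longrightarrow> v (pl p) = int (Polynomial.order c p))" for v c
  define inf where "inf v \<longleftrightarrow> (\<forall>p. p \<noteq> 0 \<longrightarrow> v (pl p) = - int (degree p))" for v
  have dichotomy: "inf v \<or> (\<exists>c. fin v c)" if "v \<in> places R k" for v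
    using place_infinite[OF that] place_finite[OF that] unfolding fin_def inf_def by (metis not_le)
  have excl: "\<not> (inf v \<and> fin v c)" for v c
  proof
    assume "inf v \<and> fin v c"
    then have "int (Polynomial.order c [:0, 1:]) = - int (degree ([:0, 1:] :: complex poly))"
      unfolding inf_def fin_def by (metis one_neq_zero pCons_eq_0_iff)
    then show False by simp
  qed
  define cc where "cc v = (SOME c. fin v c)" for v
  have cc: "fin v (cc v)" if "fin v c" for v c unfolding cc_def using that by (rule someI)
  define S1 where "S1 = {v \<in> S. \<exists>c. fin v c}"
  define S2 where "S2 = {v \<in> S. inf v}"
  have S12: "S = S1 \<union> S2" "S1 \<inter> S2 = {}" using dichotomy S(2) excl unfolding S1_def S2_def by auto
  have f1: "finite S1" "finite S2" using S(1) S12 by auto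
  have cc1: "fin v (cc v)" if "v \<in> S1" for v using that cc unfolding S1_def by blast
  have uniq: "u = v" if "u \<in> places R k" "v \<in> places R k" "fin u c" "fin v c" for u v c
    using place_eqI[OF that(1,2)] that(3,4) unfolding fin_def by simp
  have uniq': "u = v" if "u \<in> places R k" "v \<in> places R k" "inf u" "inf v" for u v
    using place_eqI[OF that(1,2)] that(3,4) unfolding inf_def by simp
  \<comment> \<open>Negative coefficients of D at finite places become zeros of P, positive ones
    zeros of Q, so that P/Q has order exactly -D there.\<close>
  define P where "P = (\<Prod>u\<in>S1. [:- cc u, 1:] ^ nat (- D u))"
  define Q where "Q = (\<Prod>u\<in>S1. [:- cc u, 1:] ^ nat (D u))"
  note oP = order_prod_linear[OF f1(1), of cc "\<lambda>u. nat (- D u)", folded P_def]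
  note oQ = order_prod_linear[OF f1(1), of cc "\<lambda>u. nat (D u)", folded Q_def]
  have P: "P \<noteq> 0" and Q: "Q \<noteq> 0" using oP oQ by auto
  have ddeg: "div_degree D = (\<Sum>u\<in>S1. D u) + (\<Sum>u\<in>S2. D u)"
    unfolding div_degree_def S_def[symmetric] S12(1) using f1 S12(2) by (simp add: sum.union_disjoint)
  have nn: "int (nat (- x)) - int (nat x) = - x" for x by simp
  have mem: "el (P * [:0, 1:] ^ i) Q \<in> riemann_roch_space R k D" if i: "i \<le> n" for i
  proof -
    have pi: "P * [:0, 1:] ^ i \<noteq> 0" using P by simp
    have "- D v \<le> v (el (P * [:0, 1:] ^ i) Q)" if v: "v \<in> places R k" for v
    proof -
      have ve: "v (el (P * [:0, 1:] ^ i) Q) = v (pl P) + v (pl ([:0, 1:] ^ i)) - v (pl Q)"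
        using v_el[OF v pi Q] w_mult[OF v P, of "[:0, 1:] ^ i"] by simp
      show ?thesis
      proof (cases "inf v")
        case True
        have "v (el (P * [:0, 1:] ^ i) Q) = - int (degree P) - int i + int (degree Q)"
          using True P Q unfolding ve inf_def by (simp add: degree_power_eq)
        also have "\<dots> = (\<Sum>u\<in>S1. D u) - int i"
        proof -
          have "int (degree P) - int (degree Q) = (\<Sum>u\<in>S1. int (nat (- D u)) - int (nat (D u)))"
            using oP oQ by (simp only: sum_subtractf of_nat_sum)
          then have "int (degree P) - int (degree Q) = (\<Sum>u\<in>S1. - D u)" by (simp only: nn)
          then show ?thesis by (simp add: sum_negf)
        qed
        also have "\<dots> \<ge> - (\<Sum>u\<in>S2. D u)" using i deg ddeg by linarith
        also have "(\<Sum>u\<in>S2. D u) = D v"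
        proof (cases "v \<in> S")
          case True
          then have "S2 = {v}" using \<open>inf v\<close> uniq' v S(2) unfolding S2_def by auto
          then show ?thesis by simp
        next
          case False
          then have "S2 = {}" using \<open>inf v\<close> uniq' v S(2) unfolding S2_def by auto
          then show ?thesis using False by (simp add: S_def)
        qed
        finally show ?thesis by simp
      next
        case False
        then obtain c where c: "fin v c" using dichotomy v by blast
        have "v (el (P * [:0, 1:] ^ i) Q) \<ge> int (Polynomial.order c P) - int (Polynomial.order c Q)"
          using c P Q unfolding ve fin_def by simp
        moreover have "int (Polynomial.order c P) - int (Polynomial.order c Q) =
          (\<Sum>u\<in>{u\<in>S1. cc u = c}. int (nat (- D u)) - int (nat (D u)))"
          using oP[of c] oQ[of c] by (simp only: sum_subtractf of_nat_sum)
        moreover have "(\<Sum>u\<in>{u\<in>S1. cc u = c}. int (nat (- D u)) - int (nat (D u))) = - D v"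
        proof (cases "v \<in> S")
          case True
          then have v1: "v \<in> S1" using c unfolding S1_def by blast
          have "{u\<in>S1. cc u = c} = {v}"
          proof -
            have "cc v = c"
            proof (rule ccontr)
              assume "cc v \<noteq> c"
              then have "Polynomial.order c [:- cc v, 1:] = 0" by (intro order_0I) simp
              moreover have "Polynomial.order (cc v) [:- cc v, 1:] = 1" using order_power_n_n[of "cc v" 1] by simp
              moreover have "[:- cc v, 1:] \<noteq> 0" by simp
              ultimately show False using c cc1[OF v1] unfolding fin_def by (metis of_nat_0 of_nat_1 zero_neq_one)
            qed
            moreover have "u = v" if "u \<in> S1" "cc u = c" for u
              using uniq[OF _ v _ c] cc1[OF that(1)] that S(2) unfolding S1_def by blast
            ultimately show ?thesis using v1 by blast
          qed
          then show ?thesis by (simp add: nn)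
        next
          case False
          have "{u\<in>S1. cc u = c} = {}"
            using uniq[OF _ v _ c] cc1 S(2) False unfolding S1_def by blast
          then show ?thesis using False by (simp only: sum.empty) (simp add: S_def)
        qed
        ultimately show ?thesis by simp
      qed
    qed
    then show ?thesis unfolding riemann_roch_space_def using el_in[OF Q] by simp
  qed
  have "length (map (\<lambda>i. el (P * [:0, 1:] ^ i) Q) [0..<Suc n]) \<le> n"
    by (rule independent_length_le_dimension[OF subf dim independent_powers[OF P Q]]) (use mem in auto)
  then show False by simp
qed

text \<open>A divisor attaining the value 1 would satisfy dim L(D) = deg D.\<close>

theorem not_genus_1: "\<not> has_genus R k 1"
proof
  assume "has_genus R k 1"
  then obtain D n where "D \<in> divisors R k" "dimension n k (riemann_roch_space R k D)"
    "div_degree D + 1 - int n = 1" unfolding has_genus_def by blast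
  then show False using dimension_ge by force
qed

end

section \<open>Squarefreeness of the discriminant\<close>

definition ratvals :: "complex fls \<Rightarrow> complex fls set" where
  "ratvals Z = {fls_poly p Z / fls_poly q Z | p q. q \<noteq> 0}"

lemma ratvals_intros:
  assumes "nonconst Z"
  shows ratvals_const: "fls_const c \<in> ratvals Z"
    and ratvals_self: "Z \<in> ratvals Z"
    and ratvals_add: "x \<in> ratvals Z \<Longrightarrow> y \<in> ratvals Z \<Longrightarrow> x + y \<in> ratvals Z"
    and ratvals_mult: "x \<in> ratvals Z \<Longrightarrow> y \<in> ratvals Z \<Longrightarrow> x * y \<in> ratvals Z"
    and ratvals_inverse: "x \<in> ratvals Z \<Longrightarrow> inverse x \<in> ratvals Z"
proof -
  have I: "x \<in> ratvals Z" if "x = fls_poly p Z / fls_poly q Z" "q \<noteq> 0" for x p q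
    using that unfolding ratvals_def by blast
  show "fls_const c \<in> ratvals Z" by (rule I[of _ "[:c:]" 1]) auto
  show "Z \<in> ratvals Z" by (rule I[of _ "[:0, 1:]" 1]) auto
  show "inverse x \<in> ratvals Z" if x: "x \<in> ratvals Z"
  proof -
    obtain p q where pq: "x = fls_poly p Z / fls_poly q Z" "q \<noteq> 0" using x unfolding ratvals_def by blast
    show ?thesis
    proof (cases "p = 0")
      case True
      then show ?thesis by (intro I[of _ 0 1]) (auto simp: pq)
    next
      case False
      then show ?thesis by (intro I[of _ q p]) (auto simp: pq)
    qed
  qed
  assume "x \<in> ratvals Z" "y \<in> ratvals Z"
  then obtain p q p' q' where pq: "x = fls_poly p Z / fls_poly q Z" "q \<noteq> 0" "y = fls_poly p' Z / fls_poly q' Z" "q' \<noteq> 0"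
    unfolding ratvals_def by blast
  have nz: "fls_poly q Z \<noteq> 0" "fls_poly q' Z \<noteq> 0" using fls_poly_nonzero[OF assms] pq by auto
  show "x + y \<in> ratvals Z"
    by (rule I[of _ "p * q' + p' * q" "q * q'"]) (use pq nz in \<open>auto simp: add_frac_eq\<close>)
  show "x * y \<in> ratvals Z"
    by (rule I[of _ "p * p'" "q * q'"]) (use pq in auto)
qed

lemma ratvals_fls_poly:
  assumes "nonconst Z" "x \<in> ratvals Z"
  shows "fls_poly p x \<in> ratvals Z"
proof (induction p)
  case 0
  show ?case using ratvals_const[OF assms(1), of 0] by simp
next
  case (pCons c p)
  then show ?case using assms by (simp add: ratvals_add ratvals_mult ratvals_const)
qed

context kern
begin

lemma repr_determined:
  assumes "repr f e" "repr f' e'" "\<gamma> \<in> Arcs d t"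
  shows "f = f' \<longleftrightarrow> rf \<gamma> e = rf \<gamma> e'"
  using assms ratio_eq_iff' unfolding repr_def by metis

lemma constants_subfield: "subfield (constants K) F"
proof -
  interpret field F by (rule function_field_field)
  have c: "const2 c = [:[:c:]:]" for c by (simp add: const2_def)
  note [simp] = mult_ratio add_ratio K_not_dvd_1 ratio_in
  have mem: "ratio K (const2 c) 1 \<in> constants K" for c by (simp add: constants_def)
  have cases: thesis if "x \<in> constants K" "\<And>c. x = ratio K (const2 c) 1 \<Longrightarrow> thesis" for x thesis
    using that by (auto simp: constants_def)
  have one: "\<one>\<^bsub>F\<^esub> = ratio K (const2 1) 1" by (simp add: one_F c one_pCons)
  have zero: "\<zero>\<^bsub>F\<^esub> = ratio K (const2 0) 1" by (simp add: zero_F c)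
  have mult: "ratio K (const2 a) 1 \<otimes>\<^bsub>F\<^esub> ratio K (const2 b) 1 = ratio K (const2 (a * b)) 1" for a b by (simp add: c)
  have add: "ratio K (const2 a) 1 \<oplus>\<^bsub>F\<^esub> ratio K (const2 b) 1 = ratio K (const2 (a + b)) 1" for a b by (simp add: c)
  have sub: "subring (constants K) F"
  proof (rule subringI)
    show "constants K \<subseteq> carrier F" by (auto simp: constants_def)
    show "\<one>\<^bsub>F\<^esub> \<in> constants K" unfolding one by (rule mem)
    show "\<ominus>\<^bsub>F\<^esub> h \<in> constants K" if "h \<in> constants K" for h
    proof (rule cases[OF that])
      fix a assume h: "h = ratio K (const2 a) 1"
      have "ratio K (const2 (- a)) 1 \<oplus>\<^bsub>F\<^esub> h = \<zero>\<^bsub>F\<^esub>" unfolding h add zero by simp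
      then have "\<ominus>\<^bsub>F\<^esub> h = ratio K (const2 (- a)) 1" by (rule minus_equality) (simp_all add: h)
      then show ?thesis using mem by simp
    qed
    show "h \<otimes>\<^bsub>F\<^esub> h' \<in> constants K" "h \<oplus>\<^bsub>F\<^esub> h' \<in> constants K"
      if "h \<in> constants K" "h' \<in> constants K" for h h'
      using that mult add mem by (metis cases)+
  qed
  show ?thesis
  proof (rule subfieldI'[OF sub])
    fix h assume h: "h \<in> constants K - {\<zero>\<^bsub>F\<^esub>}"
    then obtain a where a: "h = ratio K (const2 a) 1" using cases by blast
    then have "a \<noteq> 0" using h zero by auto
    then have "h \<otimes>\<^bsub>F\<^esub> ratio K (const2 (1 / a)) 1 = \<one>\<^bsub>F\<^esub>" unfolding a mult one by simp
    then have "inv\<^bsub>F\<^esub> h = ratio K (const2 (1 / a)) 1" by (intro comm_inv_char) (simp_all add: a)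
    then show "inv\<^bsub>F\<^esub> h \<in> constants K" using mem by simp
  qed
qed

text \<open>Evaluation along the one arc \<gamma> is an embedding of the function field. Its image
  is contained in C(Z) because both coordinates are, and exhausts it because Z is the value of a
  function.\<close>

lemma not_genus_1_if_rational:
  assumes g: "\<gamma> \<in> Arcs d t" and Z: "nonconst Z" "Z = rf \<gamma> z"
    and x: "fst \<gamma> \<in> ratvals Z" and y: "snd \<gamma> \<in> ratvals Z"
  shows "\<not> has_genus F (constants K) 1"
proof -
  \<comment> \<open>The choice of term is immaterial: terms representing the same class have the
    same value along \<gamma>.\<close>
  define \<phi> where "\<phi> f = rf \<gamma> (SOME e. repr f e)" for f
  have \<phi>: "\<phi> f = rf \<gamma> e" if "repr f e" for f e
    using repr_determined[OF someI[of "repr f", OF that] that g] unfolding \<phi>_def by simp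
  have mem: "rf \<gamma> e \<in> ratvals Z" for e
    by (induction e) (use x y ratvals_intros[OF Z(1)] in auto)
  have img: "\<phi> ` carrier F = ratvals Z"
  proof (intro equalityI subsetI)
    fix w assume "w \<in> \<phi> ` carrier F"
    then show "w \<in> ratvals Z" using mem unfolding \<phi>_def by auto
  next
    fix w assume "w \<in> ratvals Z"
    then obtain p q where w: "w = fls_poly p Z / fls_poly q Z" unfolding ratvals_def by blast
    obtain a where a: "\<And>\<gamma>. rf \<gamma> a = fls_poly p (rf \<gamma> z)" using poly_rexp by blast
    obtain b where b: "\<And>\<gamma>. rf \<gamma> b = fls_poly q (rf \<gamma> z)" using poly_rexp by blast
    obtain f where f: "repr f (Mul a (Inv b))" using ex_repr_fun by blast
    have "\<phi> f = w" unfolding \<phi>[OF f] w Z(2) by (simp add: a b divide_inverse)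
    then show "w \<in> \<phi> ` carrier F" using repr_in[OF f] by blast
  qed
  have const: "repr (ratio K (const2 c) 1) (Cst c)" for c
    unfolding repr_def by (intro exI[of _ "const2 c"] exI[of _ 1]) (simp add: K_not_dvd_1 const2_def)
  have "rational_field F (constants K) \<phi> Z"
  proof (intro rational_field.intro function_field_field rational_field_axioms.intro constants_subfield Z(1))
    show "inj_on \<phi> (carrier F)"
    proof (rule inj_onI)
      fix f f' assume f: "f \<in> carrier F" "f' \<in> carrier F" "\<phi> f = \<phi> f'"
      obtain e e' where "repr f e" "repr f' e'" using f ex_repr_rexp by blast
      then show "f = f'" using repr_determined[OF _ _ g] \<phi> f(3) by metis
    qed
    fix f f' assume "f \<in> carrier F" "f' \<in> carrier F"
    then obtain e e' where e: "repr f e" "repr f' e'" using ex_repr_rexp by blast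
    show "\<phi> (f \<oplus>\<^bsub>F\<^esub> f') = \<phi> f + \<phi> f'" using \<phi>[OF repr_add[OF e]] \<phi>[OF e(1)] \<phi>[OF e(2)] by simp
    show "\<phi> (f \<otimes>\<^bsub>F\<^esub> f') = \<phi> f * \<phi> f'" using \<phi>[OF repr_mult[OF e]] \<phi>[OF e(1)] \<phi>[OF e(2)] by simp
  next
    show "\<phi> ` carrier F = {fls_poly p Z / fls_poly q Z |p q. q \<noteq> 0}" using img by (simp add: ratvals_def)
    show "\<phi> ` constants K = range fls_const"
      unfolding constants_def image_image using \<phi>[OF const] by simp
  qed
  then show ?thesis by (rule rational_field.not_genus_1)
qed

end

text \<open>The square of e/(u v) absorbs the square factor and one copy of v. For v and w linear in
  x the resulting relation is linear in x and can be solved for it.\<close>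

lemma conic_parameter:
  fixes u v w e :: "'a::field"
  assumes "u \<noteq> 0" "v \<noteq> 0" "e ^ 2 = u ^ 2 * (v * w)"
  shows "(e / (u * v)) ^ 2 * v = w"
proof -
  have "(e / (u * v)) ^ 2 * v = (u ^ 2 * (v * w)) / (u ^ 2 * v ^ 2) * v"
    by (simp add: power_divide power_mult_distrib assms(3))
  then show ?thesis using assms(1,2) by (simp add: power2_eq_square)
qed

locale kern_walk = kern + walk
begin

lemma squarefree_if_genus_1:
  assumes genus: "has_genus F (constants K) 1"
  shows "Polynomial.order r (disc d t) \<le> 1"
proof (rule ccontr)
  assume "\<not> ?thesis"
  then have "[:- r, 1:] ^ 2 dvd disc d t" by (simp add: order_divides)
  \<comment> \<open>The quartic divided by (x - r)^2 leaves a quadratic, written below as (x - s)(l0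
    + l1 x).\<close>
  then obtain D' where D': "disc d t = [:- r, 1:] ^ 2 * D'" by blast
  then have "D' \<noteq> 0" using disc_nz by auto
  then have "degree D' = 2" using degree_disc unfolding D' by (subst (asm) degree_mult_eq) (auto simp: degree_linear_power)
  then obtain s where "poly D' s = 0"
    using fundamental_theorem_of_algebra[of D'] constant_degree[of D'] by auto
  then obtain L where L: "D' = [:- s, 1:] * L" by (metis poly_eq_0_iff_dvd dvdE)
  then have "L \<noteq> 0" using \<open>D' \<noteq> 0\<close> by auto
  then have "degree L = 1" using \<open>degree D' = 2\<close> unfolding L by (subst (asm) degree_mult_eq) auto
  then obtain l0 l1 where l: "L = [:l0, l1:]" "l1 \<noteq> 0"
    by (metis degree_pCons_eq_if degree_eq_zeroE pCons_cases One_nat_def Suc_inject zero_neq_one pCons_eq_0_iff)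
  obtain \<gamma> where g: "\<gamma> \<in> Arcs d t" using ex_arc by blast
  define x where "x = fst \<gamma>"
  have sq: "\<delta> \<gamma> ^ 2 = (x - fls_const r) ^ 2 * ((x - fls_const s) * (fls_const l0 + fls_const l1 * x))"
  proof -
    have "\<delta> \<gamma> ^ 2 = fls_poly ([:- r, 1:] ^ 2 * ([:- s, 1:] * [:l0, l1:])) x"
      using disc_root_square[OF g] unfolding D' L l x_def .
    then show ?thesis by (simp only: fls_poly_mult fls_poly_power) (simp add: mult.commute)
  qed
  have nz: "x - fls_const r \<noteq> 0" "x - fls_const s \<noteq> 0" using nonconst_nz[OF ArcsD(2)[OF g]] by (auto simp: x_def)
  show False
  proof (cases "l0 + l1 * s = 0")
    \<comment> \<open>Here s is a double root of the quadratic, so D is the square of m (x - r)(x -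
      s) and \<delta> would lie in C(x), against \<open>ind1\<close>.\<close>
    case True
    define m where "m = csqrt l1"
    have l0: "l0 = - (l1 * s)" using True by (simp add: eq_neg_iff_add_eq_0)
    have "l1 = m ^ 2" by (simp add: m_def)
    define u where "u = Polynomial.smult m ([:- r, 1:] * [:- s, 1:])"
    have c1: "fls_const l1 = fls_const m * fls_const m" by (simp add: \<open>l1 = m ^ 2\<close> power2_eq_square)
    have c0: "fls_const l0 = - (fls_const l1 * fls_const s)" by (simp add: l0)
    have "\<delta> \<gamma> ^ 2 = fls_const m ^ 2 * ((x - fls_const r) * (x - fls_const s)) ^ 2"
      unfolding sq c0 unfolding c1 by (simp add: power2_eq_square algebra_simps del: fls_const_mult_const)
    moreover have "fls_poly u x = fls_const m * ((x - fls_const r) * (x - fls_const s))"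
      unfolding u_def fls_poly_smult fls_poly_mult by simp
    ultimately have "\<delta> \<gamma> ^ 2 - fls_poly u x ^ 2 = 0" by (simp only: power_mult_distrib) simp
    moreover have "(fls_poly (- u) x + fls_poly 1 x * \<delta> \<gamma>) * (fls_poly u x + fls_poly 1 x * \<delta> \<gamma>) = \<delta> \<gamma> ^ 2 - fls_poly u x ^ 2"
      by (simp add: algebra_simps power2_eq_square)
    ultimately have "(fls_poly (- u) x + fls_poly 1 x * \<delta> \<gamma>) * (fls_poly u x + fls_poly 1 x * \<delta> \<gamma>) = 0" by (simp only:)
    then have "fls_poly (- u) x + fls_poly 1 x * \<delta> \<gamma> = 0 \<or> fls_poly u x + fls_poly 1 x * \<delta> \<gamma> = 0" by (simp only: mult_eq_0_iff)
    then show False using ind1[OF ArcsD(1)[OF g], of "- u" 1] ind1[OF ArcsD(1)[OF g], of u 1]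
      unfolding x_def by auto
  next
    case False
    define q where "q = (x - fls_const r) * (x - fls_const s)"
    \<comment> \<open>With w = \<delta> / (x - r) the curve becomes the conic w^2 = (x - s)(l0 + l1
      x) through (s, 0), and Z is the slope w / (x - s) of lines through that point.\<close>
    define Z where "Z = \<delta> \<gamma> / q"
    have q: "q \<noteq> 0" using nz by (simp add: q_def)
    have dZ: "\<delta> \<gamma> = Z * q" using q by (simp add: Z_def)
    have Z2: "Z ^ 2 * (x - fls_const s) = fls_const l0 + fls_const l1 * x"
      unfolding Z_def q_def by (rule conic_parameter[OF nz sq])
    have "(Z ^ 2 - fls_const l1) * (x - fls_const s) = Z ^ 2 * (x - fls_const s) - fls_const l1 * (x - fls_const s)"
      by (rule left_diff_distrib)
    also have "\<dots> = fls_const l0 + fls_const l1 * fls_const s"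
      unfolding Z2 by (simp add: right_diff_distrib del: fls_const_mult_const)
    finally have Z3: "(Z ^ 2 - fls_const l1) * (x - fls_const s) = fls_const (l0 + l1 * s)"
      by (simp add: fls_plus_const)
    \<comment> \<open>As l0 + l1 s is nonzero, the coefficient of x in the linear equation does not
      vanish, and x is a fraction in Z^2.\<close>
    have "fls_const (l0 + l1 * s) \<noteq> 0" using False by simp
    then have nz2: "Z ^ 2 - fls_const l1 \<noteq> 0" using Z3 by auto
    have x: "x = (fls_const l0 + fls_const s * Z ^ 2) / (Z ^ 2 - fls_const l1)"
    proof -
      have "x * (Z ^ 2 - fls_const l1) = fls_const l0 + fls_const s * Z ^ 2" using Z2 by (simp add: algebra_simps)
      then show ?thesis using nz2 by (simp add: eq_divide_eq)
    qed
    have Znc: "nonconst Z"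
      unfolding nonconst_def
    proof safe
      fix c assume c: "Z = fls_const c"
      have "x = fls_const ((l0 + s * c ^ 2) / (c ^ 2 - l1))"
        unfolding x c fls_const_power[symmetric] fls_const_mult_const fls_plus_const fls_minus_const fls_const_divide_const ..
      then show False using ArcsD(2)[OF g] by (auto simp: x_def nonconst_def)
    qed
    note I = ratvals_intros[OF Znc]
    have diff: "a - b \<in> ratvals Z" if "a \<in> ratvals Z" "b \<in> ratvals Z" for a b
      using I(3)[OF that(1) I(4)[OF I(1)[of "-1"] that(2)]] by simp
    have div: "a / b \<in> ratvals Z" if "a \<in> ratvals Z" "b \<in> ratvals Z" for a b
      unfolding divide_inverse using that I by blast
    have xin: "x \<in> ratvals Z"
      unfolding x power2_eq_square by (intro div diff I)
    have "snd \<gamma> = (\<delta> \<gamma> - fls_poly (pB d t) x) / (fls_const 2 * fls_poly (pA d t) x)"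
      using ArcsD(5)[OF g] by (simp add: disc_root_def x_def)
    also have "\<dots> \<in> ratvals Z"
      unfolding dZ q_def by (intro div diff I ratvals_fls_poly[OF Znc] xin)
    finally have yin: "snd \<gamma> \<in> ratvals Z" .
    obtain a where a: "\<And>\<gamma>. rf \<gamma> a = fls_poly (pA d t) (rf \<gamma> VX)" using poly_rexp by blast
    obtain b where b: "\<And>\<gamma>. rf \<gamma> b = fls_poly (pB d t) (rf \<gamma> VX)" using poly_rexp by blast
    have "Z = rf \<gamma> (Mul (Add (Mul (Cst 2) (Mul a VY)) b) (Inv (Mul (Add VX (Cst (- r))) (Add VX (Cst (- s))))))"
      by (simp add: Z_def q_def disc_root_def a b x_def divide_inverse mult.assoc)
    from not_genus_1_if_rational[OF g Znc this xin[unfolded x_def] yin] genus show False by blast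
  qed
qed

end

section \<open>The certificate problem\<close>

text \<open>Vieta at points: off the roots of A, \<open>iota1\<close> is given by the formula that
  defines \<open>arc_iota1\<close>, so one term describes both actions.\<close>

lemma (in biquad) iota1_affine:
  assumes "(affine x y) \<in> E" "poly (pA d t) x \<noteq> 0"
  shows "iota1 d t (affine x y) =
    (cp1_of_complex x, cp1_of_complex (- poly (pB d t) x / poly (pA d t) x - y))"
proof (rule iota1_eqI)
  define A B C where ABC: "A = poly (pA d t) x" "B = poly (pB d t) x" "C = poly (pC d t) x"
  define y' where "y' = - B / A - y"
  have A: "A \<noteq> 0" using assms(2) by (simp add: ABC)
  have B: "B = - A * (y + y')" using A by (simp add: y'_def field_simps)
  have h: "kernel_hom d t x 1 y0 y1 = A * y0 ^ 2 + B * y0 * y1 + C * y1 ^ 2" for y0 y1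
    by (simp add: kernel_hom_form ABC fA_def fB_def fC_def pA_def pB_def pC_def algebra_simps power2_eq_square)
  have "A * y ^ 2 + B * y + C = 0"
    using assms(1) h[of y 1] by (simp add: kernel_curve_def of_complex_mk on_curve_mk)
  then have "C = - (A * y ^ 2 + B * y)" by (rule sum3_zeroD)
  then have C: "C = A * (y * y')" by (simp add: B algebra_simps power2_eq_square)
  have "kernel_hom d t x 1 y0 y1 = A * ((1 * y0 - y * y1) * (1 * y0 - y' * y1))" for y0 y1
    unfolding h B C by (simp add: algebra_simps power2_eq_square)
  then have "x_fibre d t (cp1_of_complex x) (cp1_of_complex y) (cp1_of_complex y')"
    using A by (auto simp: of_complex_mk x_fibre_mk)
  then show "same_x_pair d t (fst (affine x y)) (affine x y)
     (cp1_of_complex x, cp1_of_complex (- poly (pB d t) x / poly (pA d t) x - y))"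
    by (simp add: same_x_pair_def y'_def ABC)
qed

context kern
begin

text \<open>\<open>iota2\<close> preserves y, so the same term \<open>v\<close> is the y-coordinate
  of \<open>iota1\<close> and of \<tau>.\<close>

lemma rational_maps:
  "\<exists>u v. (\<forall>\<gamma>\<in>Arcs d t. (fst \<gamma>, rf \<gamma> v) = arc_iota1 d t \<gamma>) \<and>
    (\<forall>\<gamma>\<in>Arcs d t. (rf \<gamma> u, rf \<gamma> v) = arcs.rot 1 \<gamma>) \<and>
    almost_all (\<lambda>x y. iota1 d t (affine x y) = affine x (rc x y v)) \<and>
    almost_all (\<lambda>x y. tau d t (affine x y) = affine (rc x y u) (rc x y v))"
proof -
  interpret sw: biquad "flip d" t by (rule biquad_flip)
  obtain v where v: "\<And>\<gamma>. rf \<gamma> v = snd (arc_iota1 d t \<gamma>)"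
    "\<And>x y. rc x y v = - poly (pB d t) x / poly (pA d t) x - y" using arc_iota1_rexp by blast
  obtain e where e: "\<And>\<gamma>. rf \<gamma> e = fst (arc_iota2 d t \<gamma>)"
    "\<And>x y. rc x y e = - poly (pB (flip d) t) y / poly (pA (flip d) t) y - x" using arc_iota2_rexp by blast
  obtain a where a: "\<And>\<gamma>. rf \<gamma> a = fls_poly (pA (flip d) t) (rf \<gamma> v)" "\<And>x y. rc x y a = poly (pA (flip d) t) (rc x y v)"
    using poly_rexp by blast
  have i1: "iota1 d t (affine x y) = affine x (rc x y v)"
    if "eval2 K x y = 0" "poly (pA d t) x \<noteq> 0" for x y
    using iota1_affine[of x y] that by (simp add: on_curve_affine v)
  have n1: "almost_all (\<lambda>x y. poly (pA d t) x \<noteq> 0)" by (rule almost_all_poly_nz[OF pA_nz])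
  \<comment> \<open>The second involution is applied at the conjugate y-coordinate, so the leading
    coefficient of the flipped kernel has to be nonzero there.\<close>
  have n2: "almost_all (\<lambda>x y. rc x y a \<noteq> 0)"
    by (rule almost_all_rexp_nz) (use fls_poly_nonzero[OF _ A2] ArcsD(3)[OF arc_iota1_in] in \<open>simp add: a v\<close>)
  show ?thesis
  proof (rule exI[of _ "rexp_subst VX v e"], rule exI[of _ v], intro conjI ballI)
    fix \<gamma> assume g: "\<gamma> \<in> Arcs d t"
    show 1: "(fst \<gamma>, rf \<gamma> v) = arc_iota1 d t \<gamma>" by (simp add: v prod_eq_iff)
    have "rf \<gamma> (rexp_subst VX v e) = fst (arc_iota2 d t (arc_iota1 d t \<gamma>))" using e(1)[of "arc_iota1 d t \<gamma>"] by (simp add: rexp_eval_rexp_subst v)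
    moreover have "rf \<gamma> v = snd (arc_iota2 d t (arc_iota1 d t \<gamma>))" by (simp add: v snd_arc_iota2)
    ultimately show "(rf \<gamma> (rexp_subst VX v e), rf \<gamma> v) = arcs.rot 1 \<gamma>" by (simp add: arcs.rot_1)
  next
    show "almost_all (\<lambda>x y. iota1 d t (affine x y) = affine x (rc x y v))"
      by (rule almost_all_mono[OF n1 i1])
    show "almost_all (\<lambda>x y. tau d t (affine x y) = affine (rc x y (rexp_subst VX v e)) (rc x y v))"
    proof (rule almost_all_mono[OF almost_all_conj[OF n1 n2]], elim conjE)
      fix x y assume xy: "eval2 K x y = 0" "poly (pA d t) x \<noteq> 0" "rc x y a \<noteq> 0"
      define y' where "y' = rc x y v"
      have "iota1 d t (affine x y) \<in> E"
        using xy(1) by (intro iota1_in) (simp add: on_curve_affine)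
      then have in1: "(affine x y') \<in> E" unfolding i1[OF xy(1,2)] y'_def .
      then have in2: "(cp1_of_complex y', cp1_of_complex x) \<in> sw.E"
        using swap_in[of "(affine x y')"] by simp
      have "poly (pA (flip d) t) y' \<noteq> 0" using xy(3) by (simp add: a y'_def)
      from sw.iota1_affine[OF in2 this]
      have "iota2 d t (affine x y') =
        (cp1_of_complex (- poly (pB (flip d) t) y' / poly (pA (flip d) t) y' - x), cp1_of_complex y')"
        using iota2_flip[OF in1] by simp
      then show "tau d t (affine x y) = affine (rc x y (rexp_subst VX v e)) (rc x y v)"
        by (simp add: tau_def i1[OF xy(1,2)] rexp_eval_rexp_subst e y'_def)
    qed
  qed
qed

text \<open>The pullback by \<tau> is substitution of its terms, which along arcs is evaluation at
  the rotated arc. The problem thereby becomes one about terms and arcs.\<close>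

lemma has_certificate_iff:
  assumes "repr b e"
  shows "has_certificate d t b \<longleftrightarrow> (\<exists>g. \<forall>\<gamma>\<in>Arcs d t. rf \<gamma> e = rf (arcs.rot 1 \<gamma>) g - rf \<gamma> g)"
proof -
  obtain v u where uv: "\<And>\<gamma>. \<gamma> \<in> Arcs d t \<Longrightarrow> (fst \<gamma>, rf \<gamma> v) = arc_iota1 d t \<gamma>"
    "\<And>\<gamma>. \<gamma> \<in> Arcs d t \<Longrightarrow> (rf \<gamma> u, rf \<gamma> v) = arcs.rot 1 \<gamma>"
    "almost_all (\<lambda>x y. iota1 d t (affine x y) = affine x (rc x y v))"
    "almost_all (\<lambda>x y. tau d t (affine x y) = affine (rc x y u) (rc x y v))"
    using rational_maps by blast
  have key: "b = pullback d t (tau d t) f \<ominus>\<^bsub>F\<^esub> f \<longleftrightarrow> (\<forall>\<gamma>\<in>Arcs d t. rf \<gamma> e = rf (arcs.rot 1 \<gamma>) g - rf \<gamma> g)"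
    if f: "repr f g" for f g
  proof -
    have "repr (pullback d t (tau d t) f) (rexp_subst u v g)"
      by (rule repr_pullback[OF f _ uv(4)])
         (use arcs.rot_in in \<open>auto simp: uv(2) tau_def iota1_in iota2_in\<close>)
    from repr_minus[OF this f] have r: "repr (pullback d t (tau d t) f \<ominus>\<^bsub>F\<^esub> f) (Add (rexp_subst u v g) (Mul (Cst (-1)) g))" .
    have "rf \<gamma> (Add (rexp_subst u v g) (Mul (Cst (-1)) g)) = rf (arcs.rot 1 \<gamma>) g - rf \<gamma> g" if "\<gamma> \<in> Arcs d t" for \<gamma>
      using uv(2)[OF that, symmetric] by (simp add: rexp_eval_rexp_subst)
    then show ?thesis using repr_eq_iff[OF assms r] by simp
  qed
  show ?thesis unfolding has_certificate_def using key ex_repr_rexp ex_repr_fun repr_in by meson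
qed

lemma repr_b:
  "\<exists>e. repr (x_fun d t \<otimes>\<^bsub>F\<^esub> (pullback d t (iota1 d t) (y_fun d t) \<ominus>\<^bsub>F\<^esub> y_fun d t)) e \<and>
     (\<forall>\<gamma>\<in>Arcs d t. rf \<gamma> e = fst \<gamma> * (snd (arcs.rot 1 \<gamma>) - snd \<gamma>))"
proof -
  obtain v u where uv: "\<And>\<gamma>. \<gamma> \<in> Arcs d t \<Longrightarrow> (fst \<gamma>, rf \<gamma> v) = arc_iota1 d t \<gamma>"
    "\<And>\<gamma>. \<gamma> \<in> Arcs d t \<Longrightarrow> (rf \<gamma> u, rf \<gamma> v) = arcs.rot 1 \<gamma>"
    "almost_all (\<lambda>x y. iota1 d t (affine x y) = affine x (rc x y v))"
    "almost_all (\<lambda>x y. tau d t (affine x y) = affine (rc x y u) (rc x y v))"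
    using rational_maps by blast
  have X: "repr (x_fun d t) VX" unfolding repr_def x_fun_def
    by (intro exI[of _ X] exI[of _ 1]) (simp add: K_not_dvd_1 X_def)
  have Y: "repr (y_fun d t) VY" unfolding repr_def y_fun_def
    by (intro exI[of _ Y] exI[of _ 1]) (simp add: K_not_dvd_1 Y_def)
  have "repr (pullback d t (iota1 d t) (y_fun d t)) (rexp_subst VX v VY)"
    by (rule repr_pullback[OF Y]) (use arc_iota1_in iota1_in uv(3) in \<open>auto simp: uv(1)\<close>)
  from repr_mult[OF X repr_minus[OF this Y]] show ?thesis
  proof (intro exI conjI ballI)
    fix \<gamma> assume "\<gamma> \<in> Arcs d t"
    then have "rf \<gamma> v = snd (arcs.rot 1 \<gamma>)" using uv(2) by (metis snd_conv)
    then show "rf \<gamma> (Mul VX (Add (rexp_subst VX v VY) (Mul (Cst (-1)) VY))) = fst \<gamma> * (snd (arcs.rot 1 \<gamma>) - snd \<gamma>)"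
      by simp
  qed
qed

end

context kern_walk
begin

text \<open>Vieta gives A (\<tau> y - y) = -\<delta>; splitting off the constant term of the linear
  polynomial A isolates x (\<tau> y - y), up to a multiple of \<tau> y - y.\<close>

lemma step_y:
  assumes g: "\<gamma> \<in> Arcs d t"
  shows "fls_const (kernel_coeff d t 1 2) * (fst \<gamma> * (snd (arcs.rot 1 \<gamma>) - snd \<gamma>)) =
    - \<delta> \<gamma> - fls_const (kernel_coeff d t 0 2) * (snd (arcs.rot 1 \<gamma>) - snd \<gamma>)"
proof -
  have s: "snd (arcs.rot 1 \<gamma>) = - fls_poly (pB d t) (fst \<gamma>) / fls_poly (pA d t) (fst \<gamma>) - snd \<gamma>"
    by (simp add: arcs.rot_1 snd_arc_iota2 arc_iota1_def)
  have "fls_poly (pA d t) (fst \<gamma>) * (snd (arcs.rot 1 \<gamma>) - snd \<gamma>) = - \<delta> \<gamma>"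
    unfolding s using ArcsD(5)[OF g] by (simp add: disc_root_def field_simps)
  moreover have "fls_poly (pA d t) (fst \<gamma>) = fls_const (kernel_coeff d t 0 2) + fst \<gamma> * fls_const (kernel_coeff d t 1 2)"
    unfolding pA_def O_on by simp
  ultimately show ?thesis by (simp add: algebra_simps)
qed

lemma certificate_delta_iff:
  "(\<exists>g. \<forall>\<gamma>\<in>Arcs d t. fst \<gamma> * (snd (arcs.rot 1 \<gamma>) - snd \<gamma>) = rf (arcs.rot 1 \<gamma>) g - rf \<gamma> g) \<longleftrightarrow>
   (\<exists>e. \<forall>\<gamma>\<in>Arcs d t. rf (arcs.rot 1 \<gamma>) e - rf \<gamma> e = \<delta> \<gamma>)"
proof -
  let ?c = "kernel_coeff d t 1 2" and ?a = "kernel_coeff d t 0 2"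
  have c: "fls_const ?c \<noteq> 0" using kc12 by simp
  show ?thesis
  proof
    assume "\<exists>g. \<forall>\<gamma>\<in>Arcs d t. fst \<gamma> * (snd (arcs.rot 1 \<gamma>) - snd \<gamma>) = rf (arcs.rot 1 \<gamma>) g - rf \<gamma> g"
    then obtain g where g: "\<And>\<gamma>. \<gamma> \<in> Arcs d t \<Longrightarrow> fst \<gamma> * (snd (arcs.rot 1 \<gamma>) - snd \<gamma>) = rf (arcs.rot 1 \<gamma>) g - rf \<gamma> g"
      by blast
    \<comment> \<open>Solving \<open>step_y\<close> for \<delta>: the multiple of \<tau> y - y is
      the certificate difference of a multiple of y.\<close>
    let ?e = "Add (Mul (Cst (- ?c)) g) (Mul (Cst (- ?a)) VY)"
    have "rf (arcs.rot 1 \<gamma>) ?e - rf \<gamma> ?e = \<delta> \<gamma>" if \<gamma>: "\<gamma> \<in> Arcs d t" for \<gamma>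
      using step_y[OF \<gamma>, unfolded g[OF \<gamma>]] by (simp add: algebra_simps)
    then show "\<exists>e. \<forall>\<gamma>\<in>Arcs d t. rf (arcs.rot 1 \<gamma>) e - rf \<gamma> e = \<delta> \<gamma>" by blast
  next
    assume "\<exists>e. \<forall>\<gamma>\<in>Arcs d t. rf (arcs.rot 1 \<gamma>) e - rf \<gamma> e = \<delta> \<gamma>"
    then obtain e where e: "\<And>\<gamma>. \<gamma> \<in> Arcs d t \<Longrightarrow> rf (arcs.rot 1 \<gamma>) e - rf \<gamma> e = \<delta> \<gamma>" by blast
    let ?h = "Add e (Mul (Cst ?a) VY)"
    let ?g = "Mul (Inv (Cst (- ?c))) ?h"
    have "fst \<gamma> * (snd (arcs.rot 1 \<gamma>) - snd \<gamma>) = rf (arcs.rot 1 \<gamma>) ?g - rf \<gamma> ?g" if \<gamma>: "\<gamma> \<in> Arcs d t" for \<gamma>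
    proof -
      have "fls_const ?c * (fst \<gamma> * (snd (arcs.rot 1 \<gamma>) - snd \<gamma>)) = - (rf (arcs.rot 1 \<gamma>) ?h - rf \<gamma> ?h)"
        using step_y[OF \<gamma>, folded e[OF \<gamma>]] by (simp add: algebra_simps)
      then have "fst \<gamma> * (snd (arcs.rot 1 \<gamma>) - snd \<gamma>) = - (rf (arcs.rot 1 \<gamma>) ?h - rf \<gamma> ?h) / fls_const ?c"
        using c by (simp add: eq_divide_eq mult.commute)
      also have "\<dots> = rf (arcs.rot 1 \<gamma>) ?g - rf \<gamma> ?g"
      proof -
        have "- (p - q) / w = inverse (- w) * p - inverse (- w) * q" if "w \<noteq> 0" for p q w :: "complex fls"
          using that by (simp add: field_simps)
        from this[OF c] show ?thesis by (simp only: rexp_eval.simps fls_const_uminus)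
      qed
      finally show ?thesis .
    qed
    then show "\<exists>g. \<forall>\<gamma>\<in>Arcs d t. fst \<gamma> * (snd (arcs.rot 1 \<gamma>) - snd \<gamma>) = rf (arcs.rot 1 \<gamma>) g - rf \<gamma> g" by blast
  qed
qed

end

theorem proposition4p4:
  fixes d :: "int \<Rightarrow> int \<Rightarrow> complex" and t :: complex
    and P0 P1 Q0 Q1 :: "cp1 \<times> cp1"
  assumes "\<not> algebraic t"
    and "irreducible (walk_kernel d t)"
    and "degree_x (walk_kernel d t) = 2" and "degree_y (walk_kernel d t) = 2"
    and "d 1 1 = 0"
    and "has_genus (function_field (walk_kernel d t)) (constants (walk_kernel d t)) 1"
    and "tau_infinite_order d t"
    and "same_x_pair d t cp1_infinity P0 P1"
    and "same_y_pair d t cp1_infinity Q0 Q1"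
    and "\<not> (\<exists>P \<in> {P0, P1}. \<exists>Q \<in> {Q0, Q1}.
            (iota1 d t P = P \<or> iota2 d t P = P) \<and> (iota1 d t Q = Q \<or> iota2 d t Q = Q))"
  shows "has_certificate d t
           (x_fun d t \<otimes>\<^bsub>function_field (walk_kernel d t)\<^esub>
             (pullback d t (iota1 d t) (y_fun d t) \<ominus>\<^bsub>function_field (walk_kernel d t)\<^esub> y_fun d t))
         \<longleftrightarrow> same_orbit d t P0 P1"
proof -
  interpret kern d t by (rule kern.intro) fact+
  interpret sw: biquad "flip d" t by (rule biquad_flip)
  let ?O = "(cp1_infinity, cp1_infinity)"
  have k22: "kernel_coeff d t 2 2 = 0" using assms(5) by (simp add: kernel_coeff_def)
  have O_in: "?O \<in> E"
    by (simp add: kernel_curve_def infinity_mk on_curve_mk kernel_hom_form fA_def k22)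
  have P: "P0 \<in> E" "P1 \<in> E" "P1 = iota1 d t P0" "P0 = iota1 d t P1" "fst P0 = cp1_infinity"
    using same_x_pair_in[OF assms(8)] by blast+
  have OP: "?O = P0 \<or> ?O = P1" using same_fst_cases[OF P(1) O_in] P(3,5) by simp
  have Q: "prod.swap Q0 \<in> sw.E" "prod.swap Q1 = iota1 (flip d) t (prod.swap Q0)" "fst (prod.swap Q0) = cp1_infinity"
    using sw.same_x_pair_in[OF assms(9)[unfolded same_y_pair_flip]] by blast+
  have "?O \<in> sw.E" using swap_in[of ?O] O_in by simp
  then have "?O = prod.swap Q0 \<or> ?O = prod.swap Q1" using sw.same_fst_cases[OF Q(1)] Q(2,3) by simp
  then have OQ: "?O = Q0 \<or> ?O = Q1" by (metis swap_simp swap_swap)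
  have nfix: "\<not> (iota1 d t ?O = ?O \<or> iota2 d t ?O = ?O)" using assms(10) OP OQ by auto
  interpret kern_walk d t by unfold_locales (use k22 nfix in auto)
  interpret smooth_walk d t
    by unfold_locales (use squarefree_if_genus_1[OF assms(6)] assms(7) in auto)
  obtain e where e: "repr (x_fun d t \<otimes>\<^bsub>F\<^esub> (pullback d t (iota1 d t) (y_fun d t) \<ominus>\<^bsub>F\<^esub> y_fun d t)) e"
     "\<And>\<gamma>. \<gamma> \<in> Arcs d t \<Longrightarrow> rf \<gamma> e = fst \<gamma> * (snd (arcs.rot 1 \<gamma>) - snd \<gamma>)"
    using repr_b by blast
  \<comment> \<open>Either of \<open>P0\<close> and \<open>P1\<close> may be O; inverting the
    rotation reduces one case to the other.\<close>
  have orbit: "same_orbit d t P0 P1 \<longleftrightarrow> (\<exists>n. pts.rot n ?O = iota1 d t ?O)"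
  proof -
    have inv: "R = pts.rot n S \<longleftrightarrow> pts.rot (- n) R = S" if "R \<in> E" "S \<in> E" for R S n
      using that pts.rot_add[of S "- n" n] pts.rot_add[of R n "- n"] by auto
    show ?thesis
    proof (cases "P0 = ?O")
      case True
      then have "P1 = iota1 d t ?O" using P(3) by simp
      then have "P0 = pts.rot n P1 \<longleftrightarrow> pts.rot (- n) ?O = iota1 d t ?O" for n
        using inv[OF P(1,2)] True by simp
      then show ?thesis unfolding same_orbit_iff[OF P(2)] by (metis minus_minus)
    next
      case False
      then have "P1 = ?O" using OP by simp
      then have "P0 = iota1 d t ?O" using P(4) by metis
      then show ?thesis unfolding same_orbit_iff[OF P(2)] by (metis \<open>P1 = ?O\<close>)
    qed
  qed
  have "has_certificate d t (x_fun d t \<otimes>\<^bsub>F\<^esub> (pullback d t (iota1 d t) (y_fun d t) \<ominus>\<^bsub>F\<^esub> y_fun d t)) \<longleftrightarrow>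
      (\<exists>g. \<forall>\<gamma>\<in>Arcs d t. fst \<gamma> * (snd (arcs.rot 1 \<gamma>) - snd \<gamma>) = rf (arcs.rot 1 \<gamma>) g - rf \<gamma> g)"
    using has_certificate_iff[OF e(1)] e(2) by simp
  also have "\<dots> \<longleftrightarrow> same_orbit d t P0 P1"
    unfolding certificate_delta_iff certificate_iff orbit ..
  finally show ?thesis .
qed

end
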